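(* Let $\boldsymbol u$ be the total displacement field solving the elastic scattering problem for a biperiodic rigid surface described in the context, and let $e_1^{(n)}$, $e_2^{(n)}$ ($n\in\mathbb Z^2$) be the associated grating efficiencies of the reflected compressional and shear modes. Then the total energy is conserved, i.e., $$\sum_{n\in U_1} e_1^{(n)}+\sum_{n\in U_2} e_2^{(n)}=1,$$ where $U_j=\{n\in\mathbb Z^2: |\boldsymbol\alpha^{(n)}|\le\kappa_j\}$, $j=1,2$.
   Context: Geometry. Write $\boldsymbol r=(x_1,x_2)^\top$, $\boldsymbol x=(x_1,x_2,x_3)^\top$. Let $f:\mathbb R^2\to\mathbb R$ be Lipschitz continuous and biperiodic with period $(\Lambda_1,\Lambda_2)$ in $(x_1,x_2)$, $\Gamma_f=\{\boldsymbol x: x_3=f(\boldsymbol r)\}$, $\Omega_f=\{\boldsymbol x: x_3>f(\boldsymbol r)\}$, and let $h>\max f$. Put $\Omega=\{\boldsymbol x:0<x_1<\Lambda_1,\,0<x_2<\Lambda_2,\,f(\boldsymbol r)<x_3<h\}$ and $\Omega_h=\{\boldsymbol x:0<x_1<\Lambda_1,\,0<x_2<\Lambda_2,\,x_3>h\}$. Parameters. $\omega>0$; Lamé constants $\mu>0$, $\lambda+\mu>0$; $\kappa_1=\omega/(\lambda+2\mu)^{1/2}$, $\kappa_2=\omega/\mu^{1/2}$. Incident angles $\theta_1\in[0,\pi/2)$, $\theta_2\in[0,2\pi]$; $\boldsymbol q=(\sin\theta_1\cos\theta_2,\sin\theta_1\sin\theta_2,-\cos\theta_1)^\top$; the incident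 field is $\boldsymbol u^{\rm inc}(\boldsymbol x)=\boldsymbol q e^{{\rm i}\kappa_1\boldsymbol x\cdot\boldsymbol q}$. Put $\boldsymbol\alpha=(\alpha_1,\alpha_2)^\top$ with $\alpha_1=\kappa_1\sin\theta_1\cos\theta_2$, $\alpha_2=\kappa_1\sin\theta_1\sin\theta_2$, and $\beta=\kappa_1\cos\theta_1$. For $n=(n_1,n_2)^\top\in\mathbb Z^2$, $\boldsymbol\alpha^{(n)}=(\alpha_1+2\pi n_1/\Lambda_1,\ \alpha_2+2\pi n_2/\Lambda_2)^\top$ and, for $j=1,2$, $\beta_j^{(n)}=(\kappa_j^2-|\boldsymbol\alpha^{(n)}|^2)^{1/2}$ if $|\boldsymbol\alpha^{(n)}|<\kappa_j$, $\beta_j^{(n)}={\rm i}(|\boldsymbol\alpha^{(n)}|^2-\kappa_j^2)^{1/2}$ if $|\boldsymbol\alpha^{(n)}|>\kappa_j$. Standing assumption: $\kappa_j\ne|\boldsymbol\alpha^{(n)}|$ for all $n\in\mathbb Z^2$, $j=1,2$. Scattering problem. $\boldsymbol u$ satisfies $\mu\Delta\boldsymbol u+(\lambda+\mu)\nabla\nabla\cdot\boldsymbol u+\omega^2\boldsymbol u=0$ in $\Omega_f$ and $\boldsymbol u=0$ on $\Gamma_f$ (in the $H^1$ sense on $\Omega$); it is quasi-biperiodic, i.e. $\boldsymbol u(\boldsymbol x)e^{-{\rm i}\boldsymbol\alpha\cdot\boldsymbol r}$ is biperiodic in $(x_1,x_2)$ with periods $(\Lambda_1,\Lambda_2)$;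 and it satisfies the radiation condition that the diffracted field $\boldsymbol v=\boldsymbol u-\boldsymbol u^{\rm inc}$ consists of bounded outgoing waves in $\Omega_h$. Potentials. In $\Omega_h$ the diffracted field has the Helmholtz decomposition $\boldsymbol v=\nabla\phi+\nabla\times\boldsymbol\psi$, $\nabla\cdot\boldsymbol\psi=0$, with $\phi$, $\boldsymbol\psi$ quasi-biperiodic, $\Delta\phi+\kappa_1^2\phi=0$, $\Delta\boldsymbol\psi+\kappa_2^2\boldsymbol\psi=0$, and by the radiation condition these have the Rayleigh expansions $$\phi(\boldsymbol x)=\sum_{n\in\mathbb Z^2}\phi^{(n)}(h)e^{{\rm i}(\boldsymbol\alpha^{(n)}\cdot\boldsymbol r+\beta_1^{(n)}(x_3-h))},\qquad \boldsymbol\psi(\boldsymbol x)=\sum_{n\in\mathbb Z^2}\boldsymbol\psi^{(n)}(h)e^{{\rm i}(\boldsymbol\alpha^{(n)}\cdot\boldsymbol r+\beta_2^{(n)}(x_3-h))},\quad x_3>h.$$ Grating efficiencies. Put $a_0=-{\rm i}/\kappa_1$, $a_1^{(n)}=\phi^{(n)}(h)e^{-{\rm i}\beta_1^{(n)}h}$, $\boldsymbol b^{(n)}=\boldsymbol\psi^{(n)}(h)e^{-{\rm i}\beta_2^{(n)}h}$, and $$e_1^{(n)}=\frac{\beta_1^{(n)}|a_1^{(n)}|^2}{\beta|a_0|^2},\qquad e_2^{(n)}=\frac{\beta_2^{(n)}|\boldsymbol b^{(n)}|^2}{\beta|a_0|^2}.$$ *)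

theory Defs
  imports "HOL-Analysis.Analysis"
begin

section \<open>Differential operators on functions of three real variables\<close>

definition partial :: "3 \<Rightarrow> (real^3 \<Rightarrow> 'a::real_normed_vector) \<Rightarrow> real^3 \<Rightarrow> 'a" where
  "partial j F x = frechet_derivative F (at x) (axis j 1)"

text \<open>The next two predicates are meant for open sets.\<close>

definition C1_on :: "(real^3) set \<Rightarrow> (real^3 \<Rightarrow> 'a::real_normed_vector) \<Rightarrow> bool" where
  "C1_on S F \<longleftrightarrow> (\<forall>x\<in>S. F differentiable (at x)) \<and> (\<forall>j. continuous_on S (partial j F))"

definition C2_on :: "(real^3) set \<Rightarrow> (real^3 \<Rightarrow> 'a::real_normed_vector) \<Rightarrow> bool" where
  "C2_on S F \<longleftrightarrow> C1_on S F \<and> (\<forall>j. C1_on S (partial j F))"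

definition grad :: "(real^3 \<Rightarrow> complex) \<Rightarrow> real^3 \<Rightarrow> complex^3" where
  "grad F x = (\<chi> j. partial j F x)"

definition laplacian :: "(real^3 \<Rightarrow> 'a::real_normed_vector) \<Rightarrow> real^3 \<Rightarrow> 'a" where
  "laplacian F x = (\<Sum>j\<in>UNIV. partial j (partial j F) x)"

definition jacobian :: "(real^3 \<Rightarrow> complex^3) \<Rightarrow> real^3 \<Rightarrow> complex^3^3" where
  "jacobian w x = (\<chi> i j. partial j w x $ i)"

definition divergence :: "(real^3 \<Rightarrow> complex^3) \<Rightarrow> real^3 \<Rightarrow> complex" where
  "divergence w x = (\<Sum>j\<in>UNIV. partial j w x $ j)"

definition curl :: "(real^3 \<Rightarrow> complex^3) \<Rightarrow> real^3 \<Rightarrow> complex^3" where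
  "curl w x = vector [partial 2 w x $ 3 - partial 3 w x $ 2,
                      partial 3 w x $ 1 - partial 1 w x $ 3,
                      partial 1 w x $ 2 - partial 2 w x $ 1]"

section \<open>Geometry and periodicity\<close>

definition horiz :: "real^3 \<Rightarrow> real^2" where
  "horiz x = vector [x $ 1, x $ 2]"

definition biperiodic :: "real \<Rightarrow> real \<Rightarrow> (real^2 \<Rightarrow> real) \<Rightarrow> bool" where
  "biperiodic L1 L2 f \<longleftrightarrow> (\<forall>r. f (r + L1 *\<^sub>R axis 1 1) = f r \<and> f (r + L2 *\<^sub>R axis 2 1) = f r)"

definition region_above :: "(real^2 \<Rightarrow> real) \<Rightarrow> (real^3) set" where
  "region_above f = {x. x $ 3 > f (horiz x)}"

definition half_space :: "real \<Rightarrow> (real^3) set" where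
  "half_space h = {x. x $ 3 > h}"

definition period_cell :: "real \<Rightarrow> real \<Rightarrow> (real^2 \<Rightarrow> real) \<Rightarrow> real \<Rightarrow> (real^3) set" where
  "period_cell L1 L2 f c =
     {x. 0 < x $ 1 \<and> x $ 1 < L1 \<and> 0 < x $ 2 \<and> x $ 2 < L2 \<and> f (horiz x) < x $ 3 \<and> x $ 3 < c}"

text \<open>The set \<open>S\<close> is assumed to be invariant under the two translations.\<close>

definition quasi_biperiodic ::
  "real \<Rightarrow> real \<Rightarrow> real^2 \<Rightarrow> (real^3) set \<Rightarrow> (real^3 \<Rightarrow> complex) \<Rightarrow> bool" where
  "quasi_biperiodic L1 L2 al S F \<longleftrightarrow>
     (let g = (\<lambda>x. F x * exp (- \<i> * complex_of_real (al \<bullet> horiz x)))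
      in \<forall>x\<in>S. g (x + L1 *\<^sub>R axis 1 1) = g x \<and> g (x + L2 *\<^sub>R axis 2 1) = g x)"

section \<open>Weak solutions of the Navier equation with homogeneous Dirichlet condition\<close>

definition test_function :: "(real^3) set \<Rightarrow> (real^3 \<Rightarrow> 'a::real_normed_vector) \<Rightarrow> bool" where
  "test_function U p \<longleftrightarrow>
     C1_on UNIV p \<and> compact (closure {x. p x \<noteq> 0}) \<and> closure {x. p x \<noteq> 0} \<subseteq> U"

text \<open>\<open>G x $ i $ j\<close> stands for the weak derivative of the \<open>i\<close>-th component in direction \<open>j\<close>.
  Local integrability of \<open>u\<close> and \<open>G\<close> is required separately, in \<open>H1_cell\<close> below.\<close>

definition weak_jacobian ::
  "(real^3) set \<Rightarrow> (real^3 \<Rightarrow> complex^3) \<Rightarrow> (real^3 \<Rightarrow> complex^3^3) \<Rightarrow> bool" where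
  "weak_jacobian U u G \<longleftrightarrow>
     (\<forall>p::real^3 \<Rightarrow> complex. test_function U p \<longrightarrow>
        (\<forall>i j. (LINT x:U|lebesgue. u x $ i * partial j p x) =
               - (LINT x:U|lebesgue. G x $ i $ j * p x)))"

definition H1_cell ::
  "real \<Rightarrow> real \<Rightarrow> (real^2 \<Rightarrow> real) \<Rightarrow> real \<Rightarrow>
   (real^3 \<Rightarrow> complex^3) \<Rightarrow> (real^3 \<Rightarrow> complex^3^3) \<Rightarrow> bool" where
  "H1_cell L1 L2 f c u G \<longleftrightarrow>
     set_integrable lebesgue (period_cell L1 L2 f c) (\<lambda>x. (norm (u x))\<^sup>2 + (norm (G x))\<^sup>2)"

text \<open>Vanishing on the surface \<open>x\<^sub>3 = f(x\<^sub>1,x\<^sub>2)\<close> in the sense of \<open>H\<^sup>1\<close>: the function belongs to the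
  \<open>H\<^sup>1\<close>-closure of the quasi-biperiodic \<open>C\<^sup>1\<close> functions that vanish near the surface.\<close>

definition zero_on_surface ::
  "real \<Rightarrow> real \<Rightarrow> real^2 \<Rightarrow> (real^2 \<Rightarrow> real) \<Rightarrow> real \<Rightarrow>
   (real^3 \<Rightarrow> complex^3) \<Rightarrow> (real^3 \<Rightarrow> complex^3^3) \<Rightarrow> bool" where
  "zero_on_surface L1 L2 al f c u G \<longleftrightarrow>
     (\<exists>w::nat \<Rightarrow> real^3 \<Rightarrow> complex^3.
        (\<forall>k. C1_on UNIV (w k) \<and>
             (\<forall>i. quasi_biperiodic L1 L2 al UNIV (\<lambda>x. w k x $ i)) \<and>
             (\<exists>d>0. \<forall>x. x $ 3 \<le> f (horiz x) + d \<longrightarrow> w k x = 0)) \<and>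
        (\<lambda>k. LINT x:period_cell L1 L2 f c|lebesgue.
               (norm (u x - w k x))\<^sup>2 + (norm (G x - jacobian (w k) x))\<^sup>2) \<longlonglongrightarrow> 0)"

text \<open>Weak form of \<open>\<mu>\<Delta>u + (\<lambda>+\<mu>)\<nabla>\<nabla>\<cdot>u + \<omega>\<^sup>2u = 0\<close> in \<open>U\<close>, where \<open>G\<close> is the weak Jacobian of \<open>u\<close>.\<close>

definition weak_navier ::
  "real \<Rightarrow> real \<Rightarrow> real \<Rightarrow> (real^3) set \<Rightarrow>
   (real^3 \<Rightarrow> complex^3) \<Rightarrow> (real^3 \<Rightarrow> complex^3^3) \<Rightarrow> bool" where
  "weak_navier lam mu om U u G \<longleftrightarrow>
     (\<forall>p::real^3 \<Rightarrow> complex^3. test_function U p \<longrightarrow>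
        (LINT x:U|lebesgue.
            of_real mu * (\<Sum>i\<in>UNIV. \<Sum>j\<in>UNIV. G x $ i $ j * jacobian p x $ i $ j)
          + of_real (lam + mu) * (\<Sum>i\<in>UNIV. G x $ i $ i) * divergence p x
          - of_real (om\<^sup>2) * (\<Sum>i\<in>UNIV. u x $ i * p x $ i)) = 0)"

text \<open>The height at which the domain is truncated is auxiliary, so the \<open>H\<^sup>1\<close> conditions are imposed
  for every height \<open>c > max f\<close>. The weak Jacobian is determined up to null sets only; its
  quasi-biperiodicity, which for almost every point follows from that of \<open>u\<close>, selects a
  representative.\<close>

definition rigid_surface_solution ::
  "real \<Rightarrow> real \<Rightarrow> real \<Rightarrow> real \<Rightarrow> real \<Rightarrow> real^2 \<Rightarrow> (real^2 \<Rightarrow> real) \<Rightarrow>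
   (real^3 \<Rightarrow> complex^3) \<Rightarrow> bool" where
  "rigid_surface_solution lam mu om L1 L2 al f u \<longleftrightarrow>
     u \<in> borel_measurable (lebesgue_on (region_above f)) \<and>
     (\<forall>i. quasi_biperiodic L1 L2 al (region_above f) (\<lambda>x. u x $ i)) \<and>
     (\<exists>G::real^3 \<Rightarrow> complex^3^3.
        G \<in> borel_measurable (lebesgue_on (region_above f)) \<and>
        (\<forall>i j. quasi_biperiodic L1 L2 al (region_above f) (\<lambda>x. G x $ i $ j)) \<and>
        weak_jacobian (region_above f) u G \<and>
        (\<forall>c. (\<forall>r. f r < c) \<longrightarrow> H1_cell L1 L2 f c u G \<and> zero_on_surface L1 L2 al f c u G) \<and>
        weak_navier lam mu om (region_above f) u G)"

section \<open>Incident field, potentials and Rayleigh expansions\<close>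

definition inc_direction :: "real \<Rightarrow> real \<Rightarrow> real^3" where
  "inc_direction th1 th2 = vector [sin th1 * cos th2, sin th1 * sin th2, - cos th1]"

definition inc_field :: "real \<Rightarrow> real^3 \<Rightarrow> real^3 \<Rightarrow> complex^3" where
  "inc_field k1 q x = (\<chi> i. of_real (q $ i) * exp (\<i> * of_real (k1 * (x \<bullet> q))))"

definition alpha_n :: "real \<Rightarrow> real \<Rightarrow> real^2 \<Rightarrow> int \<times> int \<Rightarrow> real^2" where
  "alpha_n L1 L2 al n = vector [al $ 1 + 2 * pi * of_int (fst n) / L1,
                                al $ 2 + 2 * pi * of_int (snd n) / L2]"

definition beta_n :: "real \<Rightarrow> real \<Rightarrow> real^2 \<Rightarrow> real \<Rightarrow> int \<times> int \<Rightarrow> complex" where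
  "beta_n L1 L2 al k n =
     (if norm (alpha_n L1 L2 al n) < k
      then of_real (sqrt (k\<^sup>2 - (norm (alpha_n L1 L2 al n))\<^sup>2))
      else \<i> * of_real (sqrt ((norm (alpha_n L1 L2 al n))\<^sup>2 - k\<^sup>2)))"

definition helmholtz_potentials ::
  "real \<Rightarrow> real \<Rightarrow> real^2 \<Rightarrow> real \<Rightarrow> real \<Rightarrow> real \<Rightarrow> (real^3 \<Rightarrow> complex^3) \<Rightarrow>
   (real^3 \<Rightarrow> complex) \<Rightarrow> (real^3 \<Rightarrow> complex^3) \<Rightarrow> bool" where
  "helmholtz_potentials L1 L2 al k1 k2 h v \<phi> \<psi> \<longleftrightarrow>
     C2_on (half_space h) \<phi> \<and> C2_on (half_space h) \<psi> \<and>
     quasi_biperiodic L1 L2 al (half_space h) \<phi> \<and>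
     (\<forall>i. quasi_biperiodic L1 L2 al (half_space h) (\<lambda>x. \<psi> x $ i)) \<and>
     (\<forall>x\<in>half_space h.
        v x = grad \<phi> x + curl \<psi> x \<and>
        divergence \<psi> x = 0 \<and>
        laplacian \<phi> x + of_real (k1\<^sup>2) * \<phi> x = 0 \<and>
        laplacian \<psi> x + of_real (k2\<^sup>2) *s \<psi> x = 0)"

text \<open>The radiation condition: only bounded outgoing modes occur. The coefficients \<open>a n\<close> are those
  normalised at the height \<open>h\<close>.\<close>

definition rayleigh_expansion ::
  "real \<Rightarrow> real \<Rightarrow> real^2 \<Rightarrow> real \<Rightarrow> real \<Rightarrow> (int \<times> int \<Rightarrow> complex) \<Rightarrow>
   (real^3 \<Rightarrow> complex) \<Rightarrow> bool" where
  "rayleigh_expansion L1 L2 al k h a F \<longleftrightarrow>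
     (\<forall>x\<in>half_space h.
        ((\<lambda>n. a n * exp (\<i> * (of_real (alpha_n L1 L2 al n \<bullet> horiz x)
                              + beta_n L1 L2 al k n * of_real (x $ 3 - h)))) has_sum F x) UNIV)"

section \<open>Grating efficiencies\<close>

text \<open>\<open>bn\<close> and \<open>A\<close> are the vertical wave number and the amplitude of the reflected mode, \<open>b\<close> and \<open>a0\<close>
  those of the incident field. The value is complex because \<open>bn\<close> is imaginary for evanescent
  modes.\<close>

definition efficiency ::
  "real \<Rightarrow> complex \<Rightarrow> complex \<Rightarrow> 'a::real_normed_vector \<Rightarrow> complex" where
  "efficiency b a0 bn A = bn * of_real ((norm A)\<^sup>2) / of_real (b * (norm a0)\<^sup>2)"

end

theory Submission
  imports Defs
begin

text \<open>Energy is conserved because the surface is rigid and the medium does not absorb. Testing the weak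
  Navier equation with \<open>\<zeta> cnj(u)\<close>, where \<open>\<zeta>\<close> is a real cut-off function, yields volume terms that are real,
  and terms with derivatives of \<open>\<zeta>\<close>. The imaginary part therefore says that
  \<open>\<Sum>\<^sub>j \<integral> \<partial>\<^sub>j\<zeta> Im F\<^sub>j = 0\<close> for the energy flux
  \<open>F\<^sub>j = \<mu> \<Sum>\<^sub>i \<partial>\<^sub>ju\<^sub>i cnj(u\<^sub>i) + (\<lambda>+\<mu>) (div u) cnj(u\<^sub>j)\<close>, which is biperiodic.

  Instead of integrating over one period cell with opposite faces identified, everything is integrated
  over the whole space against \<open>\<zeta>(x) = \<eta>1(x\<^sub>1) \<eta>2(x\<^sub>2) \<tau>(x\<^sub>3)\<close>, where \<open>\<eta>1\<close> has compact support and
  \<open>\<eta>1'(t) = r1(t) - r1(t + L1)\<close>, and likewise for \<open>\<eta>2\<close>. Such a derivative has integral zero against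
  every \<open>L1\<close>-periodic function, so that both horizontal terms vanish. The vertical term remains:
  \<open>Im \<integral> \<rho> F\<^sub>3 = 0\<close> with \<open>\<rho> = \<eta>1 \<eta>2 \<sigma>\<close> and \<open>\<sigma> = -\<tau>'\<close> supported in \<open>h + 1 \<le> x\<^sub>3 \<le> h + 3\<close>
  (\<open>Im_flux_eq_0\<close>). The function \<open>u\<close> itself is not smooth enough to be a test function near the surface;
  there the smooth approximations that vanish near the surface take its place.

  Above the plane \<open>x\<^sub>3 = h\<close> the field is smooth and is the sum of the incident wave and the Rayleigh
  series, which may be differentiated term by term (\<open>wave_series_has_derivative\<close>). The flux of a finite
  partial sum is a double sum over pairs of plane waves. Different modes are orthogonal for the weight \<open>\<rho>\<close>
  (\<open>plane_waves_orthogonal\<close>). Within one mode the imaginary part of the flux does not depend on the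
  point (\<open>mode_flux\<close>): the cross terms between compressional and shear waves cancel because
  \<open>(\<lambda>+2\<mu>) k1\<^sup>2 = \<omega>\<^sup>2 = \<mu> k2\<^sup>2\<close>, those between the incident and the reflected compressional wave are
  imaginary before multiplication by \<open>\<i>\<close>, and each wave contributes \<open>\<omega>\<^sup>2\<close> times the real part of its
  vertical wave number times the squared modulus of its amplitude. Evanescent modes contribute nothing.
  So all sufficiently large partial sums have the same flux \<open>E \<integral> \<rho>\<close>, where \<open>E / \<omega>\<^sup>2\<close> is the left-hand side
  of the theorem minus one, multiplied by \<open>b |a0|\<^sup>2\<close>. In the limit \<open>E \<integral> \<rho> = 0\<close>, whence \<open>E = 0\<close>.\<close>

section \<open>Translations and integration by parts over the whole space\<close>

lemma distr_lebesgue_translation: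
  fixes a :: "'a::euclidean_space"
  shows "(\<lambda>x. x + a) \<in> lebesgue \<rightarrow>\<^sub>M lebesgue" "distr lebesgue lebesgue (\<lambda>x. x + a) = lebesgue"
proof -
  have eq: "(\<lambda>x::'a. a + (\<Sum>j\<in>Basis. (1 * (x \<bullet> j)) *\<^sub>R j)) = (\<lambda>x. x + a)"
    by (simp add: euclidean_representation add.commute)
  show 1: "(\<lambda>x. x + a) \<in> lebesgue \<rightarrow>\<^sub>M lebesgue"
    using lebesgue_affine_measurable[of "\<lambda>_. 1" a] unfolding eq by simp
  show "distr lebesgue lebesgue (\<lambda>x. x + a) = lebesgue"
    using lebesgue_affine_euclidean[of "\<lambda>_. 1" a] unfolding eq by (simp add: density_1)
qed

lemma
  fixes f :: "'a::euclidean_space \<Rightarrow> 'b::{banach,second_countable_topology}"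
  assumes "f \<in> borel_measurable lebesgue"
  shows integrable_lebesgue_translation:
      "integrable lebesgue (\<lambda>x. f (x + a)) \<longleftrightarrow> integrable lebesgue f"
    and integral_lebesgue_translation:
      "integral\<^sup>L lebesgue (\<lambda>x. f (x + a)) = integral\<^sup>L lebesgue f"
  using integrable_distr_eq[OF distr_lebesgue_translation(1)[of a] assms]
    integral_distr[OF distr_lebesgue_translation(1)[of a] assms]
  by (simp_all add: distr_lebesgue_translation(2))

lemma nn_integral_lebesgue_translation:
  fixes f :: "'a::euclidean_space \<Rightarrow> ennreal"
  assumes "f \<in> borel_measurable lebesgue"
  shows "(\<integral>\<^sup>+ x. f (x + a) \<partial>lebesgue) = (\<integral>\<^sup>+ x. f x \<partial>lebesgue)"
  using nn_integral_distr[OF distr_lebesgue_translation(1)[of a]] assms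
  by (simp add: distr_lebesgue_translation(2))

lemma partial_eqI: "(F has_derivative D) (at x) \<Longrightarrow> partial j F x = D (axis j 1)"
  unfolding partial_def by (simp add: frechet_derivative_at[symmetric])

lemma partial_works:
  "F differentiable (at x) \<Longrightarrow> (F has_derivative frechet_derivative F (at x)) (at x)"
  by (simp add: frechet_derivative_works)

lemma frechet_derivative_eq_sum_partial:
  fixes F :: "real^3 \<Rightarrow> 'a::real_normed_vector"
  assumes "F differentiable (at x)"
  shows "frechet_derivative F (at x) v = (\<Sum>j\<in>UNIV. v $ j *\<^sub>R partial j F x)"
proof -
  interpret linear "frechet_derivative F (at x)"
    using assms by (rule linear_frechet_derivative)
  have "v = (\<Sum>j\<in>UNIV. v $ j *\<^sub>R axis j 1)"
    using basis_expansion[of v] by (simp add: scalar_mult_eq_scaleR)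
  then have "frechet_derivative F (at x) v = frechet_derivative F (at x) (\<Sum>j\<in>UNIV. v $ j *\<^sub>R axis j 1)"
    by simp
  then show ?thesis by (simp add: sum scale partial_def)
qed

lemma partial_cong_open:
  assumes "open S" "x \<in> S" "\<And>y. y \<in> S \<Longrightarrow> F y = H y"
  shows "partial j F x = partial j H x"
proof -
  have "(F has_derivative D) (at x) \<longleftrightarrow> (H has_derivative D) (at x)" for D
    using has_derivative_transform_within_open[of F D x UNIV S H]
      has_derivative_transform_within_open[of H D x UNIV S F] assms by auto
  then show ?thesis unfolding partial_def frechet_derivative_def by simp
qed

lemma differentiable_cong_open:
  assumes "open S" "x \<in> S" "\<And>y. y \<in> S \<Longrightarrow> F y = H y" "H differentiable (at x)"
  shows "F differentiable (at x)"
  using assms(4) has_derivative_transform_within_open[of H _ x UNIV S F] assms(1-3)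
  unfolding differentiable_def by auto

lemma C1_onI:
  assumes "\<And>x. x \<in> S \<Longrightarrow> (F has_derivative D x) (at x)"
    and "\<And>j. continuous_on S (\<lambda>x. D x (axis j 1))"
  shows "C1_on S F"
proof -
  have "partial j F x = D x (axis j 1)" if "x \<in> S" for j x
    using assms(1)[OF that] by (rule partial_eqI)
  then have "continuous_on S (partial j F)" for j
    using assms(2)[of j] by (simp cong: continuous_on_cong)
  with assms(1) show ?thesis unfolding C1_on_def differentiable_def by blast
qed

lemma C1_onD:
  assumes "C1_on S F" "x \<in> S"
  shows "(F has_derivative frechet_derivative F (at x)) (at x)"
  using assms by (simp add: C1_on_def partial_works)

lemma C1_on_cont: "C1_on S F \<Longrightarrow> continuous_on S F"
  unfolding C1_on_def
  by (meson continuous_at_imp_continuous_on differentiable_imp_continuous_within)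

lemma bounded_of_compact_support:
  fixes g :: "'a::euclidean_space \<Rightarrow> 'b::real_normed_vector"
  assumes "continuous_on UNIV g" "bounded S" "\<And>x. x \<notin> S \<Longrightarrow> g x = 0"
  obtains B where "B \<ge> 0" "\<And>x. norm (g x) \<le> B"
proof -
  have "compact (g ` closure S)"
    by (intro compact_continuous_image continuous_on_subset[OF assms(1)]) (auto simp: assms(2))
  then obtain B where "\<And>y. y \<in> g ` closure S \<Longrightarrow> norm y \<le> B"
    by (meson compact_imp_bounded bounded_iff)
  then have "norm (g x) \<le> max B 0" for x
    using assms(3)[of x] closure_subset[of S] by (cases "x \<in> S") (auto simp: le_max_iff_disj)
  with that[of "max B 0"] show thesis by simp
qed

lemma integrable_bounded_support:
  fixes g :: "'a::euclidean_space \<Rightarrow> 'b::{banach,second_countable_topology}"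
  assumes "g \<in> borel_measurable lebesgue" "bounded S" "\<And>x. x \<notin> S \<Longrightarrow> g x = 0"
    and "\<And>x. norm (g x) \<le> B"
  shows "integrable lebesgue g"
proof -
  obtain r where r: "S \<subseteq> cball 0 r" using bounded_subset_ballD[OF assms(2), of 0] ball_subset_cball by blast
  have "integrable lebesgue (\<lambda>x. indicator (cball (0::'a) r) x *\<^sub>R B)"
    using lmeasurable_cball[of "0::'a" r] by (simp add: lmeasurable_iff_integrable)
  moreover have bound: "norm (g x) \<le> norm (indicator (cball (0::'a) r) x *\<^sub>R B)" for x
  proof (cases "x \<in> cball 0 r")
    case True
    then show ?thesis using assms(4)[of x] by (simp del: mem_cball_0)
  next
    case False
    with r have "x \<notin> S" by blast
    then show ?thesis by (simp add: assms(3))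
  qed
  ultimately show ?thesis
    by (intro Bochner_Integration.integrable_bound[OF _ assms(1) AE_I2])
qed

lemma borel_measurable_lebesgue_continuous:
  fixes g :: "'a::euclidean_space \<Rightarrow> 'b::topological_space"
  assumes "continuous_on UNIV g"
  shows "g \<in> borel_measurable lebesgue"
proof -
  have "g \<in> borel_measurable lborel" using borel_measurable_continuous_onI[OF assms] by simp
  then show ?thesis by (rule measurable_completion)
qed

lemma integrable_continuous_bounded_support:
  fixes g :: "'a::euclidean_space \<Rightarrow> 'b::euclidean_space"
  assumes "continuous_on UNIV g" "bounded S" "\<And>x. x \<notin> S \<Longrightarrow> g x = 0"
  shows "integrable lebesgue g"
proof -
  obtain B where "\<And>x. norm (g x) \<le> B"
    using bounded_of_compact_support[OF assms] by blast
  with borel_measurable_lebesgue_continuous[OF assms(1)] assms(2,3) show ?thesis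
    by (rule integrable_bounded_support)
qed

lemma has_vector_derivative_difference_quotient:
  fixes p :: "'a::real_normed_vector \<Rightarrow> 'b::real_normed_vector"
  assumes "((\<lambda>t. p (x + t *\<^sub>R e)) has_vector_derivative v) (at 0)"
  shows "((\<lambda>t. (p (x + t *\<^sub>R e) - p x) /\<^sub>R t) \<longlongrightarrow> v) (at 0)"
proof -
  have lim: "((\<lambda>h. norm (p (x + h *\<^sub>R e) - p x - h *\<^sub>R v) / norm h) \<longlongrightarrow> 0) (at 0)"
    using assms by (simp add: has_vector_derivative_def has_derivative_at)
  have "norm ((p (x + h *\<^sub>R e) - p x) /\<^sub>R h - v) = norm (p (x + h *\<^sub>R e) - p x - h *\<^sub>R v) / norm h"
    if "h \<noteq> 0" for h
  proof -
    have "(p (x + h *\<^sub>R e) - p x) /\<^sub>R h - v = (p (x + h *\<^sub>R e) - p x - h *\<^sub>R v) /\<^sub>R h"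
      using that by (simp add: scaleR_diff_right)
    then show ?thesis by (simp add: divide_inverse mult.commute)
  qed
  then have "((\<lambda>h. norm ((p (x + h *\<^sub>R e) - p x) /\<^sub>R h - v)) \<longlongrightarrow> 0) (at 0)"
    by (intro Lim_transform_eventually[OF lim]) (auto simp: eventually_at_filter)
  then show ?thesis using LIM_zero_iff tendsto_norm_zero_iff by blast
qed

text \<open>By translation invariance every difference quotient of \<open>p\<close> has integral zero, and the quotients
  converge to the partial derivative under a common bound. This avoids iterated integrals.\<close>

lemma integral_partial_eq_0:
  fixes p :: "real^3 \<Rightarrow> complex"
  assumes p: "C1_on UNIV p" and "bounded S" "\<And>x. x \<notin> S \<Longrightarrow> p x = 0"
  shows "integral\<^sup>L lebesgue (partial j p) = 0"
proof -
  obtain r where r: "S \<subseteq> cball 0 r" using bounded_subset_ballD[OF assms(2), of 0] ball_subset_cball by blast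
  have p0: "p x = 0" if "x \<notin> cball 0 r" for x using r that assms(3)[of x] by blast
  have pc: "continuous_on UNIV p" using C1_on_cont[OF p] .
  have meas: "g \<in> borel_measurable lebesgue" if "continuous_on UNIV g" for g :: "real^3 \<Rightarrow> complex"
    using that by (rule borel_measurable_lebesgue_continuous)
  have dc: "continuous_on UNIV (partial i p)" for i using p by (simp add: C1_on_def)
  have d0: "partial i p x = 0" if "x \<notin> cball 0 r" for i x
  proof -
    have "partial i p x = partial i (\<lambda>_. 0) x"
      by (rule partial_cong_open[of "- cball 0 r"]) (use that p0 in auto)
    then show ?thesis by (simp add: partial_def)
  qed
  have "\<exists>B. \<forall>x. norm (partial i p x) \<le> B" for i
    by (rule bounded_of_compact_support[OF dc bounded_cball[of 0 r] d0[of _ i]]) auto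
  then obtain Bi where Bi: "\<And>i x. norm (partial i p x) \<le> Bi i" by metis
  define B where "B = (\<Sum>i\<in>UNIV. \<bar>Bi i\<bar>)"
  have on: "onorm (frechet_derivative p (at x)) \<le> B" for x
  proof (rule onorm_le)
    fix v :: "real^3"
    have "norm (frechet_derivative p (at x) v) \<le> (\<Sum>i\<in>UNIV. norm (v $ i *\<^sub>R partial i p x))"
      using frechet_derivative_eq_sum_partial[of p x v] p norm_sum[of "\<lambda>i. v $ i *\<^sub>R partial i p x" UNIV]
      by (simp add: C1_on_def)
    also have "\<dots> \<le> (\<Sum>i\<in>UNIV. norm v * \<bar>Bi i\<bar>)"
      by (intro sum_mono) (auto intro!: mult_mono component_le_norm_cart order.trans[OF Bi])
    finally show "norm (frechet_derivative p (at x) v) \<le> B * norm v"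
      by (simp add: B_def sum_distrib_left mult.commute)
  qed
  have lip: "norm (p x - p y) \<le> B * norm (x - y)" for x y
    by (rule differentiable_bound[where f' = "\<lambda>x. frechet_derivative p (at x)" and S = UNIV])
       (use C1_onD[OF p] on in auto)
  define e where "e = axis j (1::real)"
  have ne: "norm e = 1" by (simp add: e_def)
  define q where "q = (\<lambda>n x. real (Suc n) *\<^sub>R (p (x + (1 / real (Suc n)) *\<^sub>R e) - p x))"
  have qint: "integral\<^sup>L lebesgue (q n) = 0" for n
  proof -
    have "integrable lebesgue p"
      by (rule integrable_continuous_bounded_support[OF pc bounded_cball p0])
    then show ?thesis unfolding q_def
      using integral_lebesgue_translation[OF meas[OF pc]] integrable_lebesgue_translation[OF meas[OF pc]]
      by simp
  qed
  have lim: "(\<lambda>n. q n x) \<longlonglongrightarrow> partial j p x" for x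
  proof -
    have "((\<lambda>t. p (x + t *\<^sub>R e)) has_vector_derivative partial j p x) (at 0)"
    proof -
      have "(p has_derivative frechet_derivative p (at x)) (at (x + 0 *\<^sub>R e))"
        using C1_onD[OF p, of x] by simp
      moreover have "((\<lambda>t. x + t *\<^sub>R e) has_derivative (\<lambda>t. t *\<^sub>R e)) (at (0::real))"
        by (auto intro!: derivative_eq_intros)
      ultimately have "((\<lambda>t. p (x + t *\<^sub>R e)) has_derivative (\<lambda>t. frechet_derivative p (at x) (t *\<^sub>R e))) (at 0)"
        by (rule_tac has_derivative_compose[where f = "\<lambda>t. x + t *\<^sub>R e" and g = p and x = 0])
      moreover have "frechet_derivative p (at x) (t *\<^sub>R e) = t *\<^sub>R partial j p x" for t
        by (simp add: partial_def e_def linear_scale[OF has_derivative_linear[OF C1_onD[OF p UNIV_I]]])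
      ultimately show ?thesis by (simp add: has_vector_derivative_def)
    qed
    then have "((\<lambda>t. (p (x + t *\<^sub>R e) - p x) /\<^sub>R t) \<longlongrightarrow> partial j p x) (at 0)"
      by (rule has_vector_derivative_difference_quotient)
    moreover have "filterlim (\<lambda>n. 1 / real (Suc n)) (at 0) sequentially"
      unfolding filterlim_at using LIMSEQ_inverse_real_of_nat by (auto simp: field_simps)
    ultimately have "(\<lambda>n. (p (x + (1 / real (Suc n)) *\<^sub>R e) - p x) /\<^sub>R (1 / real (Suc n))) \<longlonglongrightarrow> partial j p x"
      by (rule filterlim_compose)
    then show ?thesis by (simp add: q_def divide_inverse)
  qed
  have "(\<lambda>n. integral\<^sup>L lebesgue (q n)) \<longlonglongrightarrow> integral\<^sup>L lebesgue (partial j p)"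
  proof (rule integral_dominated_convergence[where w = "\<lambda>x. indicator (cball 0 (r + 1)) x *\<^sub>R B"])
    show "partial j p \<in> borel_measurable lebesgue" by (rule meas[OF dc])
    show "q n \<in> borel_measurable lebesgue" for n
      unfolding q_def by (intro meas continuous_intros continuous_on_compose2[OF pc]) auto
    show "integrable lebesgue (\<lambda>x. indicator (cball (0::real^3) (r + 1)) x *\<^sub>R B)"
      using lmeasurable_cball[of "0::real^3" "r + 1"] by (simp add: lmeasurable_iff_integrable)
    show "AE x in lebesgue. norm (q n x) \<le> indicator (cball 0 (r + 1)) x *\<^sub>R B" for n
    proof (rule AE_I2)
      fix x
      have "norm (q n x) \<le> real (Suc n) * (B * norm ((1 / real (Suc n)) *\<^sub>R e))"
        unfolding q_def norm_scaleR using lip[of "x + (1 / real (Suc n)) *\<^sub>R e" x]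
        by (simp del: of_nat_Suc add: field_simps)
      then have 1: "norm (q n x) \<le> B" by (simp add: ne del: of_nat_Suc)
      have "q n x = 0" if "x \<notin> cball 0 (r + 1)"
      proof -
        have "norm ((1 / real (Suc n)) *\<^sub>R e) \<le> 1" using ne by (simp add: divide_simps)
        then have "norm x \<le> norm (x + (1 / real (Suc n)) *\<^sub>R e) + 1"
          using norm_triangle_ineq4[of "x + (1 / real (Suc n)) *\<^sub>R e" "(1 / real (Suc n)) *\<^sub>R e"]
          unfolding add_diff_cancel_right' by linarith
        then show ?thesis using p0[of x] p0[of "x + (1 / real (Suc n)) *\<^sub>R e"] that by (auto simp: q_def)
      qed
      with 1 show "norm (q n x) \<le> indicator (cball 0 (r + 1)) x *\<^sub>R B" by (auto simp: indicator_def)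
    qed
  qed (auto intro: lim)
  then show ?thesis using qint by (simp add: LIMSEQ_const_iff)
qed

section \<open>Cut-off functions\<close>

text \<open>Integrating downwards from \<open>B + 1\<close> gives a function that is differentiable everywhere, since both
  formulas are valid for \<open>B < t < B + 1\<close>.\<close>

lemma exists_antiderivative_vanishing_above:
  fixes k :: "real \<Rightarrow> real"
  assumes k: "continuous_on UNIV k" "\<And>t. B < t \<Longrightarrow> k t = 0"
  obtains A where "\<And>t. (A has_real_derivative k t) (at t)" "\<And>t. B \<le> t \<Longrightarrow> A t = 0"
proof -
  define A where "A t = - integral {t..B + 1} k" for t
  have A0: "A t = 0" if "B \<le> t" for t
  proof -
    have "integral {t..B + 1} k = integral {t..B + 1} (\<lambda>_. 0)"
      by (rule integral_spike[of "{B}"]) (use k(2) that in auto)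
    then show ?thesis by (simp add: A_def)
  qed
  have "(A has_real_derivative k t) (at t)" for t
  proof (cases "t < B + 1")
    case True
    have "((\<lambda>t. integral {t..B + 1} k) has_vector_derivative - k t) (at t within {t - 1..B + 1})"
      by (rule integral_has_vector_derivative'[OF continuous_on_subset[OF k(1)]]) (use True in auto)
    moreover have "at t within {t - 1..B + 1} = at t"
      by (rule at_within_interior) (use True in auto)
    ultimately show ?thesis
      unfolding A_def has_real_derivative_iff_has_vector_derivative
      by (auto dest: has_vector_derivative_minus)
  next
    case False
    have "((\<lambda>_. 0) has_real_derivative k t) (at t)" using k(2)[of t] False by simp
    then show ?thesis
      by (rule has_field_derivative_transform_within_open[of _ _ _ "{B<..}"]) (use A0 False in auto)
  qed
  with A0 show thesis using that by blast
qed

text \<open>For an antiderivative \<open>A\<close> of a bump \<open>k\<close> on \<open>{0..L}\<close> put \<open>\<eta> t = A (t + L) - A t\<close>. The mean value theorem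
  gives \<open>\<eta> t = L * k x\<close> for some \<open>x\<close> between \<open>t\<close> and \<open>t + L\<close>, from which sign and support are read off.\<close>

lemma exists_periodic_bump:
  fixes L :: real
  assumes "0 < L"
  obtains \<eta> r :: "real \<Rightarrow> real" where
    "\<And>t. (\<eta> has_real_derivative (r t - r (t + L))) (at t)" "continuous_on UNIV r"
    "\<And>t. t \<notin> {0..L} \<Longrightarrow> r t = 0" "\<And>t. t \<notin> {-L..L} \<Longrightarrow> \<eta> t = 0"
    "\<And>t. 0 \<le> \<eta> t" "0 < \<eta> 0"
proof -
  define k where "k = (\<lambda>t. max 0 (t * (L - t)))"
  have kc: "continuous_on UNIV k" unfolding k_def by (intro continuous_intros)
  have k0: "k t = 0" if "t \<notin> {0<..<L}" for t
  proof -
    have "t * (L - t) \<le> 0" using that assms by (cases "t \<le> 0") (auto simp: mult_le_0_iff)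
    then show ?thesis by (simp add: k_def)
  qed
  have kpos: "0 < k t" if "t \<in> {0<..<L}" for t using that by (simp add: k_def)
  have kge: "0 \<le> k t" for t by (simp add: k_def)
  obtain A where A: "\<And>t. (A has_real_derivative k t) (at t)"
    by (rule exists_antiderivative_vanishing_above[OF kc, of L]) (use k0 in auto)
  define \<eta> where "\<eta> t = A (t + L) - A t" for t
  have mvt: "\<exists>x. t < x \<and> x < t + L \<and> \<eta> t = L * k x" for t
    using MVT2[of t "t + L" A k] A assms by (auto simp: \<eta>_def)
  show thesis
  proof (rule that[of \<eta> "\<lambda>t. - k t"])
    show "(\<eta> has_real_derivative - k t - - k (t + L)) (at t)" for t
      unfolding \<eta>_def using DERIV_shift[of A "k (t + L)" t L] A[of "t + L"] A[of t]
      by (auto intro!: derivative_eq_intros)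
    show "continuous_on UNIV (\<lambda>t. - k t)" by (intro continuous_intros kc)
    show "\<eta> t = 0" if "t \<notin> {-L..L}" for t
    proof -
      obtain x where "t < x" "x < t + L" "\<eta> t = L * k x" using mvt by blast
      then show ?thesis using k0[of x] that by (auto simp: not_le)
    qed
    show "0 \<le> \<eta> t" for t
      using mvt[of t] assms kge by (auto intro: mult_nonneg_nonneg less_imp_le)
    obtain x where "0 < x" "x < L" "\<eta> 0 = L * k x" using mvt[of 0] by auto
    then show "0 < \<eta> 0" using assms kpos[of x] by simp
  qed (use k0 in auto)
qed

text \<open>The bump \<open>\<sigma>\<close> has to be continuously differentiable, because it is a factor of test functions, too.\<close>

lemma exists_vertical_cutoff:
  fixes c :: real
  obtains \<tau> \<sigma> \<sigma>' :: "real \<Rightarrow> real" where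
    "\<And>t. (\<tau> has_real_derivative (- \<sigma> t)) (at t)" "\<And>t. (\<sigma> has_real_derivative \<sigma>' t) (at t)"
    "continuous_on UNIV \<sigma>'" "\<And>t. t \<notin> {c-1..c+1} \<Longrightarrow> \<sigma> t = 0" "\<And>t. c + 1 \<le> t \<Longrightarrow> \<tau> t = 0"
    "\<And>t. 0 \<le> \<sigma> t" "0 < \<sigma> c"
proof -
  obtain \<eta> r where e: "\<And>t. (\<eta> has_real_derivative (r t - r (t + 1))) (at t)" "continuous_on UNIV r"
    "\<And>t. t \<notin> {0..1} \<Longrightarrow> r t = 0" "\<And>t. t \<notin> {-1..1} \<Longrightarrow> \<eta> t = 0" "\<And>t. 0 \<le> \<eta> t" "0 < \<eta> (0::real)"
    using exists_periodic_bump[of 1] by (metis zero_less_one)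
  define \<sigma> where "\<sigma> t = \<eta> (t - c)" for t
  have d: "(\<sigma> has_real_derivative r (t - c) - r (t - c + 1)) (at t)" for t
    unfolding \<sigma>_def using DERIV_shift[of \<eta> "r (t - c) - r (t - c + 1)" t "-c"] e(1)[of "t - c"] by simp
  have "continuous_on UNIV \<sigma>" using d by (meson DERIV_isCont continuous_at_imp_continuous_on)
  moreover have s0: "\<sigma> t = 0" if "t \<notin> {c-1..c+1}" for t using that e(4)[of "t - c"] by (auto simp: \<sigma>_def)
  ultimately obtain A where A: "\<And>t. (A has_real_derivative \<sigma> t) (at t)" "\<And>t. c + 1 \<le> t \<Longrightarrow> A t = 0"
    by (rule exists_antiderivative_vanishing_above[of \<sigma> "c + 1"]) auto
  show thesis
  proof (rule that[of "\<lambda>t. - A t" \<sigma>, OF _ d _ s0])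
    show "((\<lambda>t. - A t) has_real_derivative - \<sigma> t) (at t)" for t by (intro DERIV_minus A)
    show "continuous_on UNIV (\<lambda>t. r (t - c) - r (t - c + 1))"
      by (intro continuous_intros continuous_on_compose2[OF e(2)]) auto
  qed (use e A in \<open>auto simp: \<sigma>_def\<close>)
qed

section \<open>Integrals against periodic functions\<close>

lemma borel_measurable_cutoff [measurable]:
  fixes r :: "real \<Rightarrow> real"
  assumes "continuous_on UNIV r"
  shows "(\<lambda>x::real^'n. r (x $ j)) \<in> borel_measurable lebesgue"
  by (rule borel_measurable_lebesgue_continuous)
     (intro continuous_on_compose2[OF assms] continuous_intros, auto)

lemma axis_nth_eq: "axis i c $ j = (if i = j then c else 0)"
  by (simp add: axis_def)

text \<open>The two terms of the weight give integrals that differ by a translation.\<close>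

lemma integral_difference_weight_periodic:
  fixes g :: "real^'n \<Rightarrow> complex" and r :: "real \<Rightarrow> real"
  assumes r: "continuous_on UNIV r" "\<And>t. t \<notin> {0..L} \<Longrightarrow> r t = 0" "0 < L"
    and g: "g \<in> borel_measurable lebesgue" "\<And>x. g (x + L *\<^sub>R axis j 1) = g x"
    and int: "integrable lebesgue (\<lambda>x. of_real (r (x $ j)) * g x)"
  shows "integral\<^sup>L lebesgue (\<lambda>x. of_real (r (x $ j) - r (x $ j + L)) * g x) = 0"
proof -
  define F where "F = (\<lambda>x. complex_of_real (r (x $ j)) * g x)"
  have F: "F \<in> borel_measurable lebesgue" "integrable lebesgue F" using int by (auto simp: F_def)
  have eq: "of_real (r (x $ j) - r (x $ j + L)) * g x = F x - F (x + L *\<^sub>R axis j 1)" for x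
    using g(2)[of x] by (simp add: F_def algebra_simps)
  show ?thesis unfolding eq
    using F integrable_lebesgue_translation[OF F(1)] integral_lebesgue_translation[OF F(1)] by simp
qed

text \<open>The heights are measured from \<open>h\<close>: the bump \<open>\<sigma>\<close> lives in the part of the half space where the
  Rayleigh series converge uniformly.\<close>

locale cutoffs =
  fixes L1 L2 h :: real and \<eta>1 r1 \<eta>2 r2 \<tau> \<sigma> \<sigma>' :: "real \<Rightarrow> real"
  assumes L: "0 < L1" "0 < L2"
    and e1: "\<And>t. (\<eta>1 has_real_derivative (r1 t - r1 (t + L1))) (at t)" "continuous_on UNIV r1"
      "\<And>t. t \<notin> {0..L1} \<Longrightarrow> r1 t = 0" "\<And>t. t \<notin> {-L1..L1} \<Longrightarrow> \<eta>1 t = 0" "\<And>t. 0 \<le> \<eta>1 t" "0 < \<eta>1 0"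
    and e2: "\<And>t. (\<eta>2 has_real_derivative (r2 t - r2 (t + L2))) (at t)" "continuous_on UNIV r2"
      "\<And>t. t \<notin> {0..L2} \<Longrightarrow> r2 t = 0" "\<And>t. t \<notin> {-L2..L2} \<Longrightarrow> \<eta>2 t = 0" "\<And>t. 0 \<le> \<eta>2 t" "0 < \<eta>2 0"
    and c: "\<And>t. (\<tau> has_real_derivative (- \<sigma> t)) (at t)" "\<And>t. (\<sigma> has_real_derivative \<sigma>' t) (at t)"
      "continuous_on UNIV \<sigma>'" "\<And>t. t \<notin> {h+1..h+3} \<Longrightarrow> \<sigma> t = 0" "\<And>t. h + 3 \<le> t \<Longrightarrow> \<tau> t = 0"
      "\<And>t. 0 \<le> \<sigma> t" "0 < \<sigma> (h + 2)"
begin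

lemma eta_cont: "continuous_on UNIV \<eta>1" "continuous_on UNIV \<eta>2" "continuous_on UNIV \<sigma>"
proof -
  have dc: "continuous_on UNIV g" if "\<And>t. (g has_real_derivative g' t) (at t)" for g g' :: "real \<Rightarrow> real"
    using that by (meson DERIV_isCont continuous_at_imp_continuous_on)
  show "continuous_on UNIV \<eta>1" "continuous_on UNIV \<eta>2" "continuous_on UNIV \<sigma>"
    using dc[OF e1(1)] dc[OF e2(1)] dc[OF c(2)] by auto
qed

text \<open>The horizontal derivatives of \<open>\<eta>1(x $ 1) \<eta>2(x $ 2) s(x $ 3)\<close> are invisible to biperiodic functions. The flux of
  the solution needs this for \<open>s = \<tau>\<close>, the orthogonality of plane waves for \<open>s = \<sigma>\<close>.\<close>

lemma integral_horizontal_derivative_weight: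
  fixes g :: "real^3 \<Rightarrow> complex"
  assumes g: "g \<in> borel_measurable lebesgue"
      "\<And>x. g (x + L1 *\<^sub>R axis 1 1) = g x" "\<And>x. g (x + L2 *\<^sub>R axis 2 1) = g x"
    and s: "continuous_on UNIV s"
    and int: "\<And>a b. \<lbrakk>continuous_on UNIV a; continuous_on UNIV b; \<And>t. t \<notin> {-L1..L1} \<Longrightarrow> a t = 0;
        \<And>t. t \<notin> {-L2..L2} \<Longrightarrow> b t = 0\<rbrakk>
      \<Longrightarrow> integrable lebesgue (\<lambda>x. of_real (a (x $ 1) * b (x $ 2) * s (x $ 3)) * g x)"
  shows "(\<integral>x. of_real ((r1 (x $ 1) - r1 (x $ 1 + L1)) * \<eta>2 (x $ 2) * s (x $ 3)) * g x \<partial>lebesgue) = 0"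
    and "(\<integral>x. of_real (\<eta>1 (x $ 1) * (r2 (x $ 2) - r2 (x $ 2 + L2)) * s (x $ 3)) * g x \<partial>lebesgue) = 0"
proof -
  have cm: "(\<lambda>x. of_real (q (x $ i)) :: complex) \<in> borel_measurable lebesgue" if "continuous_on UNIV q"
    for q :: "real \<Rightarrow> real" and i :: 3
    using borel_measurable_cutoff[OF that, of i] by measurable
  have z: "r1 t = 0" if "t \<notin> {-L1..L1}" for t using that e1(3)[of t] L by auto
  have "(\<integral>x. of_real (r1 (x $ 1) - r1 (x $ 1 + L1)) * (of_real (\<eta>2 (x $ 2) * s (x $ 3)) * g x) \<partial>lebesgue) = 0"
  proof (rule integral_difference_weight_periodic[OF e1(2,3) L(1)])
    show "(\<lambda>x. of_real (\<eta>2 (x $ 2) * s (x $ 3)) * g x) \<in> borel_measurable lebesgue"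
      unfolding of_real_mult using cm[OF eta_cont(2), of 2] cm[OF s, of 3] g(1) by measurable
    show "integrable lebesgue (\<lambda>x. of_real (r1 (x $ 1)) * (of_real (\<eta>2 (x $ 2) * s (x $ 3)) * g x))"
      using int[OF e1(2) eta_cont(2) z e2(4)] by (simp add: mult_ac)
  qed (simp_all add: g axis_nth_eq)
  then show "(\<integral>x. of_real ((r1 (x $ 1) - r1 (x $ 1 + L1)) * \<eta>2 (x $ 2) * s (x $ 3)) * g x \<partial>lebesgue) = 0"
    by (simp add: mult.assoc)
  have z: "r2 t = 0" if "t \<notin> {-L2..L2}" for t using that e2(3)[of t] L by auto
  have "(\<integral>x. of_real (r2 (x $ 2) - r2 (x $ 2 + L2)) * (of_real (\<eta>1 (x $ 1) * s (x $ 3)) * g x) \<partial>lebesgue) = 0"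
  proof (rule integral_difference_weight_periodic[OF e2(2,3) L(2)])
    show "(\<lambda>x. of_real (\<eta>1 (x $ 1) * s (x $ 3)) * g x) \<in> borel_measurable lebesgue"
      unfolding of_real_mult using cm[OF eta_cont(1), of 1] cm[OF s, of 3] g(1) by measurable
    show "integrable lebesgue (\<lambda>x. of_real (r2 (x $ 2)) * (of_real (\<eta>1 (x $ 1) * s (x $ 3)) * g x))"
      using int[OF eta_cont(1) e2(2) e1(4) z] by (simp add: mult_ac)
  qed (simp_all add: g axis_nth_eq)
  then show "(\<integral>x. of_real (\<eta>1 (x $ 1) * (r2 (x $ 2) - r2 (x $ 2 + L2)) * s (x $ 3)) * g x \<partial>lebesgue) = 0"
    by (simp add: mult_ac)
qed

end

lemma exists_cutoffs:
  assumes "0 < L1" "0 < L2"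
  shows "\<exists>\<eta>1 r1 \<eta>2 r2 \<tau> \<sigma> \<sigma>'. cutoffs L1 L2 h \<eta>1 r1 \<eta>2 r2 \<tau> \<sigma> \<sigma>'"
proof -
  obtain \<eta>1 r1 where 1: "\<And>t. (\<eta>1 has_real_derivative (r1 t - r1 (t + L1))) (at t)" "continuous_on UNIV r1"
    "\<And>t. t \<notin> {0..L1} \<Longrightarrow> r1 t = 0" "\<And>t. t \<notin> {-L1..L1} \<Longrightarrow> \<eta>1 t = 0" "\<And>t. 0 \<le> \<eta>1 t" "0 < \<eta>1 0"
    using exists_periodic_bump[OF assms(1)] by metis
  obtain \<eta>2 r2 where 2: "\<And>t. (\<eta>2 has_real_derivative (r2 t - r2 (t + L2))) (at t)" "continuous_on UNIV r2"
    "\<And>t. t \<notin> {0..L2} \<Longrightarrow> r2 t = 0" "\<And>t. t \<notin> {-L2..L2} \<Longrightarrow> \<eta>2 t = 0" "\<And>t. 0 \<le> \<eta>2 t" "0 < \<eta>2 0"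
    using exists_periodic_bump[OF assms(2)] by metis
  have s: "h + 2 - 1 = h + 1" "h + 2 + 1 = h + 3" by simp_all
  obtain \<tau> \<sigma> \<sigma>' where 3: "\<And>t. (\<tau> has_real_derivative (- \<sigma> t)) (at t)" "\<And>t. (\<sigma> has_real_derivative \<sigma>' t) (at t)"
      "continuous_on UNIV \<sigma>'" "\<And>t. t \<notin> {h+1..h+3} \<Longrightarrow> \<sigma> t = 0" "\<And>t. h + 3 \<le> t \<Longrightarrow> \<tau> t = 0"
      "\<And>t. 0 \<le> \<sigma> t" "0 < \<sigma> (h + 2)"
    using exists_vertical_cutoff[of "h + 2", unfolded s] by metis
  show ?thesis
    by (intro exI) (unfold_locales; fact assms 1 2 3)
qed

section \<open>Differentiation rules\<close>

lemma C1_on_bounded_linear: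
  assumes T: "bounded_linear T" and F: "C1_on S F"
  shows "C1_on S (\<lambda>x. T (F x))"
    and "x \<in> S \<Longrightarrow> partial j (\<lambda>x. T (F x)) x = T (partial j F x)"
proof -
  have D: "((\<lambda>x. T (F x)) has_derivative (\<lambda>v. T (frechet_derivative F (at x) v))) (at x)" if "x \<in> S" for x
    using bounded_linear.has_derivative[OF T C1_onD[OF F that]] .
  show "C1_on S (\<lambda>x. T (F x))"
  proof (rule C1_onI[OF D])
    show "continuous_on S (\<lambda>x. T (frechet_derivative F (at x) (axis j 1)))" for j
      using F bounded_linear.continuous_on[OF T, of S "partial j F"]
      by (simp add: C1_on_def partial_def[abs_def])
  qed
  show "x \<in> S \<Longrightarrow> partial j (\<lambda>x. T (F x)) x = T (partial j F x)"
    using partial_eqI[OF D] by (simp add: partial_def)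
qed

lemma C1_on_bilinear:
  assumes T: "bounded_bilinear T" and F: "C1_on S F" and H: "C1_on S H"
  shows "C1_on S (\<lambda>x. T (F x) (H x))"
    and "x \<in> S \<Longrightarrow> partial j (\<lambda>x. T (F x) (H x)) x = T (F x) (partial j H x) + T (partial j F x) (H x)"
proof -
  have D: "((\<lambda>x. T (F x) (H x)) has_derivative
      (\<lambda>v. T (F x) (frechet_derivative H (at x) v) + T (frechet_derivative F (at x) v) (H x))) (at x)"
    if "x \<in> S" for x
    using bounded_bilinear.FDERIV[OF T C1_onD[OF F that] C1_onD[OF H that]] .
  show "C1_on S (\<lambda>x. T (F x) (H x))"
  proof (rule C1_onI[OF D])
    show "continuous_on S (\<lambda>x. T (F x) (frechet_derivative H (at x) (axis j 1))
            + T (frechet_derivative F (at x) (axis j 1)) (H x))" for j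
      using F H C1_on_cont[OF F] C1_on_cont[OF H]
      by (auto simp: C1_on_def partial_def[abs_def] intro!: continuous_on_add bounded_bilinear.continuous_on[OF T])
  qed
  show "x \<in> S \<Longrightarrow> partial j (\<lambda>x. T (F x) (H x)) x = T (F x) (partial j H x) + T (partial j F x) (H x)"
    using partial_eqI[OF D] by (simp add: partial_def)
qed

lemmas C1_on_scaleR = C1_on_bilinear[OF bounded_bilinear_scaleR]
  and C1_on_mult = C1_on_bilinear[OF bounded_bilinear_mult]

lemma C1_on_add:
  assumes F: "C1_on S F" and H: "C1_on S H"
  shows "C1_on S (\<lambda>x. F x + H x)"
    and "x \<in> S \<Longrightarrow> partial j (\<lambda>x. F x + H x) x = partial j F x + partial j H x"
proof -
  have D: "((\<lambda>x. F x + H x) has_derivative (\<lambda>v. frechet_derivative F (at x) v + frechet_derivative H (at x) v)) (at x)"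
    if "x \<in> S" for x
    by (intro has_derivative_add C1_onD[OF F that] C1_onD[OF H that])
  show "C1_on S (\<lambda>x. F x + H x)"
    by (rule C1_onI[OF D]) (use F H in \<open>auto simp: C1_on_def partial_def[abs_def] intro!: continuous_intros\<close>)
  show "x \<in> S \<Longrightarrow> partial j (\<lambda>x. F x + H x) x = partial j F x + partial j H x"
    using partial_eqI[OF D] by (simp add: partial_def)
qed

lemma C1_on_cutoff:
  fixes a b c a' b' c' :: "real \<Rightarrow> real"
  assumes "\<And>t. (a has_real_derivative a' t) (at t)" "\<And>t. (b has_real_derivative b' t) (at t)"
    "\<And>t. (c has_real_derivative c' t) (at t)"
    and "continuous_on UNIV a'" "continuous_on UNIV b'" "continuous_on UNIV c'"
  defines "z \<equiv> \<lambda>x::real^3. a (x $ 1) * b (x $ 2) * c (x $ 3)"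
  shows "C1_on UNIV z"
    and "partial 1 z x = a' (x $ 1) * b (x $ 2) * c (x $ 3)"
    and "partial 2 z x = a (x $ 1) * b' (x $ 2) * c (x $ 3)"
    and "partial 3 z x = a (x $ 1) * b (x $ 2) * c' (x $ 3)"
proof -
  have d1: "((\<lambda>x::real^3. g (x $ j)) has_derivative (\<lambda>v. g' (x $ j) * v $ j)) (at x)"
    if "\<And>t. (g has_real_derivative g' t) (at t)" for g g' :: "real \<Rightarrow> real" and j x
    using has_derivative_compose[of "\<lambda>x. x $ j" "\<lambda>v. v $ j" x UNIV g "\<lambda>h. g' (x $ j) * h"] that[of "x $ j"]
      bounded_linear_imp_has_derivative[OF bounded_linear_vec_nth[of j], of "at x"]
    by (simp add: has_field_derivative_def)
  have D: "(z has_derivative (\<lambda>v. a (x $ 1) * b (x $ 2) * (c' (x $ 3) * v $ 3) +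
      (a (x $ 1) * (b' (x $ 2) * v $ 2) + a' (x $ 1) * v $ 1 * b (x $ 2)) * c (x $ 3))) (at x)" for x
    unfolding z_def by (intro has_derivative_mult d1 assms(1-3))
  have cont: "continuous_on UNIV (\<lambda>x::real^3. g (x $ j))" if "continuous_on UNIV g"
    for g :: "real \<Rightarrow> real" and j
    by (intro continuous_on_compose2[OF that] continuous_intros) auto
  have contd: "continuous_on UNIV g" if "\<And>t. (g has_real_derivative g' t) (at t)" for g g' :: "real \<Rightarrow> real"
    using that by (meson DERIV_isCont continuous_at_imp_continuous_on)
  show "C1_on UNIV z"
    by (rule C1_onI[OF D])
       (intro continuous_intros cont assms(4-6) contd[OF assms(1)] contd[OF assms(2)] contd[OF assms(3)])
  show "partial 1 z x = a' (x $ 1) * b (x $ 2) * c (x $ 3)"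
    "partial 2 z x = a (x $ 1) * b' (x $ 2) * c (x $ 3)"
    "partial 3 z x = a (x $ 1) * b (x $ 2) * c' (x $ 3)"
    using partial_eqI[OF D] by (simp_all add: axis_def)
qed

lemma partial_translation:
  fixes F :: "real^3 \<Rightarrow> 'a::real_normed_vector"
  shows "partial j (\<lambda>x. F (x + a)) x = partial j F (x + a)"
proof -
  have "((\<lambda>x. F (x + a)) has_derivative D) (at x) \<longleftrightarrow> (F has_derivative D) (at (x + a))" for D
  proof
    assume "((\<lambda>x. F (x + a)) has_derivative D) (at x)"
    then have "((\<lambda>x. F (x + a)) has_derivative D) (at ((x + a) - a))" by simp
    moreover have "((\<lambda>x. x - a) has_derivative (\<lambda>v. v)) (at (x + a))"
      by (auto intro!: derivative_eq_intros)
    ultimately show "(F has_derivative D) (at (x + a))"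
      using has_derivative_compose[of "\<lambda>x. x - a" "\<lambda>v. v" "x + a" UNIV "\<lambda>x. F (x + a)" D] by simp
  next
    assume "(F has_derivative D) (at (x + a))"
    moreover have "((\<lambda>x. x + a) has_derivative (\<lambda>v. v)) (at x)"
      by (auto intro!: derivative_eq_intros)
    ultimately show "((\<lambda>x. F (x + a)) has_derivative D) (at x)"
      using has_derivative_compose[of "\<lambda>x. x + a" "\<lambda>v. v" x UNIV F D] by simp
  qed
  then show ?thesis by (simp add: partial_def frechet_derivative_def)
qed

section \<open>Periodic densities and limits in the mean\<close>

lemma AE_nth_neq: "AE x in lebesgue. (x::real^'n) $ j \<noteq> c"
proof -
  have "negligible {x::real^'n. x $ j = c}" 
    using negligible_standard_hyperplane[of "axis j 1 :: real^'n" c] by (simp add: inner_axis axis_in_Basis_iff)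
  then show ?thesis by (auto simp: negligible_iff_null_sets dest: AE_not_in)
qed

lemma sets_lebesgue_open_imp: "open A \<Longrightarrow> A \<in> sets lebesgue"
  by simp

text \<open>Up to three hyperplanes the slab of width \<open>2 L\<close> consists of two translates of the open one of
  width \<open>L\<close>.\<close>

lemma nn_integral_two_periods:
  fixes g :: "real^'n \<Rightarrow> ennreal"
  assumes "0 < L" and g: "g \<in> borel_measurable lebesgue" "\<And>x. g (x + L *\<^sub>R axis j 1) = g x"
  shows "(\<integral>\<^sup>+ x. g x * indicator {x. - L \<le> x $ j \<and> x $ j \<le> L} x \<partial>lebesgue)
       = 2 * (\<integral>\<^sup>+ x. g x * indicator {x. 0 < x $ j \<and> x $ j < L} x \<partial>lebesgue)"
proof -
  define C where "C = {x::real^'n. 0 < x $ j \<and> x $ j < L}"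
  have "open C" unfolding C_def
    by (intro open_Collect_conj open_Collect_less continuous_intros)
  then have C: "C \<in> sets lebesgue" by (rule sets_lebesgue_open_imp)
  define k where "k = (\<lambda>x. g x * indicator C x)"
  have k: "k \<in> borel_measurable lebesgue" unfolding k_def using g(1) C by measurable
  have kt: "(\<lambda>x. k (x + L *\<^sub>R axis j 1)) \<in> borel_measurable lebesgue"
    using measurable_compose[OF distr_lebesgue_translation(1) k] .
  have "(\<integral>\<^sup>+ x. g x * indicator {x. - L \<le> x $ j \<and> x $ j \<le> L} x \<partial>lebesgue)
      = (\<integral>\<^sup>+ x. k x + k (x + L *\<^sub>R axis j 1) \<partial>lebesgue)"
  proof (rule nn_integral_cong_AE)
    show "AE x in lebesgue. g x * indicator {x. - L \<le> x $ j \<and> x $ j \<le> L} x = k x + k (x + L *\<^sub>R axis j 1)"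
      using AE_nth_neq[of j 0] AE_nth_neq[of j L] AE_nth_neq[of j "-L"]
    proof eventually_elim
      case (elim x)
      have "(x + L *\<^sub>R axis j 1) $ j = x $ j + L" by (simp add: axis_def)
      with elim \<open>0 < L\<close> show ?case unfolding k_def g(2) C_def
        by (auto simp: indicator_def)
    qed
  qed
  also have "\<dots> = (\<integral>\<^sup>+ x. k x \<partial>lebesgue) + (\<integral>\<^sup>+ x. k (x + L *\<^sub>R axis j 1) \<partial>lebesgue)"
    by (rule nn_integral_add[OF k kt])
  also have "\<dots> = 2 * (\<integral>\<^sup>+ x. k x \<partial>lebesgue)"
    by (simp add: nn_integral_lebesgue_translation[OF k] mult_2)
  finally show ?thesis by (simp add: k_def C_def)
qed

text \<open>Convergence in the quadratic mean suffices for sesquilinear integrands. The inequality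
  \<open>sqrt s * sqrt t \<le> e * s + t / e\<close> with small \<open>e\<close> plays the role of the Cauchy-Schwarz inequality.\<close>

lemma integral_tendsto_of_product_bound:
  fixes \<Phi> :: "'a \<Rightarrow> complex"
  assumes "\<Phi> \<in> borel_measurable M" "\<And>k. \<Psi> k \<in> borel_measurable M"
    and s: "integrable M s" "\<And>x. 0 \<le> s x" and t: "\<And>k. integrable M (t k)" "\<And>k x. 0 \<le> t k x"
    and lim: "(\<lambda>k. integral\<^sup>L M (t k)) \<longlonglongrightarrow> 0"
    and b0: "\<And>x. norm (\<Phi> x) \<le> C * s x"
    and b: "\<And>k x. norm (\<Phi> x - \<Psi> k x) \<le> C * (sqrt (s x) * sqrt (t k x))"
    and C: "0 \<le> C"
  shows "integrable M \<Phi>" "(\<lambda>k. integral\<^sup>L M (\<Psi> k)) \<longlonglongrightarrow> integral\<^sup>L M \<Phi>"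
proof -
  show I: "integrable M \<Phi>"
  proof (rule Bochner_Integration.integrable_bound)
    show "integrable M (\<lambda>x. C * s x)" using s by simp
  qed (use assms in \<open>auto intro!: AE_I2\<close>)
  have amgm: "sqrt (s x) * sqrt (t k x) \<le> e * s x + t k x / e" if "0 < e" for e x k
  proof -
    have "0 \<le> (sqrt e * sqrt (s x) - sqrt (t k x) / sqrt e)\<^sup>2" by simp
    also have "\<dots> = e * s x + t k x / e - 2 * (sqrt (s x) * sqrt (t k x))"
      using that s(2) t(2) by (simp add: power2_diff power_mult_distrib power_divide)
    moreover have "0 \<le> sqrt (s x) * sqrt (t k x)" using s(2) t(2) by simp
    ultimately show ?thesis by linarith
  qed
  have b': "norm (\<Phi> x - \<Psi> k x) \<le> C * (e * s x + t k x / e)" if "0 < e" for e x k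
    using b[of x k] mult_left_mono[OF amgm[OF that, of x k] C] by linarith
  have D: "integrable M (\<lambda>x. \<Phi> x - \<Psi> k x)" for k
  proof (rule Bochner_Integration.integrable_bound)
    show "integrable M (\<lambda>x. C * (1 * s x + t k x / 1))" using s(1) t(1)[of k] by simp
    show "AE x in M. norm (\<Phi> x - \<Psi> k x) \<le> norm (C * (1 * s x + t k x / 1))"
      using b'[of 1] by (intro AE_I2) (metis abs_ge_self order_trans real_norm_def zero_less_one)
  qed (use assms in measurable)
  have J: "integrable M (\<Psi> k)" for k
    using Bochner_Integration.integrable_diff[OF I D[of k]] by simp
  have est: "norm (integral\<^sup>L M (\<Psi> k) - integral\<^sup>L M \<Phi>)
      \<le> C * (e * integral\<^sup>L M s + integral\<^sup>L M (t k) / e)" if "0 < e" for e k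
  proof -
    have "norm (integral\<^sup>L M (\<Psi> k) - integral\<^sup>L M \<Phi>) = norm (integral\<^sup>L M (\<lambda>x. \<Phi> x - \<Psi> k x))"
      using I J by (simp add: norm_minus_commute)
    also have "\<dots> \<le> integral\<^sup>L M (\<lambda>x. norm (\<Phi> x - \<Psi> k x))" by (rule integral_norm_bound)
    also have "\<dots> \<le> integral\<^sup>L M (\<lambda>x. C * (e * s x + t k x / e))"
      by (intro integral_mono integrable_norm[OF D] b'[OF that]) (use s(1) t(1)[of k] in auto)
    also have "\<dots> = C * (e * integral\<^sup>L M s + integral\<^sup>L M (t k) / e)"
      using s(1) t(1)[of k] by simp
    finally show ?thesis .
  qed
  have S: "0 \<le> integral\<^sup>L M s" using s(2) by simp
  show "(\<lambda>k. integral\<^sup>L M (\<Psi> k)) \<longlonglongrightarrow> integral\<^sup>L M \<Phi>"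
  proof (rule LIM_zero_cancel, rule tendstoI)
    fix e :: real assume e: "0 < e"
    define d where "d = e / (2 * (C * integral\<^sup>L M s + 1))"
    have pos: "0 < C * integral\<^sup>L M s + 1" using C S by (simp add: add_nonneg_pos)
    have d: "0 < d" "C * (d * integral\<^sup>L M s) < e / 2"
    proof -
      show "0 < d" using e pos by (simp add: d_def)
      have "C * (d * integral\<^sup>L M s) = d * (C * integral\<^sup>L M s)" by simp
      also have "\<dots> < d * (C * integral\<^sup>L M s + 1)" using \<open>0 < d\<close> by simp
      also have "\<dots> = e / 2" using pos unfolding d_def times_divide_eq_left by (subst mult_divide_mult_cancel_right) auto
      finally show "C * (d * integral\<^sup>L M s) < e / 2" .
    qed
    have "(\<lambda>k. C * (integral\<^sup>L M (t k) / d)) \<longlonglongrightarrow> C * (0 / d)"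
      by (intro tendsto_intros lim) (use d in auto)
    then have "\<forall>\<^sub>F k in sequentially. C * (integral\<^sup>L M (t k) / d) < e / 2"
      by (rule order_tendstoD(2)) (use e in auto)
    then show "\<forall>\<^sub>F k in sequentially. dist (integral\<^sup>L M (\<Psi> k) - integral\<^sup>L M \<Phi>) 0 < e"
    proof eventually_elim
      case (elim k)
      then show ?case using est[OF d(1), of k] d(2) unfolding dist_norm distrib_left diff_0_right by linarith
    qed
  qed
qed

section \<open>Quasi-periodicity\<close>

lemma horiz_add: "horiz (x + c *\<^sub>R axis 1 1) = horiz x + c *\<^sub>R axis 1 1"
    "horiz (x + c *\<^sub>R axis 2 1) = horiz x + c *\<^sub>R axis 2 1"
  by (auto simp: horiz_def vec_eq_iff forall_2 axis_def)

lemma continuous_on_horiz: "continuous_on S horiz"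
proof -
  have "continuous_on S (\<lambda>x::real^3. \<chi> i::2. if i = 1 then x $ 1 else x $ 2)"
  proof (intro continuous_on_vec_lambda)
    fix i :: 2
    show "continuous_on S (\<lambda>x::real^3. if i = 1 then x $ 1 else x $ 2)"
      by (cases "i = 1") (auto intro!: continuous_intros)
  qed
  moreover have "horiz = (\<lambda>x::real^3. \<chi> i::2. if i = 1 then x $ 1 else x $ 2)"
    by (auto simp: horiz_def vec_eq_iff forall_2 fun_eq_iff)
  ultimately show ?thesis by argo
qed

definition floquet :: "real \<Rightarrow> real \<Rightarrow> complex" where
  "floquet a L = exp (\<i> * of_real (a * L))"

lemma norm_floquet [simp]: "norm (floquet a L) = 1"
  by (simp add: floquet_def)

lemma quasi_biperiodicD:
  assumes "quasi_biperiodic L1 L2 al S F" "x \<in> S"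
  shows "F (x + L1 *\<^sub>R axis 1 1) = floquet (al $ 1) L1 * F x"
    and "F (x + L2 *\<^sub>R axis 2 1) = floquet (al $ 2) L2 * F x"
proof -
  have ip: "al \<bullet> (r + c *\<^sub>R axis i 1) = al \<bullet> r + al $ i * c" for r :: "real^2" and c i
    by (simp add: inner_add_right inner_axis)
  have *: "a = floquet d c * b"
    if "a * exp (- \<i> * complex_of_real (e + d * c)) = b * exp (- \<i> * complex_of_real e)" for a b c d e
  proof -
    have "a = a * exp (- \<i> * complex_of_real (e + d * c)) * exp (\<i> * complex_of_real (e + d * c))"
      by (simp flip: exp_add)
    also have "\<dots> = b * (exp (- \<i> * complex_of_real e) * exp (\<i> * complex_of_real (e + d * c)))"
      unfolding that by (simp only: mult.assoc)
    also have "\<dots> = b * exp (\<i> * complex_of_real (d * c))"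
      by (simp add: distrib_left flip: exp_add)
    finally show ?thesis by (simp add: floquet_def)
  qed
  show "F (x + L1 *\<^sub>R axis 1 1) = floquet (al $ 1) L1 * F x"
    "F (x + L2 *\<^sub>R axis 2 1) = floquet (al $ 2) L2 * F x"
    using assms by (auto simp: quasi_biperiodic_def Let_def horiz_add ip intro!: *)
qed

section \<open>The energy identity of the weak solution\<close>

definition cnjv :: "complex^'n \<Rightarrow> complex^'n" where
  "cnjv w = (\<chi> i. cnj (w $ i))"

lemma cnjv_nth [simp]: "cnjv w $ i = cnj (w $ i)"
  by (simp add: cnjv_def)

lemma bounded_linear_cnjv: "bounded_linear (cnjv :: complex^'n \<Rightarrow> _)"
  unfolding linear_conv_bounded_linear[symmetric]
  by (auto intro!: linearI simp: vec_eq_iff)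

text \<open>The integrand of the weak Navier equation for the test function \<open>\<zeta> cnj(w)\<close>, in terms of the values \<open>z\<close> of
  the real cut-off function \<open>\<zeta>\<close>, \<open>d\<close> of its gradient, \<open>v\<close> and \<open>H\<close> of the solution and its weak Jacobian, and \<open>w\<close>
  and \<open>W\<close> of the function \<open>w\<close> and its Jacobian.\<close>

definition navier_form ::
  "real \<Rightarrow> real \<Rightarrow> real \<Rightarrow> real \<Rightarrow> real^3 \<Rightarrow> complex^3 \<Rightarrow> complex^3^3 \<Rightarrow> complex^3 \<Rightarrow> complex^3^3 \<Rightarrow> complex"
  where "navier_form lam mu om z d v H w W =
    of_real mu * (\<Sum>i\<in>UNIV. \<Sum>j\<in>UNIV. H $ i $ j * (of_real z * cnj (W $ i $ j) + of_real (d $ j) * cnj (w $ i)))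
    + of_real (lam + mu) * (\<Sum>i\<in>UNIV. H $ i $ i) * (\<Sum>j\<in>UNIV. of_real z * cnj (W $ j $ j) + of_real (d $ j) * cnj (w $ j))
    - of_real (om\<^sup>2) * (\<Sum>i\<in>UNIV. v $ i * (of_real z * cnj (w $ i)))"

text \<open>The factor of \<open>d $ j\<close> in \<open>navier_form lam mu om z d v H v H\<close>.\<close>

definition energy_flux :: "real \<Rightarrow> real \<Rightarrow> complex^3 \<Rightarrow> complex^3^3 \<Rightarrow> 3 \<Rightarrow> complex" where
  "energy_flux lam mu v H j = of_real mu * (\<Sum>i\<in>UNIV. H $ i $ j * cnj (v $ i))
     + of_real (lam + mu) * (\<Sum>i\<in>UNIV. H $ i $ i) * cnj (v $ j)"

lemma navier_form_diff:
  "navier_form lam mu om z d v H w W - navier_form lam mu om z d v H w' W'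
   = navier_form lam mu om z d v H (w - w') (W - W')"
  unfolding navier_form_def sum_3 vector_minus_component complex_cnj_diff
  by (simp only: algebra_simps)

text \<open>The terms without derivatives of the cut-off function are real multiples of squared moduli.\<close>

lemma Im_navier_form_self:
  "Im (navier_form lam mu om z d v H v H) = (\<Sum>j\<in>UNIV. d $ j * Im (energy_flux lam mu v H j))"
proof -
  define T where "T = (\<Sum>i\<in>UNIV. H $ i $ i)"
  define N where "N = (\<Sum>i\<in>UNIV. \<Sum>j\<in>UNIV. (norm (H $ i $ j))\<^sup>2)"
  define V where "V = (\<Sum>i\<in>UNIV. (norm (v $ i))\<^sup>2)"
  define R where "R = (\<lambda>j. \<Sum>i\<in>UNIV. H $ i $ j * cnj (v $ i))"
  have 1: "(\<Sum>i\<in>UNIV. \<Sum>j\<in>UNIV. H $ i $ j * (of_real z * cnj (H $ i $ j) + of_real (d $ j) * cnj (v $ i)))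
      = of_real z * of_real N + (\<Sum>j\<in>UNIV. of_real (d $ j) * R j)"
    unfolding N_def R_def sum_3 by (simp only: of_real_add complex_norm_square algebra_simps)
  have 2: "(\<Sum>j\<in>UNIV. of_real z * cnj (H $ j $ j) + of_real (d $ j) * cnj (v $ j))
      = of_real z * cnj T + (\<Sum>j\<in>UNIV. of_real (d $ j) * cnj (v $ j))"
    unfolding T_def sum_3 by (simp only: complex_cnj_add algebra_simps)
  have 3: "(\<Sum>i\<in>UNIV. v $ i * (of_real z * cnj (v $ i))) = of_real z * of_real V"
    unfolding V_def sum_3 by (simp only: of_real_add complex_norm_square algebra_simps)
  define X where "X = (\<Sum>j\<in>UNIV. of_real (d $ j) * R j)"
  define Y where "Y = (\<Sum>j\<in>UNIV. of_real (d $ j) * cnj (v $ j))"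
  have 4: "(\<Sum>j\<in>UNIV. of_real (d $ j) * (of_real mu * R j + of_real (lam + mu) * T * cnj (v $ j)))
      = of_real mu * X + of_real (lam + mu) * T * Y"
    unfolding X_def Y_def sum_3 by (simp only: algebra_simps)
  have "navier_form lam mu om z d v H v H =
      of_real mu * (of_real z * of_real N + X) + of_real (lam + mu) * T * (of_real z * cnj T + Y)
      - of_real (om\<^sup>2) * (of_real z * of_real V)"
    unfolding navier_form_def 1 2 3 T_def[symmetric] X_def[symmetric] Y_def[symmetric] by (rule refl)
  also have "\<dots> = of_real mu * (of_real z * of_real N) + of_real (lam + mu) * (of_real z * (T * cnj T))
      - of_real (om\<^sup>2) * (of_real z * of_real V) + (of_real mu * X + of_real (lam + mu) * T * Y)"
    by (simp only: distrib_left distrib_right mult_ac add_ac diff_conv_add_uminus)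
  also have "\<dots> = of_real (mu * (z * N) + (lam + mu) * (z * (norm T)\<^sup>2) - om\<^sup>2 * (z * V))
      + (of_real mu * X + of_real (lam + mu) * T * Y)"
    unfolding complex_norm_square[symmetric] of_real_mult of_real_diff of_real_add[of "_ * _"] by (rule refl)
  finally have "Im (navier_form lam mu om z d v H v H)
      = Im (\<Sum>j\<in>UNIV. of_real (d $ j) * (of_real mu * R j + of_real (lam + mu) * T * cnj (v $ j)))"
    unfolding 4 by simp
  then show ?thesis by (simp add: energy_flux_def T_def R_def)
qed

lemma norm_nth_nth_le: "norm (H $ i $ j) \<le> norm (H::complex^'n^'m)"
  by (rule order.trans[OF Finite_Cartesian_Product.norm_nth_le Finite_Cartesian_Product.norm_nth_le])

lemma energy_flux_bound_components:
  assumes "\<And>i. norm (v $ i) \<le> N" "\<And>i j. norm (H $ i $ j) \<le> N"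
  shows "norm (energy_flux lam mu v H j) \<le> (3 * \<bar>mu\<bar> + 3 * \<bar>lam + mu\<bar>) * N\<^sup>2"
proof -
  have N: "0 \<le> N" using order.trans[OF norm_ge_zero assms(1)] .
  have p: "norm (H $ i $ k * cnj (v $ l)) \<le> N\<^sup>2" for i k l
    unfolding norm_mult complex_mod_cnj power2_eq_square by (intro mult_mono assms N) auto
  have "norm (energy_flux lam mu v H j) \<le> norm (of_real mu * (\<Sum>i\<in>UNIV. H $ i $ j * cnj (v $ i)))
     + norm (of_real (lam + mu) * (\<Sum>i\<in>UNIV. H $ i $ i * cnj (v $ j)))"
    unfolding energy_flux_def mult.assoc sum_distrib_right by (rule norm_triangle_ineq)
  also have "\<dots> \<le> \<bar>mu\<bar> * (3 * N\<^sup>2) + \<bar>lam + mu\<bar> * (3 * N\<^sup>2)"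
    unfolding norm_mult norm_of_real
    by (intro add_mono mult_left_mono order.trans[OF norm_sum] order.trans[OF sum_bounded_above[of UNIV _ "N\<^sup>2"]] p)
       auto
  finally show ?thesis by (simp add: algebra_simps)
qed

lemma energy_flux_bound:
  "norm (energy_flux lam mu v H j) \<le> (3 * \<bar>mu\<bar> + 3 * \<bar>lam + mu\<bar>) * ((norm v)\<^sup>2 + (norm H)\<^sup>2)"
proof -
  have "norm (energy_flux lam mu v H j)
      \<le> (3 * \<bar>mu\<bar> + 3 * \<bar>lam + mu\<bar>) * (sqrt ((norm v)\<^sup>2 + (norm H)\<^sup>2))\<^sup>2"
    by (intro energy_flux_bound_components order.trans[OF Finite_Cartesian_Product.norm_nth_le]
        order.trans[OF norm_nth_nth_le] real_le_rsqrt) auto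
  then show ?thesis by simp
qed

lemma navier_form_bound:
  assumes "\<bar>z\<bar> \<le> K" "\<And>j. \<bar>d $ j\<bar> \<le> K"
  shows "norm (navier_form lam mu om z d v H w W)
    \<le> (18 * \<bar>mu\<bar> + 18 * \<bar>lam + mu\<bar> + 3 * om\<^sup>2) * K *
       (sqrt ((norm v)\<^sup>2 + (norm H)\<^sup>2) * sqrt ((norm w)\<^sup>2 + (norm W)\<^sup>2))"
proof -
  define S where "S = sqrt ((norm v)\<^sup>2 + (norm H)\<^sup>2)"
  define T where "T = sqrt ((norm w)\<^sup>2 + (norm W)\<^sup>2)"
  have nn: "0 \<le> S" "0 \<le> T" "0 \<le> K" using assms(1) by (auto simp: S_def T_def)
  have S: "norm v \<le> S" "norm H \<le> S" by (auto simp: S_def intro!: real_le_rsqrt)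
  have T: "norm w \<le> T" "norm W \<le> T" by (auto simp: T_def intro!: real_le_rsqrt)
  have b1: "norm (of_real z * cnj (W $ i $ j)) \<le> K * T" for i j
    unfolding norm_mult complex_mod_cnj norm_of_real
    by (intro mult_mono assms order.trans[OF norm_nth_nth_le T(2)] nn) auto
  have b2: "norm (of_real (d $ j) * cnj (w $ i)) \<le> K * T" for i j
    unfolding norm_mult complex_mod_cnj norm_of_real
    by (intro mult_mono assms order.trans[OF Finite_Cartesian_Product.norm_nth_le T(1)] nn) auto
  have b3: "norm (of_real z * cnj (w $ i)) \<le> K * T" for i
    unfolding norm_mult complex_mod_cnj norm_of_real
    by (intro mult_mono assms order.trans[OF Finite_Cartesian_Product.norm_nth_le T(1)] nn) auto
  have c: "norm (of_real z * cnj (W $ i $ j) + of_real (d $ k) * cnj (w $ l)) \<le> 2 * (K * T)" for i j k l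
    using norm_triangle_ineq[of "of_real z * cnj (W $ i $ j)" "of_real (d $ k) * cnj (w $ l)"] b1[of i j] b2[of k l]
    by linarith
  have h: "norm (H $ i $ j) \<le> S" for i j using norm_nth_nth_le S(2) by (rule order.trans)
  have sum3: "norm (\<Sum>i\<in>UNIV. F i) \<le> 3 * y" if "\<And>i. norm (F i) \<le> y" for F :: "3 \<Rightarrow> complex" and y
    using sum_norm_bound[of UNIV F y] that by simp
  have t1: "norm (\<Sum>i\<in>UNIV. \<Sum>j\<in>UNIV. H $ i $ j * (of_real z * cnj (W $ i $ j) + of_real (d $ j) * cnj (w $ i)))
      \<le> 3 * (3 * (S * (2 * (K * T))))"
    by (intro sum3) (auto simp only: norm_mult intro!: mult_mono h c nn norm_ge_zero)
  have t2: "norm ((\<Sum>i\<in>UNIV. H $ i $ i) * (\<Sum>j\<in>UNIV. of_real z * cnj (W $ j $ j) + of_real (d $ j) * cnj (w $ j)))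
      \<le> (3 * S) * (3 * (2 * (K * T)))"
    unfolding norm_mult by (intro mult_mono sum3 h c) (use nn in auto)
  have t3: "norm (\<Sum>i\<in>UNIV. v $ i * (of_real z * cnj (w $ i))) \<le> 3 * (S * (K * T))"
    by (intro sum3) (simp only: norm_mult[of "v $ _"], intro mult_mono b3 order.trans[OF Finite_Cartesian_Product.norm_nth_le S(1)] nn norm_ge_zero)
  have "norm (navier_form lam mu om z d v H w W)
     \<le> norm (of_real mu * (\<Sum>i\<in>UNIV. \<Sum>j\<in>UNIV. H $ i $ j * (of_real z * cnj (W $ i $ j) + of_real (d $ j) * cnj (w $ i))))
      + norm (of_real (lam + mu) * ((\<Sum>i\<in>UNIV. H $ i $ i) * (\<Sum>j\<in>UNIV. of_real z * cnj (W $ j $ j) + of_real (d $ j) * cnj (w $ j))))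
      + norm (of_real (om\<^sup>2) * (\<Sum>i\<in>UNIV. v $ i * (of_real z * cnj (w $ i))))"
    unfolding navier_form_def mult.assoc
    by (intro order.trans[OF norm_triangle_ineq4] add_right_mono norm_triangle_ineq)
  also have "\<dots> \<le> \<bar>mu\<bar> * (3 * (3 * (S * (2 * (K * T))))) + \<bar>lam + mu\<bar> * ((3 * S) * (3 * (2 * (K * T))))
      + om\<^sup>2 * (3 * (S * (K * T)))"
    unfolding norm_mult[of "of_real _"] norm_of_real abs_power2 by (intro add_mono mult_left_mono t1 t2 t3) auto
  finally show ?thesis by (simp add: S_def[symmetric] T_def[symmetric] algebra_simps)
qed

locale rigid_scatterer =
  fixes lam mu om L1 L2 h :: real and al :: "real^2" and f :: "real^2 \<Rightarrow> real"
    and u :: "real^3 \<Rightarrow> complex^3" and G :: "real^3 \<Rightarrow> complex^3^3"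
  assumes L: "0 < L1" "0 < L2"
    and lipschitz: "\<exists>C. C-lipschitz_on UNIV f" and biper: "biperiodic L1 L2 f"
    and height: "\<And>r. f r < h"
    and u_meas: "u \<in> borel_measurable (lebesgue_on (region_above f))"
    and u_qp: "\<And>i. quasi_biperiodic L1 L2 al (region_above f) (\<lambda>x. u x $ i)"
    and G_meas: "G \<in> borel_measurable (lebesgue_on (region_above f))"
    and G_qp: "\<And>i j. quasi_biperiodic L1 L2 al (region_above f) (\<lambda>x. G x $ i $ j)"
    and wjac: "weak_jacobian (region_above f) u G"
    and H1: "\<And>c. (\<And>r. f r < c) \<Longrightarrow> H1_cell L1 L2 f c u G"
    and zero: "\<And>c. (\<And>r. f r < c) \<Longrightarrow> zero_on_surface L1 L2 al f c u G"
    and navier: "weak_navier lam mu om (region_above f) u G"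
begin

abbreviation "U \<equiv> region_above f"

abbreviation "cell \<equiv> period_cell L1 L2 f (h + 4)"

text \<open>The union of the four translates of the cell that meet the supports of the cut-off functions,
  together with the faces between them. The top lies at \<open>h + 4\<close> while the cut-off functions vanish
  above \<open>h + 3\<close>, so that closed supports stay inside.\<close>

definition box :: "(real^3) set" where
  "box = {x \<in> U. - L1 \<le> x $ 1 \<and> x $ 1 \<le> L1 \<and> - L2 \<le> x $ 2 \<and> x $ 2 \<le> L2 \<and> x $ 3 < h + 4}"

definition u0 where "u0 x = indicator U x *\<^sub>R u x"
definition G0 where "G0 x = indicator U x *\<^sub>R G x"

lemma f_cont: "continuous_on S f"
  using lipschitz lipschitz_on_continuous_on continuous_on_subset by blast

lemma fh_cont: "continuous_on S (\<lambda>x. f (horiz x))"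
  by (rule continuous_on_compose2[OF f_cont continuous_on_horiz]) auto

lemma open_U: "open U"
  unfolding region_above_def by (intro open_Collect_less fh_cont continuous_intros)

lemma U_sets: "U \<in> sets lebesgue" using open_U by simp

lemma U_translate [simp]:
  "x + L1 *\<^sub>R axis 1 1 \<in> U \<longleftrightarrow> x \<in> U" "x + L2 *\<^sub>R axis 2 1 \<in> U \<longleftrightarrow> x \<in> U"
  using biper by (auto simp: region_above_def horiz_add biperiodic_def axis_nth_eq)

lemma u0_meas [measurable]: "u0 \<in> borel_measurable lebesgue"
  unfolding u0_def[abs_def] using u_meas U_sets by (simp add: borel_measurable_restrict_space_iff)

lemma G0_meas [measurable]: "G0 \<in> borel_measurable lebesgue"
  unfolding G0_def[abs_def] using G_meas U_sets by (simp add: borel_measurable_restrict_space_iff)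

lemma u0_qp:
  "u0 (x + L1 *\<^sub>R axis 1 1) $ i = floquet (al $ 1) L1 * u0 x $ i"
  "u0 (x + L2 *\<^sub>R axis 2 1) $ i = floquet (al $ 2) L2 * u0 x $ i"
  using quasi_biperiodicD[OF u_qp[of i], of x] by (auto simp: u0_def indicator_def)

lemma G0_qp:
  "G0 (x + L1 *\<^sub>R axis 1 1) $ i $ j = floquet (al $ 1) L1 * G0 x $ i $ j"
  "G0 (x + L2 *\<^sub>R axis 2 1) $ i $ j = floquet (al $ 2) L2 * G0 x $ i $ j"
  using quasi_biperiodicD[OF G_qp[of i j], of x] by (auto simp: G0_def indicator_def)

lemma box_bounded: "bounded box"
proof -
  define K where "K = cbox (vector [-L1, -L2]) (vector [L1, L2] :: real^2)"
  have "compact (f ` K)" unfolding K_def by (intro compact_continuous_image f_cont compact_cbox)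
  then have "bdd_below (f ` K)" by (intro bounded_imp_bdd_below compact_imp_bounded)
  then obtain m where m: "\<And>r. r \<in> K \<Longrightarrow> m \<le> f r"
    unfolding bdd_below_def by auto
  have "box \<subseteq> cbox (vector [-L1, -L2, m]) (vector [L1, L2, h + 4])"
  proof
    fix x assume x: "x \<in> box"
    then have "horiz x \<in> K" by (auto simp: K_def mem_box_cart forall_2 box_def horiz_def)
    from m[OF this] x show "x \<in> cbox (vector [-L1, -L2, m]) (vector [L1, L2, h + 4])"
      by (auto simp: mem_box_cart forall_3 box_def region_above_def)
  qed
  then show ?thesis using bounded_cbox bounded_subset by blast
qed

lemma cell_subset_box: "cell \<subseteq> box"
  using L by (auto simp: period_cell_def box_def region_above_def)

lemma box_sets: "box \<in> sets lebesgue"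
proof -
  have "box = U \<inter> {x. - L1 \<le> x $ 1} \<inter> {x. x $ 1 \<le> L1} \<inter> {x. - L2 \<le> x $ 2} \<inter> {x. x $ 2 \<le> L2} \<inter> {x. x $ 3 < h + 4}"
    by (auto simp: box_def)
  moreover have "closed {x::real^3. c \<le> x $ i}" "closed {x::real^3. x $ i \<le> c}" "open {x::real^3. x $ i < c}" for c i
    by (intro closed_Collect_le open_Collect_less continuous_intros)+
  ultimately show ?thesis using U_sets by (auto intro!: sets.Int)
qed

lemma cell_sets: "cell \<in> sets lebesgue"
proof -
  have "open cell" unfolding period_cell_def
    by (intro open_Collect_conj open_Collect_less fh_cont continuous_intros)
  then show ?thesis by simp
qed

lemma box_integral:
  fixes g :: "real^3 \<Rightarrow> real"
  assumes g: "g \<in> borel_measurable lebesgue" "\<And>x. 0 \<le> g x"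
    and per: "\<And>x. g (x + L1 *\<^sub>R axis 1 1) = g x" "\<And>x. g (x + L2 *\<^sub>R axis 2 1) = g x"
    and int: "integrable lebesgue (\<lambda>x. indicator cell x * g x)"
  shows "integrable lebesgue (\<lambda>x. indicator box x * g x)"
    and "(\<integral>x. indicator box x * g x \<partial>lebesgue) = 4 * (\<integral>x. indicator cell x * g x \<partial>lebesgue)"
proof -
  have op: "open {x::real^3. 0 < x $ j \<and> x $ j < c}" "closed {x::real^3. -c \<le> x $ j \<and> x $ j \<le> c}" for j c
    by (intro open_Collect_conj open_Collect_less closed_Collect_conj closed_Collect_le continuous_intros)+
  then have ms: "{x::real^3. 0 < x $ j \<and> x $ j < c} \<in> sets lebesgue" "{x::real^3. -c \<le> x $ j \<and> x $ j \<le> c} \<in> sets lebesgue" for j c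
    by auto
  have op3: "open {x::real^3. x $ 3 < h + 4}" by (intro open_Collect_less continuous_intros)
  define k where "k x = ennreal (g x) * indicator U x * indicator {x. x $ 3 < h + 4} x" for x
  have k: "k \<in> borel_measurable lebesgue" unfolding k_def[abs_def] using g(1) U_sets op3 by measurable
  have kp: "k (x + L1 *\<^sub>R axis 1 1) = k x" "k (x + L2 *\<^sub>R axis 2 1) = k x" for x
    by (auto simp: k_def per indicator_def axis_nth_eq)
  define A where "A j c = (indicator {x::real^3. -c \<le> x $ j \<and> x $ j \<le> c} :: _ \<Rightarrow> ennreal)" for j c
  define D where "D j c = (indicator {x::real^3. 0 < x $ j \<and> x $ j < c} :: _ \<Rightarrow> ennreal)" for j c
  have AD: "A j c \<in> borel_measurable lebesgue" "D j c \<in> borel_measurable lebesgue" for j c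
    unfolding A_def D_def using ms by auto
  have A2: "A 2 c (x + a *\<^sub>R axis 1 1) = A 2 c x" for c x a by (auto simp: A_def axis_nth_eq indicator_def)
  have D1: "D 1 c (x + a *\<^sub>R axis 2 1) = D 1 c x" for c x a by (auto simp: D_def axis_nth_eq indicator_def)
  have "(\<integral>\<^sup>+x. ennreal (indicator box x * g x) \<partial>lebesgue) = (\<integral>\<^sup>+x. (k x * A 2 L2 x) * A 1 L1 x \<partial>lebesgue)"
    by (intro nn_integral_cong) (auto simp: k_def A_def box_def indicator_def)
  also have "\<dots> = 2 * (\<integral>\<^sup>+x. (k x * A 2 L2 x) * D 1 L1 x \<partial>lebesgue)"
    using nn_integral_two_periods[OF L(1), of "\<lambda>x. k x * A 2 L2 x" 1] k AD
    by (simp add: kp A2 A_def[of 1] D_def[of 1])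
  also have "(\<integral>\<^sup>+x. (k x * A 2 L2 x) * D 1 L1 x \<partial>lebesgue) = (\<integral>\<^sup>+x. (k x * D 1 L1 x) * A 2 L2 x \<partial>lebesgue)"
    by (simp add: mult_ac)
  also have "\<dots> = 2 * (\<integral>\<^sup>+x. (k x * D 1 L1 x) * D 2 L2 x \<partial>lebesgue)"
    using nn_integral_two_periods[OF L(2), of "\<lambda>x. k x * D 1 L1 x" 2] k AD
    by (simp add: kp D1 A_def[of 2] D_def[of 2])
  also have "(\<integral>\<^sup>+x. (k x * D 1 L1 x) * D 2 L2 x \<partial>lebesgue) = (\<integral>\<^sup>+x. ennreal (indicator cell x * g x) \<partial>lebesgue)"
    by (intro nn_integral_cong) (auto simp: k_def D_def period_cell_def region_above_def indicator_def)
  also have "\<dots> = ennreal (\<integral>x. indicator cell x * g x \<partial>lebesgue)"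
    by (rule nn_integral_eq_integral[OF int]) (simp add: g(2))
  finally have eq: "(\<integral>\<^sup>+x. ennreal (indicator box x * g x) \<partial>lebesgue)
      = 2 * (2 * ennreal (\<integral>x. indicator cell x * g x \<partial>lebesgue))" .
  have ge: "0 \<le> (\<integral>x. indicator cell x * g x \<partial>lebesgue)" by (simp add: g(2))
  have eq': "(\<integral>\<^sup>+x. ennreal (indicator box x * g x) \<partial>lebesgue)
      = ennreal (4 * (\<integral>x. indicator cell x * g x \<partial>lebesgue))"
    unfolding eq using ge by (simp add: ennreal_mult flip: mult.assoc)
  have m: "(\<lambda>x. indicator box x * g x) \<in> borel_measurable lebesgue" using g(1) box_sets by measurable
  show I: "integrable lebesgue (\<lambda>x. indicator box x * g x)"
    by (rule integrableI_nn_integral_finite[OF m _ eq']) (use g ge in auto)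
  show "(\<integral>x. indicator box x * g x \<partial>lebesgue) = 4 * (\<integral>x. indicator cell x * g x \<partial>lebesgue)"
    using nn_integral_eq_integral[OF I] eq' ge g(2) by simp
qed

definition sq_density where "sq_density x = indicator box x * ((norm (u0 x))\<^sup>2 + (norm (G0 x))\<^sup>2)"

lemma norm_periodic:
  fixes v v' :: "complex^'n"
  assumes "\<And>i. v $ i = c * v' $ i" "norm c = 1"
  shows "norm v = norm v'"
  by (simp add: norm_vec_def assms norm_mult)

lemma norm_periodic2:
  fixes v v' :: "complex^'n^'m"
  assumes "\<And>i j. v $ i $ j = c * v' $ i $ j" "norm c = 1"
  shows "norm v = norm v'"
proof -
  have "norm (v $ i) = norm (v' $ i)" for i
    using norm_periodic[of "v $ i" c "v' $ i"] assms by blast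
  then show ?thesis unfolding norm_vec_def[of v] norm_vec_def[of v'] by simp
qed

lemma sq_density_integrable: "integrable lebesgue sq_density"
proof -
  have "H1_cell L1 L2 f (h + 4) u G"
    using height by (intro H1) (smt (verit))
  then have 1: "integrable lebesgue (\<lambda>x. indicator cell x *\<^sub>R ((norm (u x))\<^sup>2 + (norm (G x))\<^sup>2))"
    by (simp add: H1_cell_def set_integrable_def)
  have 2: "(\<lambda>x. indicator cell x *\<^sub>R ((norm (u x))\<^sup>2 + (norm (G x))\<^sup>2))
      = (\<lambda>x. indicator cell x * ((norm (u0 x))\<^sup>2 + (norm (G0 x))\<^sup>2))"
  proof
    fix x
    show "indicator cell x *\<^sub>R ((norm (u x))\<^sup>2 + (norm (G x))\<^sup>2)
      = indicator cell x * ((norm (u0 x))\<^sup>2 + (norm (G0 x))\<^sup>2)"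
      using cell_subset_box by (cases "x \<in> cell") (auto simp: u0_def G0_def box_def)
  qed
  have "integrable lebesgue (\<lambda>x. indicator cell x * ((norm (u0 x))\<^sup>2 + (norm (G0 x))\<^sup>2))"
    using 1 unfolding 2 .
  then show ?thesis unfolding sq_density_def[abs_def]
    by (intro box_integral)
       (auto simp: norm_periodic[OF u0_qp(1)] norm_periodic[OF u0_qp(2)]
          norm_periodic2[OF G0_qp(1)] norm_periodic2[OF G0_qp(2)])
qed

end

lemma scaleR_nth: "(c *\<^sub>R v) $ i = of_real c * v $ i" for v :: "complex^'n"
  by (subst vector_scaleR_component) (rule scaleR_conv_of_real)

context rigid_scatterer begin

lemma u_on_U: "x \<in> U \<Longrightarrow> u0 x = u x" "x \<in> U \<Longrightarrow> G0 x = G x"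
  by (auto simp: u0_def G0_def)

definition admissible_weight :: "(real^3 \<Rightarrow> real) \<Rightarrow> bool" where
  "admissible_weight y \<longleftrightarrow> continuous_on UNIV y \<and>
     (\<forall>x. y x \<noteq> 0 \<longrightarrow> - L1 \<le> x $ 1 \<and> x $ 1 \<le> L1 \<and> - L2 \<le> x $ 2 \<and> x $ 2 \<le> L2 \<and> x $ 3 \<le> h + 3)"

lemma weight_zero:
  assumes "admissible_weight y" "x \<notin> box"
  shows "y x = 0 \<or> (u0 x = 0 \<and> G0 x = 0)"
  using assms by (force simp: admissible_weight_def box_def u0_def G0_def)

lemma weight_bounded:
  assumes "admissible_weight y"
  obtains K where "0 \<le> K" "\<And>x. x \<in> box \<Longrightarrow> \<bar>y x\<bar> \<le> K"
proof -
  have "compact (y ` closure box)"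
    using assms box_bounded
    by (intro compact_continuous_image) (auto simp: admissible_weight_def intro: continuous_on_subset)
  then obtain B where "\<And>v. v \<in> y ` closure box \<Longrightarrow> norm v \<le> B"
    by (meson compact_imp_bounded bounded_iff)
  then have "\<bar>y x\<bar> \<le> max B 0" if "x \<in> box" for x
    using that closure_subset[of box] by (force simp: le_max_iff_disj)
  with that[of "max B 0"] show thesis by simp
qed

abbreviation "flux x j \<equiv> energy_flux lam mu (u0 x) (G0 x) j"

lemma measurable_nth:
  assumes "g \<in> borel_measurable lebesgue"
  shows "(\<lambda>x. g x $ i) \<in> borel_measurable lebesgue"
  using assms borel_measurable_continuous_on[of "\<lambda>v. v $ i" g lebesgue]
  by (simp add: continuous_on_component continuous_on_id)

lemma measurable_cnj:
  assumes "g \<in> borel_measurable lebesgue"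
  shows "(\<lambda>x. cnj (g x)) \<in> borel_measurable lebesgue"
  using assms borel_measurable_continuous_on[of cnj g lebesgue]
  by (simp add: continuous_on_cnj continuous_on_id)

lemma u0_nth_meas [measurable]: "(\<lambda>x. u0 x $ i) \<in> borel_measurable lebesgue"
  by (rule measurable_nth) simp

lemma G0_nth_meas [measurable]: "(\<lambda>x. G0 x $ i $ j) \<in> borel_measurable lebesgue"
  by (intro measurable_nth) simp

lemma flux_meas [measurable]: "(\<lambda>x. flux x j) \<in> borel_measurable lebesgue"
proof -
  have [measurable]: "(\<lambda>x. cnj (u0 x $ i)) \<in> borel_measurable lebesgue" for i
    by (rule measurable_cnj) simp
  show ?thesis unfolding energy_flux_def by measurable
qed

lemma integrable_weight_bilinear:
  assumes y: "admissible_weight y" and F: "F \<in> borel_measurable lebesgue"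
    and b: "\<And>x. norm (F x) \<le> C * ((norm (u0 x))\<^sup>2 + (norm (G0 x))\<^sup>2)" and C: "0 \<le> C"
  shows "integrable lebesgue (\<lambda>x. of_real (y x) * F x :: complex)"
proof -
  obtain K where K: "0 \<le> K" "\<And>x. x \<in> box \<Longrightarrow> \<bar>y x\<bar> \<le> K" by (rule weight_bounded[OF y]) blast
  have ym: "y \<in> borel_measurable lebesgue"
    using y by (auto simp: admissible_weight_def intro: borel_measurable_lebesgue_continuous)
  show ?thesis
  proof (rule Bochner_Integration.integrable_bound)
    show "integrable lebesgue (\<lambda>x. (K * C) * sq_density x)" using sq_density_integrable by simp
    show "(\<lambda>x. of_real (y x) * F x) \<in> borel_measurable lebesgue" using ym F by measurable
    show "AE x in lebesgue. norm (of_real (y x) * F x) \<le> norm (K * C * sq_density x)"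
    proof (rule AE_I2)
      fix x
      show "norm (of_real (y x) * F x) \<le> norm (K * C * sq_density x)"
      proof (cases "x \<in> box")
        case True
        have "norm (of_real (y x) * F x) \<le> K * (C * ((norm (u0 x))\<^sup>2 + (norm (G0 x))\<^sup>2))"
          unfolding norm_mult norm_of_real using K True by (intro mult_mono b) auto
        also have "\<dots> = K * C * sq_density x" using True by (simp add: sq_density_def)
        finally show ?thesis by (simp add: abs_le_iff order.trans[OF _ abs_ge_self])
      next
        case False
        from weight_zero[OF y this] b[of x] show ?thesis by auto
      qed
    qed
  qed
qed

lemma integrable_weight_flux:
  "admissible_weight y \<Longrightarrow> integrable lebesgue (\<lambda>x. of_real (y x) * flux x j)"
  by (rule integrable_weight_bilinear[OF _ flux_meas energy_flux_bound]) auto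

lemma flux_periodic:
  "flux (x + L1 *\<^sub>R axis 1 1) j = flux x j" "flux (x + L2 *\<^sub>R axis 2 1) j = flux x j"
proof -
  have c: "floquet a b * (cnj (floquet a b) * w) = w" for a b w
    by (simp add: complex_norm_square[symmetric] flip: mult.assoc)
  show "flux (x + L1 *\<^sub>R axis 1 1) j = flux x j" "flux (x + L2 *\<^sub>R axis 2 1) j = flux x j"
    unfolding energy_flux_def u0_qp G0_qp complex_cnj_mult sum_distrib_left[symmetric]
    by (simp_all add: c mult_ac flip: sum_distrib_left)
qed

lemma continuous_jacobian: "C1_on UNIV v \<Longrightarrow> continuous_on UNIV (jacobian v)"
  unfolding C1_on_def jacobian_def by (auto intro!: continuous_intros)

text \<open>The approximations from the definition of zero boundary values converge in the mean on one cell,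
  hence on the box, because the error is biperiodic.\<close>

lemma surface_approximation:
  obtains w where "\<And>k. C1_on UNIV (w k)" "\<And>k. \<exists>d>0. \<forall>x. x $ 3 \<le> f (horiz x) + d \<longrightarrow> w k x = 0"
    "\<And>k. integrable lebesgue (\<lambda>x. indicator box x * ((norm (u0 x - w k x))\<^sup>2 + (norm (G0 x - jacobian (w k) x))\<^sup>2))"
    "(\<lambda>k. \<integral>x. indicator box x * ((norm (u0 x - w k x))\<^sup>2 + (norm (G0 x - jacobian (w k) x))\<^sup>2) \<partial>lebesgue) \<longlonglongrightarrow> 0"
proof -
  obtain w where w: "\<And>k. C1_on UNIV (w k)" "\<And>k i. quasi_biperiodic L1 L2 al UNIV (\<lambda>x. w k x $ i)"
      "\<And>k. \<exists>d>0. \<forall>x. x $ 3 \<le> f (horiz x) + d \<longrightarrow> w k x = 0"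
    and wlim: "(\<lambda>k. LINT x:cell|lebesgue.
               (norm (u x - w k x))\<^sup>2 + (norm (G x - jacobian (w k) x))\<^sup>2) \<longlonglongrightarrow> 0"
  proof -
    have "zero_on_surface L1 L2 al f (h + 4) u G"
      using height by (intro zero) (smt (verit))
    then show thesis using that unfolding zero_on_surface_def by blast
  qed
  have wc: "continuous_on UNIV (w k)" for k using C1_on_cont[OF w(1)] .
  have jc: "continuous_on UNIV (jacobian (w k))" for k by (rule continuous_jacobian[OF w(1)])
  have wm [measurable]: "w k \<in> borel_measurable lebesgue" "jacobian (w k) \<in> borel_measurable lebesgue" for k
    by (intro borel_measurable_lebesgue_continuous wc jc)+
  have wqp: "w k (x + L1 *\<^sub>R axis 1 1) $ i = floquet (al $ 1) L1 * w k x $ i"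
     "w k (x + L2 *\<^sub>R axis 2 1) $ i = floquet (al $ 2) L2 * w k x $ i" for k x i
    using quasi_biperiodicD[OF w(2)[of k i], of x] by auto
  have jqp: "jacobian (w k) (x + L1 *\<^sub>R axis 1 1) $ i $ j = floquet (al $ 1) L1 * jacobian (w k) x $ i $ j"
     "jacobian (w k) (x + L2 *\<^sub>R axis 2 1) $ i $ j = floquet (al $ 2) L2 * jacobian (w k) x $ i $ j" for k x i j
  proof -
    have bl: "bounded_linear (\<lambda>v::complex^3. (\<chi> i. c * v $ i))" for c
      unfolding linear_conv_bounded_linear[symmetric]
      by (auto intro!: linearI simp: vec_eq_iff algebra_simps)
    have "partial j (w k) (x + a) $ i = c * partial j (w k) x $ i"
      if "\<And>x i. w k (x + a) $ i = c * w k x $ i" for a c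
    proof -
      have "partial j (w k) (x + a) = partial j (\<lambda>x. w k (x + a)) x" by (simp add: partial_translation)
      also have "(\<lambda>x. w k (x + a)) = (\<lambda>x. (\<chi> i. c * w k x $ i))" using that by (auto simp: vec_eq_iff)
      also have "partial j \<dots> x = (\<chi> i. c * partial j (w k) x $ i)"
        by (rule C1_on_bounded_linear(2)[OF bl w(1)]) simp
      finally show ?thesis by simp
    qed
    then show "jacobian (w k) (x + L1 *\<^sub>R axis 1 1) $ i $ j = floquet (al $ 1) L1 * jacobian (w k) x $ i $ j"
     "jacobian (w k) (x + L2 *\<^sub>R axis 2 1) $ i $ j = floquet (al $ 2) L2 * jacobian (w k) x $ i $ j"
      using wqp by (auto simp: jacobian_def)
  qed
  define g where "g k x = (norm (u0 x - w k x))\<^sup>2 + (norm (G0 x - jacobian (w k) x))\<^sup>2" for k x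
  have gm: "g k \<in> borel_measurable lebesgue" for k unfolding g_def[abs_def] by measurable
  have gp': "g k (x + c) = g k x"
    if "\<And>i. u0 (x + c) $ i = z * u0 x $ i" "\<And>i j. G0 (x + c) $ i $ j = z * G0 x $ i $ j"
      "\<And>i. w k (x + c) $ i = z * w k x $ i" "\<And>i j. jacobian (w k) (x + c) $ i $ j = z * jacobian (w k) x $ i $ j"
      "norm z = 1" for k x c z
    unfolding g_def using norm_periodic[of "u0 (x + c) - w k (x + c)" z "u0 x - w k x"]
      norm_periodic2[of "G0 (x + c) - jacobian (w k) (x + c)" z "G0 x - jacobian (w k) x"] that
    by (simp add: right_diff_distrib)
  have gp: "g k (x + L1 *\<^sub>R axis 1 1) = g k x" "g k (x + L2 *\<^sub>R axis 2 1) = g k x" for k x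
    by (rule gp'[OF u0_qp(1) G0_qp(1) wqp(1) jqp(1) norm_floquet] gp'[OF u0_qp(2) G0_qp(2) wqp(2) jqp(2) norm_floquet])+
  have gi: "integrable lebesgue (\<lambda>x. indicator cell x * g k x)" for k
  proof -
    define m where "m x = (norm (w k x))\<^sup>2 + (norm (jacobian (w k) x))\<^sup>2" for x
    have "compact (m ` closure box)" unfolding m_def
      using box_bounded
      by (intro compact_continuous_image continuous_intros continuous_on_subset[OF wc] continuous_on_subset[OF jc]) auto
    then obtain B where B: "\<And>v. v \<in> m ` closure box \<Longrightarrow> norm v \<le> B"
      by (meson compact_imp_bounded bounded_iff)
    have B': "m x \<le> B" if "x \<in> cell" for x
      using that cell_subset_box closure_subset[of box] B[of "m x"] by auto
    have mc: "emeasure lebesgue cell < \<infinity>"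
      using bounded_set_imp_lmeasurable[of cell] cell_sets bounded_subset[OF box_bounded cell_subset_box]
      by (simp add: fmeasurable_def)
    show ?thesis
    proof (rule Bochner_Integration.integrable_bound)
      show "integrable lebesgue (\<lambda>x. 2 * sq_density x + indicator cell x * (2 * B))"
        using sq_density_integrable mc cell_sets by (intro Bochner_Integration.integrable_add integrable_mult_right integrable_mult_left integrable_real_indicator)
      show "(\<lambda>x. indicator cell x * g k x) \<in> borel_measurable lebesgue"
        using gm cell_sets by measurable
      have tri: "(norm (a - b))\<^sup>2 \<le> 2 * (norm a)\<^sup>2 + 2 * (norm b)\<^sup>2" for a b :: "'z::real_normed_vector"
      proof -
        have "(norm (a - b))\<^sup>2 \<le> (norm a + norm b)\<^sup>2"
          by (intro power_mono norm_triangle_ineq4) simp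
        also have "\<dots> \<le> 2 * (norm a)\<^sup>2 + 2 * (norm b)\<^sup>2"
          using sum_squares_bound[of "norm a" "norm b"] by (simp add: power2_sum)
        finally show ?thesis .
      qed
      show "AE x in lebesgue. norm (indicator cell x * g k x) \<le> norm (2 * sq_density x + indicator cell x * (2 * B))"
      proof (rule AE_I2)
        fix x
        show "norm (indicator cell x * g k x) \<le> norm (2 * sq_density x + indicator cell x * (2 * B))"
        proof (cases "x \<in> cell")
          case True
          have "g k x \<le> 2 * ((norm (u0 x))\<^sup>2 + (norm (G0 x))\<^sup>2) + 2 * m x"
            using tri[of "u0 x" "w k x"] tri[of "G0 x" "jacobian (w k) x"] by (simp add: g_def m_def)
          moreover have "0 \<le> g k x" by (simp add: g_def)
          moreover have "x \<in> box" using True cell_subset_box by blast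
          ultimately show ?thesis using True B'[OF True] by (simp add: sq_density_def)
        qed simp
      qed
    qed
  qed
  define t where "t k x = indicator box x * g k x" for k x
  have gnn: "0 \<le> g k x" for k x by (simp add: g_def)
  have ti: "integrable lebesgue (t k)" and tI: "integral\<^sup>L lebesgue (t k) = 4 * (\<integral>x. indicator cell x * g k x \<partial>lebesgue)" for k
    unfolding t_def[abs_def] using box_integral[OF gm gnn gp gi] by auto
  have tlim: "(\<lambda>k. integral\<^sup>L lebesgue (t k)) \<longlonglongrightarrow> 0"
  proof -
    have "(LINT x:cell|lebesgue. (norm (u x - w k x))\<^sup>2 + (norm (G x - jacobian (w k) x))\<^sup>2)
       = (\<integral>x. indicator cell x * g k x \<partial>lebesgue)" for k
      unfolding set_lebesgue_integral_def
    proof (rule Bochner_Integration.integral_cong[OF refl])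
      fix x
      show "indicator cell x *\<^sub>R ((norm (u x - w k x))\<^sup>2 + (norm (G x - jacobian (w k) x))\<^sup>2) = indicator cell x * g k x"
        using cell_subset_box by (cases "x \<in> cell") (auto simp: g_def u_on_U box_def)
    qed
    with wlim have "(\<lambda>k. 4 * (\<integral>x. indicator cell x * g k x \<partial>lebesgue)) \<longlonglongrightarrow> 4 * 0"
      by (intro tendsto_intros) simp
    then show ?thesis by (simp add: tI)
  qed
  from w(1,3) ti tlim show thesis unfolding t_def g_def by (rule that)
qed

text \<open>The function \<open>\<zeta> cnj(w)\<close> is an admissible test function: the cut-off function bounds its support
  horizontally and from above, and \<open>w\<close> keeps it away from the surface.\<close>

lemma navier_form_test_eq_0:
  fixes \<zeta> :: "real^3 \<Rightarrow> real"
  assumes z: "C1_on UNIV \<zeta>" "admissible_weight \<zeta>"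
    and w: "C1_on UNIV w" "\<exists>d>0. \<forall>x. x $ 3 \<le> f (horiz x) + d \<longrightarrow> w x = 0"
  shows "(\<integral>x. navier_form lam mu om (\<zeta> x) (\<chi> j. partial j \<zeta> x) (u0 x) (G0 x) (w x) (jacobian w x) \<partial>lebesgue) = 0"
proof -
  let ?Q = "\<lambda>x. navier_form lam mu om (\<zeta> x) (\<chi> j. partial j \<zeta> x) (u0 x) (G0 x) (w x) (jacobian w x)"
  define p where "p x = \<zeta> x *\<^sub>R cnjv (w x)" for x
  note cw = C1_on_bounded_linear[OF bounded_linear_cnjv w(1)]
  have p1: "C1_on UNIV p" unfolding p_def[abs_def] by (rule C1_on_scaleR(1)[OF z(1) cw(1)])
  have pj: "partial j p x = \<zeta> x *\<^sub>R cnjv (partial j w x) + partial j \<zeta> x *\<^sub>R cnjv (w x)" for j x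
    unfolding p_def[abs_def] by (simp add: C1_on_scaleR(2)[OF z(1) cw(1)] cw(2))
  obtain \<delta> where \<delta>: "\<delta> > 0" "\<And>x. x $ 3 \<le> f (horiz x) + \<delta> \<Longrightarrow> w x = 0" using w(2) by blast
  define Z where "Z = {x::real^3. - L1 \<le> x $ 1 \<and> x $ 1 \<le> L1 \<and> - L2 \<le> x $ 2 \<and> x $ 2 \<le> L2
      \<and> f (horiz x) + \<delta> \<le> x $ 3 \<and> x $ 3 \<le> h + 3}"
  have "closed Z" unfolding Z_def
    by (intro closed_Collect_conj closed_Collect_le continuous_intros fh_cont)
  moreover have "{x. p x \<noteq> 0} \<subseteq> Z"
  proof
    fix x assume "x \<in> {x. p x \<noteq> 0}"
    then have "\<zeta> x \<noteq> 0" "w x \<noteq> 0" by (auto simp: p_def cnjv_def vec_eq_iff)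
    moreover from this have "f (horiz x) + \<delta> \<le> x $ 3" using \<delta>(2)[of x] linear by blast
    ultimately show "x \<in> Z" using z(2) by (auto simp: Z_def admissible_weight_def)
  qed
  ultimately have cl: "closure {x. p x \<noteq> 0} \<subseteq> Z" by (rule closure_minimal[rotated])
  have ZB: "Z \<subseteq> box" using \<delta>(1) by (auto simp: Z_def box_def region_above_def)
  have "compact (closure {x. p x \<noteq> 0})"
    using bounded_subset[OF box_bounded order.trans[OF cl ZB]] by (simp add: compact_eq_bounded_closed)
  then have "test_function U p"
    using p1 cl ZB by (auto simp: test_function_def box_def)
  let ?F = "\<lambda>x. of_real mu * (\<Sum>i\<in>UNIV. \<Sum>j\<in>UNIV. G x $ i $ j * jacobian p x $ i $ j)
        + of_real (lam + mu) * (\<Sum>i\<in>UNIV. G x $ i $ i) * divergence p x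
        - of_real (om\<^sup>2) * (\<Sum>i\<in>UNIV. u x $ i * p x $ i)"
  from \<open>test_function U p\<close> have "(LINT x:U|lebesgue. ?F x) = 0"
    using navier unfolding weak_navier_def by blast
  moreover have "(LINT x:U|lebesgue. ?F x) = (\<integral>x. ?Q x \<partial>lebesgue)"
    unfolding set_lebesgue_integral_def
  proof (rule Bochner_Integration.integral_cong[OF refl])
    fix x
    have jp: "jacobian p x $ i $ j = of_real (\<zeta> x) * cnj (jacobian w x $ i $ j) + of_real ((partial j \<zeta> x)) * cnj (w x $ i)" for i j
      by (simp add: jacobian_def pj scaleR_nth del: vector_scaleR_component)
    have dp: "divergence p x = (\<Sum>j\<in>UNIV. of_real (\<zeta> x) * cnj (jacobian w x $ j $ j) + of_real ((partial j \<zeta> x)) * cnj (w x $ j))"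
      by (simp add: divergence_def jacobian_def pj scaleR_nth del: vector_scaleR_component)
    show "indicator U x *\<^sub>R ?F x = ?Q x"
    proof (cases "x \<in> U")
      case True
      have px: "p x $ i = of_real (\<zeta> x) * cnj (w x $ i)" for i
        by (simp only: p_def scaleR_nth cnjv_nth)
      from True show ?thesis unfolding navier_form_def jp dp px
        by (simp add: u_on_U)
    next
      case False
      then show ?thesis by (simp add: navier_form_def u0_def G0_def)
    qed
  qed
  ultimately show ?thesis by simp
  qed

text \<open>The limit of the preceding lemma along approximations of \<open>u\<close>.\<close>

lemma navier_form_solution:
  fixes \<zeta> :: "real^3 \<Rightarrow> real"
  assumes z: "C1_on UNIV \<zeta>" "admissible_weight \<zeta>" "\<And>j. admissible_weight (partial j \<zeta>)"
  shows "integrable lebesgue (\<lambda>x. navier_form lam mu om (\<zeta> x) (\<chi> j. partial j \<zeta> x) (u0 x) (G0 x) (u0 x) (G0 x))"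
    and "(\<integral>x. navier_form lam mu om (\<zeta> x) (\<chi> j. partial j \<zeta> x) (u0 x) (G0 x) (u0 x) (G0 x) \<partial>lebesgue) = 0"
proof -
  define d where "d x = (\<chi> j. partial j \<zeta> x)" for x
  have "\<exists>K\<ge>0. \<forall>x\<in>box. \<bar>partial j \<zeta> x\<bar> \<le> K" for j using weight_bounded[OF z(3)[of j]] by metis
  then obtain Kd where Kd: "\<And>j. 0 \<le> Kd j" "\<And>j x. x \<in> box \<Longrightarrow> \<bar>partial j \<zeta> x\<bar> \<le> Kd j" by metis
  obtain K0 where K0: "0 \<le> K0" "\<And>x. x \<in> box \<Longrightarrow> \<bar>\<zeta> x\<bar> \<le> K0" by (rule weight_bounded[OF z(2)]) blast
  define K where "K = K0 + (\<Sum>j\<in>UNIV. Kd j)"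
  have K: "0 \<le> K" "\<bar>\<zeta> x\<bar> \<le> K" "\<bar>d x $ j\<bar> \<le> K" if "x \<in> box" for x j
  proof -
    have "Kd j \<le> (\<Sum>j\<in>UNIV. Kd j)" for j by (rule member_le_sum) (auto simp: Kd)
    moreover have "0 \<le> (\<Sum>j\<in>UNIV. Kd j)" by (simp add: Kd sum_nonneg)
    ultimately show "0 \<le> K" "\<bar>\<zeta> x\<bar> \<le> K" "\<bar>d x $ j\<bar> \<le> K"
      using K0(1) K0(2)[OF that] Kd(2)[OF that, of j] unfolding K_def d_def
      by (auto intro: order.trans add_increasing add_increasing2)
  qed
  have K': "0 \<le> K" using K0(1) Kd(1) by (simp add: K_def sum_nonneg)
  define C where "C = (18 * \<bar>mu\<bar> + 18 * \<bar>lam + mu\<bar> + 3 * om\<^sup>2) * K"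
  have C: "0 \<le> C" using K' by (simp add: C_def)
  obtain w where w: "\<And>k. C1_on UNIV (w k)" "\<And>k. \<exists>d>0. \<forall>x. x $ 3 \<le> f (horiz x) + d \<longrightarrow> w k x = 0"
    and ti0: "\<And>k. integrable lebesgue (\<lambda>x. indicator box x * ((norm (u0 x - w k x))\<^sup>2 + (norm (G0 x - jacobian (w k) x))\<^sup>2))"
    and tlim0: "(\<lambda>k. \<integral>x. indicator box x * ((norm (u0 x - w k x))\<^sup>2 + (norm (G0 x - jacobian (w k) x))\<^sup>2) \<partial>lebesgue) \<longlonglongrightarrow> 0"
    by (rule surface_approximation) blast
  define t where "t k x = indicator box x * ((norm (u0 x - w k x))\<^sup>2 + (norm (G0 x - jacobian (w k) x))\<^sup>2)" for k x
  have ti: "integrable lebesgue (t k)" for k unfolding t_def by (rule ti0)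
  have tlim: "(\<lambda>k. integral\<^sup>L lebesgue (t k)) \<longlonglongrightarrow> 0" unfolding t_def by (rule tlim0)
  have wm [measurable]: "w k \<in> borel_measurable lebesgue" "jacobian (w k) \<in> borel_measurable lebesgue" for k
    by (intro borel_measurable_lebesgue_continuous C1_on_cont w(1) continuous_jacobian)+
  define Q where "Q k x = navier_form lam mu om (\<zeta> x) (d x) (u0 x) (G0 x) (w k x) (jacobian (w k) x)" for k x
  define Q0 where "Q0 x = navier_form lam mu om (\<zeta> x) (d x) (u0 x) (G0 x) (u0 x) (G0 x)" for x
  have zm [measurable]: "\<zeta> \<in> borel_measurable lebesgue" "(\<lambda>x. d x $ j) \<in> borel_measurable lebesgue" for j
    using z by (auto simp: admissible_weight_def d_def intro: borel_measurable_lebesgue_continuous)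
  have nform_meas: "(\<lambda>x. navier_form lam mu om (\<zeta> x) (d x) (u0 x) (G0 x) (v x) (V x)) \<in> borel_measurable lebesgue"
    if "v \<in> borel_measurable lebesgue" "V \<in> borel_measurable lebesgue" for v V
  proof -
    have [measurable]: "(\<lambda>x. cnj (v x $ i)) \<in> borel_measurable lebesgue" "(\<lambda>x. cnj (V x $ i $ j)) \<in> borel_measurable lebesgue" for i j
      by (intro measurable_cnj measurable_nth that)+
    show ?thesis unfolding navier_form_def by measurable
  qed
  have Qm: "Q k \<in> borel_measurable lebesgue" "Q0 \<in> borel_measurable lebesgue" for k
    unfolding Q_def[abs_def] Q0_def[abs_def] by (rule nform_meas, measurable)+
  have out: "navier_form lam mu om (\<zeta> x) (d x) (u0 x) (G0 x) v V = 0" if "x \<notin> box" for x v V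
  proof -
    have "u0 x = 0 \<and> G0 x = 0 \<or> (\<zeta> x = 0 \<and> (\<forall>j. d x $ j = 0))"
      using weight_zero[OF z(2) that] weight_zero[OF z(3) that] by (auto simp: d_def)
    then show ?thesis by (auto simp: navier_form_def)
  qed
  have b0: "norm (Q0 x) \<le> C * sq_density x" for x
  proof (cases "x \<in> box")
    case True
    then show ?thesis
      using navier_form_bound[OF K(2)[OF True] K(3)[OF True], of lam mu om "u0 x" "G0 x" "u0 x" "G0 x"]
      by (simp add: Q0_def C_def sq_density_def)
  qed (simp add: Q0_def out sq_density_def)
  have b: "norm (Q0 x - Q k x) \<le> C * (sqrt (sq_density x) * sqrt (t k x))" for k x
  proof (cases "x \<in> box")
    case True
    then show ?thesis
      using navier_form_bound[OF K(2)[OF True] K(3)[OF True], of lam mu om "u0 x" "G0 x" "u0 x - w k x" "G0 x - jacobian (w k) x"]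
      by (simp add: Q0_def Q_def C_def sq_density_def t_def navier_form_diff)
  qed (simp add: Q0_def Q_def out sq_density_def)
  have snn: "0 \<le> sq_density x" "0 \<le> t k x" for k x by (auto simp: sq_density_def t_def)
  note concl = integral_tendsto_of_product_bound[OF Qm(2) Qm(1) sq_density_integrable snn(1) ti snn(2) tlim b0 b C]
  have "integral\<^sup>L lebesgue (Q k) = 0" for k
    using navier_form_test_eq_0[OF z(1,2) w] by (simp add: Q_def[abs_def] d_def)
  with concl(2) have "integral\<^sup>L lebesgue Q0 = 0" by (simp add: LIMSEQ_const_iff)
  with concl(1) show "integrable lebesgue (\<lambda>x. navier_form lam mu om (\<zeta> x) (\<chi> j. partial j \<zeta> x) (u0 x) (G0 x) (u0 x) (G0 x))"
    "(\<integral>x. navier_form lam mu om (\<zeta> x) (\<chi> j. partial j \<zeta> x) (u0 x) (G0 x) (u0 x) (G0 x) \<partial>lebesgue) = 0"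
    by (simp_all add: Q0_def[abs_def] d_def)
qed

text \<open>Take the imaginary part for \<open>\<zeta>(x) = \<eta>1(x\<^sub>1) \<eta>2(x\<^sub>2) \<tau>(x\<^sub>3)\<close>. The terms with \<open>\<partial>\<^sub>1\<zeta>\<close> and \<open>\<partial>\<^sub>2\<zeta>\<close> vanish since the
  flux is biperiodic.\<close>

lemma Im_flux_eq_0:
  assumes "cutoffs L1 L2 h \<eta>1 r1 \<eta>2 r2 \<tau> \<sigma> \<sigma>'"
  shows "Im (\<integral>x. of_real (\<eta>1 (x $ 1) * \<eta>2 (x $ 2) * \<sigma> (x $ 3)) * flux x 3 \<partial>lebesgue) = 0"
proof -
  interpret C: cutoffs L1 L2 h \<eta>1 r1 \<eta>2 r2 \<tau> \<sigma> \<sigma>' by fact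
  note e1 = C.e1 and e2 = C.e2 and c = C.c(1) C.eta_cont(3) C.c(4,5)
  define \<zeta> where "\<zeta> x = \<eta>1 (x $ 1) * \<eta>2 (x $ 2) * \<tau> (x $ 3)" for x :: "real^3"
  have cs: "continuous_on UNIV (\<lambda>t. r1 t - r1 (t + L1))" "continuous_on UNIV (\<lambda>t. r2 t - r2 (t + L2))"
     "continuous_on UNIV (\<lambda>t. - \<sigma> t)"
    by (intro continuous_intros continuous_on_compose2[OF e1(2)] continuous_on_compose2[OF e2(2)] c(2); simp)+
  have "continuous_on UNIV \<tau>" using c(1) by (meson DERIV_isCont continuous_at_imp_continuous_on)
  with C.eta_cont have ec: "continuous_on UNIV \<eta>1" "continuous_on UNIV \<eta>2" "continuous_on UNIV \<tau>" by auto
  note Z = C1_on_cutoff[OF e1(1) e2(1) c(1) cs, folded \<zeta>_def[abs_def]]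
  have wok: "admissible_weight (\<lambda>x. a (x $ 1) * b (x $ 2) * g (x $ 3))"
    if "continuous_on UNIV a" "continuous_on UNIV b" "continuous_on UNIV g"
      "\<And>t. t \<notin> {-L1..L1} \<Longrightarrow> a t = 0" "\<And>t. t \<notin> {-L2..L2} \<Longrightarrow> b t = 0" "\<And>t. h + 3 < t \<Longrightarrow> g t = 0"
    for a b g
  proof -
    have "continuous_on UNIV (\<lambda>x::real^3. q (x $ j))" if "continuous_on UNIV q" for q :: "real \<Rightarrow> real" and j
      by (intro continuous_on_compose2[OF that] continuous_intros) auto
    then have "continuous_on UNIV (\<lambda>x::real^3. a (x $ 1) * b (x $ 2) * g (x $ 3))"
      using that by (intro continuous_intros) auto
    moreover have "- L1 \<le> x $ 1 \<and> x $ 1 \<le> L1 \<and> - L2 \<le> x $ 2 \<and> x $ 2 \<le> L2 \<and> x $ 3 \<le> h + 3"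
      if "a (x $ 1) * b (x $ 2) * g (x $ 3) \<noteq> 0" for x :: "real^3"
      using that \<open>\<And>t. t \<notin> {-L1..L1} \<Longrightarrow> a t = 0\<close>[of "x $ 1"] \<open>\<And>t. t \<notin> {-L2..L2} \<Longrightarrow> b t = 0\<close>[of "x $ 2"]
        \<open>\<And>t. h + 3 < t \<Longrightarrow> g t = 0\<close>[of "x $ 3"] by (cases "h + 3 < x $ 3") (auto simp: not_less)
    ultimately show ?thesis by (simp add: admissible_weight_def)
  qed
  have z1: "r1 t - r1 (t + L1) = 0" if "t \<notin> {-L1..L1}" for t
    using that e1(3)[of t] e1(3)[of "t + L1"] L by auto
  have z2: "r2 t - r2 (t + L2) = 0" if "t \<notin> {-L2..L2}" for t
    using that e2(3)[of t] e2(3)[of "t + L2"] L by auto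
  have w0: "admissible_weight \<zeta>" unfolding \<zeta>_def[abs_def] by (rule wok) (use ec e1(4) e2(4) c(4) in auto)
  have P1: "partial 1 \<zeta> = (\<lambda>x. (\<lambda>t. r1 t - r1 (t + L1)) (x $ 1) * \<eta>2 (x $ 2) * \<tau> (x $ 3))"
    and P2: "partial 2 \<zeta> = (\<lambda>x. \<eta>1 (x $ 1) * (\<lambda>t. r2 t - r2 (t + L2)) (x $ 2) * \<tau> (x $ 3))"
    and P3: "partial 3 \<zeta> = (\<lambda>x. \<eta>1 (x $ 1) * \<eta>2 (x $ 2) * (\<lambda>t. - \<sigma> t) (x $ 3))"
    using Z(2-4) by auto
  have w1: "admissible_weight (partial 1 \<zeta>)" unfolding P1 by (rule wok) (use ec e2(4) c(4) z1 cs in auto)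
  have w2: "admissible_weight (partial 2 \<zeta>)" unfolding P2 by (rule wok) (use ec e1(4) c(4) z2 cs in auto)
  have w3: "admissible_weight (partial 3 \<zeta>)" unfolding P3 by (rule wok) (use ec e1(4) e2(4) c(3) cs in auto)
  have wj: "admissible_weight (partial j \<zeta>)" for j using w1 w2 w3 exhaust_3[of j] by auto
  define I where "I j = (\<integral>x. of_real (partial j \<zeta> x) * flux x j \<partial>lebesgue)" for j
  have ii: "integrable lebesgue (\<lambda>x. of_real (partial j \<zeta> x) * flux x j)" for j
    by (rule integrable_weight_flux[OF wj])
  have "Im (\<integral>x. navier_form lam mu om (\<zeta> x) (\<chi> j. partial j \<zeta> x) (u0 x) (G0 x) (u0 x) (G0 x) \<partial>lebesgue)
      = (\<integral>x. (\<Sum>j\<in>UNIV. Im (of_real (partial j \<zeta> x) * flux x j)) \<partial>lebesgue)"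
    using navier_form_solution(1)[OF Z(1) w0 wj] by (simp add: Im_navier_form_self flip: integral_Im)
  also have "\<dots> = (\<Sum>j\<in>UNIV. Im (I j))"
    unfolding I_def by (subst Bochner_Integration.integral_sum, rule integrable_Im[OF ii]) (simp only: integral_Im[OF ii])
  finally have sum0: "Im (I 1) + Im (I 2) + Im (I 3) = 0"
    using navier_form_solution(2)[OF Z(1) w0 wj] by (simp add: sum_3)
  have "\<And>t. h + 3 < t \<Longrightarrow> \<tau> t = 0" using c(4) by simp
  note horizontal = C.integral_horizontal_derivative_weight[OF flux_meas flux_periodic ec(3)
      integrable_weight_flux[OF wok[OF _ _ ec(3) _ _ this]]]
  have I12: "I 1 = 0" "I 2 = 0" unfolding I_def P1 P2 by (rule horizontal; assumption)+
  have "I 3 = - (\<integral>x. of_real (\<eta>1 (x $ 1) * \<eta>2 (x $ 2) * \<sigma> (x $ 3)) * flux x 3 \<partial>lebesgue)"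
    unfolding I_def P3 by simp
  with sum0 I12 show ?thesis by simp
qed

end

section \<open>Replacing the weak Jacobian by the classical one\<close>

lemma open_half_space: "open (half_space h)"
  unfolding half_space_def by (intro open_Collect_less continuous_intros)

lemma C1_on_cong_open:
  assumes S: "open S" and eq: "\<And>x. x \<in> S \<Longrightarrow> F x = H x" and H: "C1_on S H"
  shows "C1_on S F"
proof -
  have "partial j F x = partial j H x" if "x \<in> S" for j x
    by (rule partial_cong_open[OF S that eq])
  then have "continuous_on S (partial j F)" for j
    using H by (simp add: C1_on_def cong: continuous_on_cong)
  moreover have "F differentiable (at x)" if "x \<in> S" for x
    by (rule differentiable_cong_open[OF S that eq]) (use H that in \<open>auto simp: C1_on_def\<close>)
  ultimately show ?thesis by (simp add: C1_on_def)
qed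

lemma C1_on_Un:
  assumes "open S" "open T" "C1_on S F" "C1_on T F"
  shows "C1_on (S \<union> T) F"
  using assms by (auto simp: C1_on_def intro: continuous_on_open_Un)

text \<open>Since the weights vanish for \<open>x $ 3 < h + 1\<close>, extension by zero across the plane \<open>x $ 3 = h\<close> costs no
  smoothness: the half space and \<open>{x. x $ 3 < h + 1}\<close> are overlapping open sets.\<close>

definition weighted :: "real \<Rightarrow> (real^3 \<Rightarrow> real) \<Rightarrow> (real^3 \<Rightarrow> complex) \<Rightarrow> real^3 \<Rightarrow> complex" where
  "weighted h \<rho> F x = (if x \<in> half_space h then \<rho> x *\<^sub>R F x else 0)"

lemma half_space_cover: "half_space h \<union> {x. x $ 3 < h + 1} = UNIV" "open {x::real^3. x $ 3 < h + 1}"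
  by (auto simp: half_space_def intro!: open_Collect_less continuous_intros)

lemma weighted_continuous:
  assumes r: "continuous_on UNIV \<rho>" "\<And>x. x $ 3 < h + 1 \<Longrightarrow> \<rho> x = 0" and F: "continuous_on (half_space h) F"
  shows "continuous_on UNIV (weighted h \<rho> F)"
proof -
  have "continuous_on (half_space h) (\<lambda>x. \<rho> x *\<^sub>R F x)"
    by (intro continuous_intros F continuous_on_subset[OF r(1)]) auto
  then have "continuous_on (half_space h) (weighted h \<rho> F)"
    by (simp add: weighted_def cong: continuous_on_cong)
  moreover have "continuous_on {x. x $ 3 < h + 1} (\<lambda>_::real^3. 0 :: complex)" by simp
  then have "continuous_on {x. x $ 3 < h + 1} (weighted h \<rho> F)"
    by (rule continuous_on_eq) (auto simp: weighted_def r(2))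
  ultimately show ?thesis
    using continuous_on_open_Un[OF open_half_space half_space_cover(2)] by (metis half_space_cover(1))
qed

lemma weighted_C1:
  assumes r: "C1_on UNIV \<rho>" "\<And>x. x $ 3 < h + 1 \<Longrightarrow> \<rho> x = 0" and F: "C1_on (half_space h) F"
  shows "C1_on UNIV (weighted h \<rho> F)"
    and "partial j (weighted h \<rho> F) x = weighted h \<rho> (partial j F) x + weighted h (partial j \<rho>) F x"
proof -
  have r': "C1_on (half_space h) \<rho>" using r(1) by (auto simp: C1_on_def intro: continuous_on_subset)
  have 1: "C1_on (half_space h) (weighted h \<rho> F)"
    by (rule C1_on_cong_open[OF open_half_space _ C1_on_scaleR(1)[OF r' F]]) (simp add: weighted_def)
  have z: "weighted h \<rho> F x = 0" if "x \<in> {x. x $ 3 < h + 1}" for x using that by (simp add: weighted_def r(2))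
  have "C1_on {x::real^3. x $ 3 < h + 1} (\<lambda>_. 0 :: complex)"
    by (rule C1_onI[where D = "\<lambda>_ _. 0"]) auto
  from C1_on_cong_open[OF half_space_cover(2) z this]
  have "C1_on {x. x $ 3 < h + 1} (weighted h \<rho> F)" .
  from C1_on_Un[OF open_half_space half_space_cover(2) 1 this] show "C1_on UNIV (weighted h \<rho> F)"
    by (simp add: half_space_cover)
  show "partial j (weighted h \<rho> F) x = weighted h \<rho> (partial j F) x + weighted h (partial j \<rho>) F x"
  proof (cases "x \<in> half_space h")
    case True
    have "partial j (weighted h \<rho> F) x = partial j (\<lambda>x. \<rho> x *\<^sub>R F x) x"
      by (rule partial_cong_open[OF open_half_space True]) (simp add: weighted_def)
    then show ?thesis using C1_on_scaleR(2)[OF r' F True, of j] True by (simp add: weighted_def)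
  next
    case False
    then have "x \<in> {x. x $ 3 < h + 1}" by (auto simp: half_space_def)
    from partial_cong_open[OF half_space_cover(2) this, of "weighted h \<rho> F" "\<lambda>_. 0", OF z]
    show ?thesis using False by (simp add: weighted_def partial_def)
  qed
qed

context rigid_scatterer begin

lemma half_space_subset_U: "half_space h \<subseteq> U"
  using height by (auto simp: half_space_def region_above_def intro: less_trans)

text \<open>Above \<open>h\<close> the solution is continuously differentiable, so \<open>\<rho> cnj(u $ l)\<close> is a test function for the weak Jacobian. Integrating
  \<open>\<partial>\<^sub>j(\<rho> u\<^sub>i cnj(u\<^sub>l))\<close> over the space gives the same identity with the classical Jacobian. In this way the
  flux can be rewritten without showing that the two Jacobians agree almost everywhere.\<close>

lemma weak_jacobian_eq_classical:
  assumes r: "C1_on UNIV \<rho>" "admissible_weight \<rho>" "\<And>x. x $ 3 < h + 1 \<Longrightarrow> \<rho> x = 0"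
    and uC1: "C1_on (half_space h) u"
  shows "(\<integral>x. of_real (\<rho> x) * (G0 x $ i $ j * cnj (u0 x $ l)) \<partial>lebesgue)
       = (\<integral>x. weighted h \<rho> (\<lambda>x. jacobian u x $ i $ j * cnj (u x $ l)) x \<partial>lebesgue)"
    and "integrable lebesgue (weighted h \<rho> (\<lambda>x. jacobian u x $ i $ j * cnj (u x $ l)))"
proof -
  define Z where "Z = {x::real^3. - L1 \<le> x $ 1 \<and> x $ 1 \<le> L1 \<and> - L2 \<le> x $ 2 \<and> x $ 2 \<le> L2
        \<and> h + 1 \<le> x $ 3 \<and> x $ 3 \<le> h + 3}"
  have Zc: "closed Z" unfolding Z_def
    by (intro closed_Collect_conj closed_Collect_le continuous_intros)
  have ZB: "Z \<subseteq> box" using height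
    by (force simp: Z_def box_def region_above_def intro: less_le_trans less_imp_le)
  have Zb: "bounded Z" using bounded_subset[OF box_bounded ZB] .
  have rZ: "\<rho> x = 0" if "x \<notin> Z" for x
    using that r(2) r(3)[of x] by (force simp: Z_def admissible_weight_def)
  have wZ: "weighted h \<rho> F x = 0" if "x \<notin> Z" for x F using rZ[OF that] by (simp add: weighted_def)
  have rc: "continuous_on UNIV \<rho>" using C1_on_cont[OF r(1)] .
  have blc: "bounded_linear (\<lambda>v::complex^3. cnj (v $ l))" "bounded_linear (\<lambda>v::complex^3. v $ i)"
    using bounded_linear_compose[OF bounded_linear_cnj bounded_linear_vec_nth] bounded_linear_vec_nth by auto
  note ui = C1_on_bounded_linear[OF blc(2) uC1]
  note ul = C1_on_bounded_linear[OF blc(1) uC1]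
  define B where "B = weighted h \<rho> (\<lambda>x. jacobian u x $ i $ j * cnj (u x $ l))"
  have "continuous_on (half_space h) (\<lambda>x. partial j u x $ i * cnj (u x $ l))"
    using uC1 C1_on_cont[OF uC1] by (auto simp: C1_on_def intro!: continuous_intros)
  then have Bc: "continuous_on UNIV B" unfolding B_def jacobian_def
    by (intro weighted_continuous rc r(3)) simp_all
  show Bi: "integrable lebesgue B"
    by (rule integrable_continuous_bounded_support[OF Bc Zb]) (simp add: B_def wZ)
  define p where "p = weighted h \<rho> (\<lambda>x. cnj (u x $ l))"
  define P where "P = weighted h \<rho> (\<lambda>x. u x $ i * cnj (u x $ l))"
  have pC: "C1_on UNIV p" "partial j p x = weighted h \<rho> (partial j (\<lambda>x. cnj (u x $ l))) x
      + weighted h (partial j \<rho>) (\<lambda>x. cnj (u x $ l)) x" for x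
    unfolding p_def by (intro weighted_C1 r ul(1); assumption)+
  have PC: "C1_on UNIV P" "partial j P x = weighted h \<rho> (partial j (\<lambda>x. u x $ i * cnj (u x $ l))) x
      + weighted h (partial j \<rho>) (\<lambda>x. u x $ i * cnj (u x $ l)) x" for x
    unfolding P_def by (intro weighted_C1 r C1_on_mult(1) ui(1) ul(1); assumption)+
  have PZ: "P x = 0" if "x \<notin> Z" for x unfolding P_def by (rule wZ[OF that])
  have PI: "integrable lebesgue (partial j P)" and P0: "integral\<^sup>L lebesgue (partial j P) = 0"
  proof -
    show "integral\<^sup>L lebesgue (partial j P) = 0"
      by (rule integral_partial_eq_0[OF PC(1) Zb PZ])
    have "partial j P x = 0" if "x \<notin> Z" for x
    proof -
      have "partial j P x = partial j (\<lambda>_. 0) x"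
        by (rule partial_cong_open[of "- Z"]) (use Zc that PZ in auto)
      then show ?thesis by (simp add: partial_def)
    qed
    then show "integrable lebesgue (partial j P)"
      using integrable_continuous_bounded_support[of "partial j P" Z] PC(1) Zb by (auto simp: C1_on_def)
  qed
  have Peq: "partial j P x = B x + indicator U x *\<^sub>R (u x $ i * partial j p x)" for x
  proof (cases "x \<in> half_space h")
    case True
    then have "x \<in> U" using half_space_subset_U by blast
    with True show ?thesis unfolding PC(2) pC(2) B_def
      by (simp add: weighted_def C1_on_mult(2)[OF ui(1) ul(1) True] ui(2)[OF True] ul(2)[OF True] jacobian_def
          algebra_simps)
  next
    case False
    then show ?thesis unfolding PC(2) pC(2) B_def by (simp add: weighted_def)
  qed
  have "test_function U p"
  proof -
    have "closure {x. p x \<noteq> 0} \<subseteq> Z"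
      by (rule closure_minimal[OF _ Zc]) (use wZ in \<open>auto simp: p_def\<close>)
    then show ?thesis using pC(1) ZB bounded_subset[OF Zb]
      by (auto simp: test_function_def compact_eq_bounded_closed box_def)
  qed
  then have W: "(LINT x:U|lebesgue. u x $ i * partial j p x) = - (LINT x:U|lebesgue. G x $ i $ j * p x)"
    using wjac unfolding weak_jacobian_def by blast
  have "(\<integral>x. of_real (\<rho> x) * (G0 x $ i $ j * cnj (u0 x $ l)) \<partial>lebesgue) = (LINT x:U|lebesgue. G x $ i $ j * p x)"
    unfolding set_lebesgue_integral_def
  proof (rule Bochner_Integration.integral_cong[OF refl])
    fix x
    show "of_real (\<rho> x) * (G0 x $ i $ j * cnj (u0 x $ l)) = indicator U x *\<^sub>R (G x $ i $ j * p x)"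
    proof (cases "x \<in> half_space h")
      case True
      then have "x \<in> U" using half_space_subset_U by blast
      with True show ?thesis by (simp add: p_def weighted_def u_on_U scaleR_conv_of_real)
    next
      case False
      then have "\<rho> x = 0" by (intro r(3)) (simp add: half_space_def)
      with False show ?thesis by (simp add: p_def weighted_def)
    qed
  qed
  also have "\<dots> = - (\<integral>x. partial j P x - B x \<partial>lebesgue)"
    using W by (simp add: set_lebesgue_integral_def Peq)
  also have "\<dots> = integral\<^sup>L lebesgue B" using PI Bi P0 by simp
  finally show "(\<integral>x. of_real (\<rho> x) * (G0 x $ i $ j * cnj (u0 x $ l)) \<partial>lebesgue) = integral\<^sup>L lebesgue B" .
qed

lemma integral_flux_classical:
  assumes r: "C1_on UNIV \<rho>" "admissible_weight \<rho>" "\<And>x. x $ 3 < h + 1 \<Longrightarrow> \<rho> x = 0"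
    and uC1: "C1_on (half_space h) u"
  shows "(\<integral>x. of_real (\<rho> x) * flux x j \<partial>lebesgue)
       = (\<integral>x. of_real (\<rho> x) * energy_flux lam mu (u x) (jacobian u x) j \<partial>lebesgue)"
proof -
  have wt: "weighted h \<rho> F x = of_real (\<rho> x) * F x" for F x
    using r(3)[of x] by (auto simp: weighted_def half_space_def scaleR_conv_of_real)
  have m: "(\<lambda>x. G0 x $ i $ k * cnj (u0 x $ l)) \<in> borel_measurable lebesgue" for i k l
  proof -
    have [measurable]: "(\<lambda>x. cnj (u0 x $ l)) \<in> borel_measurable lebesgue" for l
      by (rule measurable_cnj) simp
    show ?thesis by measurable
  qed
  have i1: "integrable lebesgue (\<lambda>x. of_real (\<rho> x) * (G0 x $ i $ k * cnj (u0 x $ l)))" for i k l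
  proof (rule integrable_weight_bilinear[OF r(2) m, where C = 1])
    fix x
    have "norm (G0 x $ i $ k * cnj (u0 x $ l)) \<le> norm (G0 x) * norm (u0 x)"
      unfolding norm_mult complex_mod_cnj
      by (intro mult_mono norm_nth_nth_le Finite_Cartesian_Product.norm_nth_le) auto
    also have "\<dots> \<le> (norm (u0 x))\<^sup>2 + (norm (G0 x))\<^sup>2"
      using sum_squares_bound[of "norm (G0 x)" "norm (u0 x)"]
        mult_nonneg_nonneg[OF norm_ge_zero[of "G0 x"] norm_ge_zero[of "u0 x"]] by linarith
    finally show "norm (G0 x $ i $ k * cnj (u0 x $ l)) \<le> 1 * ((norm (u0 x))\<^sup>2 + (norm (G0 x))\<^sup>2)" by simp
  qed simp
  note eq = weak_jacobian_eq_classical(1)[OF r uC1, unfolded wt]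
  note i2 = weak_jacobian_eq_classical(2)[OF r uC1, unfolded wt[abs_def]]
  have split: "of_real (\<rho> x) * energy_flux lam mu v H j
     = of_real mu * (\<Sum>i\<in>UNIV. of_real (\<rho> x) * (H $ i $ j * cnj (v $ i)))
       + of_real (lam + mu) * (\<Sum>i\<in>UNIV. of_real (\<rho> x) * (H $ i $ i * cnj (v $ j)))" for x v H
    unfolding energy_flux_def by (simp add: sum_distrib_left sum_distrib_right mult_ac distrib_left)
  show ?thesis unfolding split
    using i1 i2 by (simp add: Bochner_Integration.integral_sum eq)
qed

end

section \<open>Plane waves and their superpositions\<close>

definition plane_wave :: "complex^3 \<Rightarrow> real^3 \<Rightarrow> complex" where
  "plane_wave K x = exp (\<i> * (\<Sum>j\<in>UNIV. K $ j * of_real (x $ j)))"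

lemma plane_wave_has_derivative:
  "(plane_wave K has_derivative (\<lambda>v. \<Sum>j\<in>UNIV. of_real (v $ j) * (\<i> * K $ j * plane_wave K x))) (at x)"
proof -
  have bl: "bounded_linear (\<lambda>v::real^3. \<i> * (\<Sum>j\<in>UNIV. K $ j * of_real (v $ j)))"
    by (intro bounded_linear_intros bounded_linear_vec_nth bounded_linear_compose[OF bounded_linear_of_real bounded_linear_vec_nth])
  have "((\<lambda>x. exp (\<i> * (\<Sum>j\<in>UNIV. K $ j * of_real (x $ j)))) has_derivative
      (\<lambda>v. exp (\<i> * (\<Sum>j\<in>UNIV. K $ j * of_real (x $ j))) * (\<i> * (\<Sum>j\<in>UNIV. K $ j * of_real (v $ j))))) (at x)"
    using has_derivative_compose[OF bounded_linear_imp_has_derivative[OF bl],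
        of exp "(*) (exp (\<i> * (\<Sum>j\<in>UNIV. K $ j * of_real (x $ j))))" x UNIV]
    using DERIV_exp[of "\<i> * (\<Sum>j\<in>UNIV. K $ j * of_real (x $ j))"] by (simp add: has_field_derivative_def)
  moreover have "exp (\<i> * (\<Sum>j\<in>UNIV. K $ j * of_real (x $ j))) * (\<i> * (\<Sum>j\<in>UNIV. K $ j * of_real (v $ j)))
     = (\<Sum>j\<in>UNIV. of_real (v $ j) * (\<i> * K $ j * plane_wave K x))" for v
    unfolding plane_wave_def sum_3 by (simp add: algebra_simps)
  ultimately show ?thesis by (simp add: plane_wave_def[abs_def])
qed

lemma sum_axis_mult: "(\<Sum>k\<in>UNIV. of_real (axis j (1::real) $ k) * F k) = (F j :: complex)" for j :: 3
  using exhaust_3[of j] by (auto simp: sum_3 axis_def)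

lemma plane_wave_cont: "continuous_on S (plane_wave K)"
  by (meson continuous_at_imp_continuous_on has_derivative_continuous plane_wave_has_derivative)

lemma plane_wave_C1: "C1_on S (plane_wave K)"
  by (rule C1_onI[OF plane_wave_has_derivative]) (auto simp: sum_axis_mult intro!: continuous_intros plane_wave_cont)

lemma partial_plane_wave: "partial j (plane_wave K) x = \<i> * K $ j * plane_wave K x"
  using partial_eqI[OF plane_wave_has_derivative] by (simp add: sum_axis_mult)

text \<open>The bound by the imaginary part of the vertical component expresses that wave vectors can only be
  large if the waves decay fast.\<close>

definition outgoing :: "('n \<Rightarrow> complex^3) \<Rightarrow> bool" where
  "outgoing K \<longleftrightarrow> (\<forall>n. Im (K n $ 1) = 0 \<and> Im (K n $ 2) = 0 \<and> 0 \<le> Im (K n $ 3))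
     \<and> (\<exists>C\<ge>0. \<forall>n j. norm (K n $ j) \<le> C * (1 + Im (K n $ 3)))"

text \<open>Absolute convergence of the series with coefficients \<open>a\<close> at all points above the plane \<open>x $ 3 = h\<close>.\<close>

definition decays :: "real \<Rightarrow> ('n \<Rightarrow> complex^3) \<Rightarrow> ('n \<Rightarrow> complex) \<Rightarrow> bool" where
  "decays h K a \<longleftrightarrow> (\<forall>z>h. (\<lambda>n. norm (a n) * exp (- (Im (K n $ 3) * z))) summable_on UNIV)"

definition wave_series :: "('n \<Rightarrow> complex^3) \<Rightarrow> ('n \<Rightarrow> complex) \<Rightarrow> real^3 \<Rightarrow> complex" where
  "wave_series K a x = (\<Sum>\<^sub>\<infinity>n. a n * plane_wave (K n) x)"

lemma norm_plane_wave:
  "Im (K $ 1) = 0 \<Longrightarrow> Im (K $ 2) = 0 \<Longrightarrow> norm (plane_wave K x) = exp (- (Im (K $ 3) * x $ 3))"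
  by (simp add: plane_wave_def sum_3)

text \<open>A factor that grows linearly in the decay rate \<open>g\<close> is absorbed by a small loss of height:
  \<open>g * exp (- g * (z - y)) \<le> 1 / (z - y)\<close>.\<close>

lemma decays_gradient:
  assumes K: "outgoing K" and a: "decays h K a"
  shows "decays h K (\<lambda>n. \<i> * K n $ j * a n)"
  unfolding decays_def
proof (intro allI impI)
  fix z assume z: "h < z"
  define y where "y = (z + h) / 2"
  have y: "h < y" "y < z" using z by (auto simp: y_def)
  obtain C where C: "0 \<le> C" "\<And>n j. norm (K n $ j) \<le> C * (1 + Im (K n $ 3))" using K by (auto simp: outgoing_def)
  define D where "D = C * (1 + 1 / (z - y))"
  have sm: "(\<lambda>n. D * (norm (a n) * exp (- (Im (K n $ 3) * y)))) summable_on UNIV"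
    using a y(1) by (intro summable_on_cmult_right) (auto simp: decays_def)
  show "(\<lambda>n. norm (\<i> * K n $ j * a n) * exp (- (Im (K n $ 3) * z))) summable_on UNIV"
  proof (rule summable_on_comparison_test[OF sm])
    fix n :: 'a
    define g where "g = Im (K n $ 3)"
    have g: "0 \<le> g" using K by (simp add: outgoing_def g_def)
    have e: "g * (z - y) \<le> exp (g * (z - y))" using exp_ge_add_one_self[of "g * (z - y)"] by linarith
    then have "g \<le> exp (g * (z - y)) / (z - y)" using y by (simp add: field_simps)
    moreover have "1 \<le> exp (g * (z - y))" unfolding one_le_exp_iff using g y by simp
    ultimately have "1 + g \<le> exp (g * (z - y)) * (1 + 1 / (z - y))"
      unfolding distrib_left times_divide_eq_right mult_1_right by linarith
    then have "(1 + g) * exp (- (g * (z - y))) \<le> exp (g * (z - y)) * (1 + 1 / (z - y)) * exp (- (g * (z - y)))"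
      by (rule mult_right_mono) simp
    also have "\<dots> = 1 + 1 / (z - y)" by (simp add: exp_minus)
    finally have 1: "(1 + g) * exp (- (g * (z - y))) \<le> 1 + 1 / (z - y)" .
    have ex: "exp (- (g * z)) = exp (- (g * (z - y))) * exp (- (g * y))"
      by (simp flip: exp_add add: algebra_simps)
    have "norm (\<i> * K n $ j * a n) * exp (- (g * z)) = norm (K n $ j) * (norm (a n) * exp (- (g * z)))"
      by (simp add: norm_mult)
    also have "\<dots> \<le> (C * (1 + g)) * (norm (a n) * exp (- (g * z)))"
      using C(2)[of n j] unfolding g_def by (intro mult_right_mono) auto
    also have "\<dots> = C * ((1 + g) * exp (- (g * (z - y)))) * (norm (a n) * exp (- (g * y)))"
      unfolding ex by simp
    also have "\<dots> \<le> D * (norm (a n) * exp (- (g * y)))"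
      unfolding D_def by (intro mult_right_mono mult_left_mono 1 C(1)) simp
    finally show "norm (\<i> * K n $ j * a n) * exp (- (Im (K n $ 3) * z)) \<le> D * (norm (a n) * exp (- (Im (K n $ 3) * y)))"
      by (simp add: g_def)
  qed auto
qed

lemma norm_wave_term_le:
  assumes K: "outgoing K" and x: "z \<le> x $ 3"
  shows "norm (a n * plane_wave (K n) x) \<le> norm (a n) * exp (- (Im (K n $ 3) * z))"
  using K x by (auto simp: norm_mult norm_plane_wave outgoing_def intro!: mult_left_mono)

lemma wave_series_has_sum:
  assumes K: "outgoing K" and a: "decays h K a" and x: "x \<in> half_space h"
  shows "((\<lambda>n. a n * plane_wave (K n) x) has_sum wave_series K a x) UNIV"
proof -
  have "(\<lambda>n. norm (a n) * exp (- (Im (K n $ 3) * x $ 3))) summable_on UNIV"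
    using a x by (simp add: decays_def half_space_def)
  then have "(\<lambda>n. norm (a n * plane_wave (K n) x)) summable_on UNIV"
    using norm_wave_term_le[OF K order_refl, of a] by (rule summable_on_comparison_test) auto
  then show ?thesis unfolding wave_series_def
    by (rule has_sum_infsum[OF abs_summable_summable])
qed

text \<open>On a slightly higher half space the series of the values and of the derivatives converge uniformly
  by the Weierstrass test. The summation is along an enumeration, as the theorem on termwise
  differentiation requires.\<close>

lemma wave_series_has_derivative:
  fixes K :: "'n::countable \<Rightarrow> complex^3"
  assumes inf: "infinite (UNIV :: 'n set)" and K: "outgoing K" and a: "decays h K a" and x: "x \<in> half_space h"
  shows "(wave_series K a has_derivative
           (\<lambda>v. \<Sum>j\<in>UNIV. of_real (v $ j) * wave_series K (\<lambda>n. \<i> * K n $ j * a n) x)) (at x)"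
proof -
  define e where "e = from_nat_into (UNIV :: 'n set)"
  have e: "bij_betw e UNIV UNIV" unfolding e_def using inf by (intro bij_betw_from_nat_into) auto
  define z where "z = (h + x $ 3) / 2"
  have z: "h < z" "z < x $ 3" using x by (auto simp: z_def half_space_def)
  define S where "S = half_space z"
  have S: "open S" "x \<in> S" "\<And>y. y \<in> S \<Longrightarrow> y \<in> half_space h" "\<And>y. y \<in> S \<Longrightarrow> z \<le> y $ 3"
    using z unfolding S_def by (auto intro: open_half_space) (auto simp: half_space_def)
  have "convex S"
  proof -
    have "S = {y. axis 3 1 \<bullet> y > z}" by (auto simp: S_def half_space_def inner_axis')
    then show ?thesis by (simp add: convex_halfspace_gt)
  qed
  have sums: "(\<lambda>i. b (e i) * plane_wave (K (e i)) y) sums wave_series K b y" if "decays h K b" "y \<in> S" for b y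
    by (rule has_sum_imp_sums) (rule has_sum_reindex_bij_betw[OF e, THEN iffD2, OF wave_series_has_sum[OF K that(1) S(3)[OF that(2)]]])
  have unif: "uniform_limit S (\<lambda>n y. \<Sum>i<n. b (e i) * plane_wave (K (e i)) y) (wave_series K b) sequentially"
    if b: "decays h K b" for b
  proof -
    have "summable (\<lambda>i. norm (b (e i)) * exp (- (Im (K (e i) $ 3) * z)))"
    proof -
      have "(\<lambda>n. norm (b n) * exp (- (Im (K n $ 3) * z))) summable_on UNIV" using b z by (simp add: decays_def)
      then have "(\<lambda>i. norm (b (e i)) * exp (- (Im (K (e i) $ 3) * z))) summable_on UNIV"
        by (rule summable_on_reindex_bij_betw[OF e, THEN iffD2])
      then show ?thesis by (rule summable_on_imp_summable)
    qed
    then have "uniform_limit S (\<lambda>n y. \<Sum>i<n. b (e i) * plane_wave (K (e i)) y)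
        (\<lambda>y. \<Sum>i. b (e i) * plane_wave (K (e i)) y) sequentially"
      by (rule Weierstrass_m_test[rotated]) (rule norm_wave_term_le[OF K S(4)])
    then show ?thesis
      by (subst uniform_limit_cong'[where g = "\<lambda>n y. \<Sum>i<n. b (e i) * plane_wave (K (e i)) y"
            and i = "\<lambda>y. \<Sum>i. b (e i) * plane_wave (K (e i)) y"])
         (auto simp: sums_unique[OF sums[OF b]])
  qed
  define c where "c j = (\<lambda>n. \<i> * K n $ j * a n)" for j
  have c: "decays h K (c j)" for j unfolding c_def by (rule decays_gradient[OF K a])
  define f where "f i y = a (e i) * plane_wave (K (e i)) y" for i y
  define f' where "f' i y v = (\<Sum>j\<in>UNIV. of_real (v $ j) * (c j (e i) * plane_wave (K (e i)) y))" for i y and v :: "real^3"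
  define g' where "g' y v = (\<Sum>j\<in>UNIV. of_real (v $ j) * wave_series K (c j) y)" for y and v :: "real^3"
  have "\<exists>g. \<forall>y\<in>S. (\<lambda>n. f n y) sums g y \<and> (g has_derivative g' y) (at y within S)"
  proof (rule has_derivative_series[OF \<open>convex S\<close>, where f' = f'])
    show "(f n has_derivative f' n y) (at y within S)" for n y
    proof -
      have "f' n y = (\<lambda>v. a (e n) * (\<Sum>j\<in>UNIV. of_real (v $ j) * (\<i> * K (e n) $ j * plane_wave (K (e n)) y)))"
        unfolding f'_def[abs_def] c_def sum_distrib_left by (intro ext sum.cong refl) (simp only: mult_ac)
      moreover have "(f n has_derivative (\<lambda>v. a (e n) * (\<Sum>j\<in>UNIV. of_real (v $ j) * (\<i> * K (e n) $ j * plane_wave (K (e n)) y)))) (at y)"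
        unfolding f_def[abs_def] by (rule has_derivative_mult_right[OF plane_wave_has_derivative])
      ultimately show ?thesis by (metis has_derivative_at_withinI)
    qed
    show "\<forall>\<^sub>F n in sequentially. \<forall>y\<in>S. \<forall>v. norm ((\<Sum>i<n. f' i y v) - g' y v) \<le> \<epsilon> * norm v" if "0 < \<epsilon>" for \<epsilon>
    proof -
      have "\<forall>\<^sub>F n in sequentially. \<forall>y\<in>S. dist (\<Sum>i<n. c j (e i) * plane_wave (K (e i)) y) (wave_series K (c j) y) < \<epsilon> / 3" for j
        using unif[OF c[of j]] that unfolding uniform_limit_iff by (elim allE[of _ "\<epsilon> / 3"]) auto
      then have "\<forall>\<^sub>F n in sequentially. \<forall>j. \<forall>y\<in>S. dist (\<Sum>i<n. c j (e i) * plane_wave (K (e i)) y) (wave_series K (c j) y) < \<epsilon> / 3"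
        by (simp add: eventually_all_finite)
      then show ?thesis
      proof eventually_elim
        case (elim n)
        show ?case
        proof (intro ballI allI)
          fix y v assume y: "y \<in> S"
          have "(\<Sum>i<n. f' i y v) - g' y v = (\<Sum>j\<in>UNIV. of_real (v $ j) * ((\<Sum>i<n. c j (e i) * plane_wave (K (e i)) y) - wave_series K (c j) y))"
            unfolding f'_def g'_def
            by (subst sum.swap) (simp add: sum_distrib_left right_diff_distrib sum_subtractf)
          also have "norm \<dots> \<le> (\<Sum>j\<in>(UNIV::3 set). norm v * (\<epsilon> / 3))"
          proof (rule sum_norm_le)
            fix j :: 3
            show "norm (of_real (v $ j) * ((\<Sum>i<n. c j (e i) * plane_wave (K (e i)) y) - wave_series K (c j) y)) \<le> norm v * (\<epsilon> / 3)"
              unfolding norm_mult norm_of_real using elim y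
              by (intro mult_mono component_le_norm_cart) (auto simp: dist_norm intro: less_imp_le)
          qed
          finally show "norm ((\<Sum>i<n. f' i y v) - g' y v) \<le> \<epsilon> * norm v" by (simp add: mult.commute)
        qed
      qed
    qed
    show "x \<in> S" by (rule S)
    show "(\<lambda>n. f n x) sums wave_series K a x" unfolding f_def by (rule sums[OF a S(2)])
  qed
  then obtain g where g: "\<And>y. y \<in> S \<Longrightarrow> (\<lambda>n. f n y) sums g y" "\<And>y. y \<in> S \<Longrightarrow> (g has_derivative g' y) (at y within S)"
    by blast
  have "g y = wave_series K a y" if "y \<in> S" for y
    using g(1)[OF that] sums[OF a that] unfolding f_def by (rule sums_unique2)
  moreover have "(g has_derivative g' x) (at x)"
    using g(2)[OF S(2)] at_within_open[OF S(2,1)] by simp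
  ultimately have "(wave_series K a has_derivative g' x) (at x)"
    using has_derivative_transform_within_open[OF _ S(1,2)] by blast
  then show ?thesis unfolding g'_def[abs_def] c_def .
qed

lemma
  fixes K :: "'n::countable \<Rightarrow> complex^3"
  assumes inf: "infinite (UNIV :: 'n set)" and K: "outgoing K" and a: "decays h K a"
  shows C1_on_wave_series: "C1_on (half_space h) (wave_series K a)"
    and partial_wave_series: "x \<in> half_space h \<Longrightarrow>
      partial j (wave_series K a) x = wave_series K (\<lambda>n. \<i> * K n $ j * a n) x"
proof -
  show "x \<in> half_space h \<Longrightarrow> partial j (wave_series K a) x = wave_series K (\<lambda>n. \<i> * K n $ j * a n) x"
    using partial_eqI[OF wave_series_has_derivative[OF inf K a]] by (simp add: sum_axis_mult)
  have "continuous_on (half_space h) (wave_series K b)" if "decays h K b" for b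
    using wave_series_has_derivative[OF inf K that]
    by (meson continuous_at_imp_continuous_on has_derivative_continuous)
  then show "C1_on (half_space h) (wave_series K a)"
    by (intro C1_onI[OF wave_series_has_derivative[OF inf K a]]) (auto simp: sum_axis_mult decays_gradient[OF K a])
qed

section \<open>Rayleigh expansions\<close>

definition wave_vector :: "real \<Rightarrow> real \<Rightarrow> real^2 \<Rightarrow> real \<Rightarrow> int \<times> int \<Rightarrow> complex^3" where
  "wave_vector L1 L2 al k n = vector [of_real (alpha_n L1 L2 al n $ 1), of_real (alpha_n L1 L2 al n $ 2), beta_n L1 L2 al k n]"

lemma beta_n_squared: "(beta_n L1 L2 al k n)\<^sup>2 = of_real (k\<^sup>2 - (norm (alpha_n L1 L2 al n))\<^sup>2)" if "0 \<le> k"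
proof (cases "norm (alpha_n L1 L2 al n) < k")
  case True
  then have "(norm (alpha_n L1 L2 al n))\<^sup>2 \<le> k\<^sup>2" by (intro power_mono) auto
  then show ?thesis using True by (simp add: beta_n_def flip: of_real_power)
next
  case False
  then have "k\<^sup>2 \<le> (norm (alpha_n L1 L2 al n))\<^sup>2" using that by (intro power_mono) auto
  then show ?thesis using False by (simp add: beta_n_def power_mult_distrib flip: of_real_power)
qed

text \<open>For evanescent modes \<open>|\<alpha>\<^sup>n|\<^sup>2 = k\<^sup>2 + (Im \<beta>\<^sup>n)\<^sup>2 \<le> (k + Im \<beta>\<^sup>n)\<^sup>2\<close>.\<close>

lemma outgoing_wave_vector:
  assumes "0 \<le> k"
  shows "outgoing (wave_vector L1 L2 al k)"
proof -
  let ?A = "\<lambda>n. norm (alpha_n L1 L2 al n)" and ?B = "beta_n L1 L2 al k"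
  have imb: "0 \<le> Im (?B n)" for n by (auto simp: beta_n_def not_less intro!: real_sqrt_ge_zero power_mono assms)
  have b: "norm (?B n) \<le> k + Im (?B n) \<and> ?A n \<le> k + Im (?B n)" for n
  proof (cases "?A n < k")
    case True
    have "sqrt (k\<^sup>2 - (?A n)\<^sup>2) \<le> k" using assms by (intro real_le_lsqrt) auto
    moreover have "0 \<le> k\<^sup>2 - (?A n)\<^sup>2" using True by (simp add: power_mono)
    ultimately show ?thesis using True by (simp add: beta_n_def)
  next
    case False
    then have sq: "k\<^sup>2 \<le> (?A n)\<^sup>2" using assms by (intro power_mono) auto
    have "?A n \<le> k + sqrt ((?A n)\<^sup>2 - k\<^sup>2)"
    proof (rule power2_le_imp_le)
      have "(k + sqrt ((?A n)\<^sup>2 - k\<^sup>2))\<^sup>2 = (?A n)\<^sup>2 + 2 * k * sqrt ((?A n)\<^sup>2 - k\<^sup>2)"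
        using sq by (simp add: power2_sum)
      then show "(?A n)\<^sup>2 \<le> (k + sqrt ((?A n)\<^sup>2 - k\<^sup>2))\<^sup>2" using assms sq by simp
    qed (use assms sq in simp)
    then show ?thesis using False assms sq by (simp add: beta_n_def norm_mult)
  qed
  have comp: "norm (wave_vector L1 L2 al k n $ j) \<le> k + Im (?B n)" for n j
    using exhaust_3[of j] b[of n] component_le_norm_cart[of "alpha_n L1 L2 al n" 1] component_le_norm_cart[of "alpha_n L1 L2 al n" 2]
    by (auto simp: wave_vector_def)
  have "norm (wave_vector L1 L2 al k n $ j) \<le> (k + 1) * (1 + Im (wave_vector L1 L2 al k n $ 3))" for n j
  proof -
    have "k + Im (?B n) \<le> (k + 1) * (1 + Im (?B n))" using assms imb[of n] by (simp add: algebra_simps)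
    with comp[of n j] show ?thesis by (simp add: wave_vector_def)
  qed
  then show ?thesis unfolding outgoing_def using imb assms
    by (auto simp: wave_vector_def intro!: exI[of _ "k + 1"])
qed

lemma rayleigh_expansion_wave_series:
  assumes k: "0 \<le> k" and F: "rayleigh_expansion L1 L2 al k h a F"
  defines "K \<equiv> wave_vector L1 L2 al k"
    and "b \<equiv> \<lambda>n. a n * exp (- \<i> * beta_n L1 L2 al k n * of_real h)"
  shows "decays h K b" and "x \<in> half_space h \<Longrightarrow> F x = wave_series K b x"
proof -
  have eq: "a n * exp (\<i> * (of_real (alpha_n L1 L2 al n \<bullet> horiz x) + beta_n L1 L2 al k n * of_real (x $ 3 - h)))
     = b n * plane_wave (K n) x" for n x
  proof -
    have "exp (\<i> * (of_real (alpha_n L1 L2 al n \<bullet> horiz x) + beta_n L1 L2 al k n * of_real (x $ 3 - h)))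
       = exp (- \<i> * beta_n L1 L2 al k n * of_real h) * plane_wave (K n) x"
      unfolding plane_wave_def exp_add[symmetric]
      by (simp add: K_def wave_vector_def sum_3 horiz_def inner_vec_def sum_2 algebra_simps)
    then show ?thesis by (simp add: b_def)
  qed
  have hs: "((\<lambda>n. b n * plane_wave (K n) x) has_sum F x) UNIV" if "x \<in> half_space h" for x
    using F that unfolding rayleigh_expansion_def eq by blast
  have K: "outgoing K" unfolding K_def by (rule outgoing_wave_vector[OF k])
  show "decays h K b" unfolding decays_def
  proof (intro allI impI)
    fix z assume "h < z"
    define x :: "real^3" where "x = vector [0, 0, z]"
    have "x \<in> half_space h" using \<open>h < z\<close> by (simp add: x_def half_space_def)
    then have "(\<lambda>n. b n * plane_wave (K n) x) summable_on UNIV"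
      using hs has_sum_imp_summable by blast
    then have "(\<lambda>n. norm (b n * plane_wave (K n) x)) summable_on UNIV"
      by (simp add: summable_on_iff_abs_summable_on_complex)
    moreover have "norm (b n * plane_wave (K n) x) = norm (b n) * exp (- (Im (K n $ 3) * z))" for n
    proof -
      have "Im (K n $ 1) = 0" "Im (K n $ 2) = 0" using K by (auto simp only: outgoing_def)
      then show ?thesis by (simp add: norm_mult norm_plane_wave x_def)
    qed
    ultimately show "(\<lambda>n. norm (b n) * exp (- (Im (K n $ 3) * z))) summable_on UNIV" by simp
  qed
  show "x \<in> half_space h \<Longrightarrow> F x = wave_series K b x"
    using hs[of x] unfolding wave_series_def by (simp add: infsumI)
qed

section \<open>Orthogonality of plane waves\<close>

text \<open>The wave vectors belong to different modes of the same quasi-periodicity: their horizontal parts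
  differ by a nonzero vector of the dual lattice.\<close>

definition lattice_shift :: "real \<Rightarrow> real \<Rightarrow> complex^3 \<Rightarrow> complex^3 \<Rightarrow> bool" where
  "lattice_shift L1 L2 K K' \<longleftrightarrow> (\<exists>m1 m2. K $ 1 - K' $ 1 = of_real (2 * pi * of_int m1 / L1)
     \<and> K $ 2 - K' $ 2 = of_real (2 * pi * of_int m2 / L2) \<and> (m1 \<noteq> 0 \<or> m2 \<noteq> (0::int)))"

context cutoffs begin

definition \<rho> :: "real^3 \<Rightarrow> real" where "\<rho> x = \<eta>1 (x $ 1) * \<eta>2 (x $ 2) * \<sigma> (x $ 3)"

lemma rho_C1: "C1_on UNIV \<rho>"
  and partial_rho: "partial 1 \<rho> x = (r1 (x $ 1) - r1 (x $ 1 + L1)) * \<eta>2 (x $ 2) * \<sigma> (x $ 3)"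
    "partial 2 \<rho> x = \<eta>1 (x $ 1) * (r2 (x $ 2) - r2 (x $ 2 + L2)) * \<sigma> (x $ 3)"
proof -
  have cs: "continuous_on UNIV (\<lambda>t. r1 t - r1 (t + L1))" "continuous_on UNIV (\<lambda>t. r2 t - r2 (t + L2))"
    by (intro continuous_intros continuous_on_compose2[OF e1(2)] continuous_on_compose2[OF e2(2)]; simp)+
  note Z = C1_on_cutoff[OF e1(1) e2(1) c(2) cs c(3), folded \<rho>_def[abs_def]]
  show "C1_on UNIV \<rho>" "partial 1 \<rho> x = (r1 (x $ 1) - r1 (x $ 1 + L1)) * \<eta>2 (x $ 2) * \<sigma> (x $ 3)"
    "partial 2 \<rho> x = \<eta>1 (x $ 1) * (r2 (x $ 2) - r2 (x $ 2 + L2)) * \<sigma> (x $ 3)"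
    using Z by auto
qed

lemma rho_cont: "continuous_on UNIV \<rho>" using C1_on_cont[OF rho_C1] .

lemma rho_nonneg: "0 \<le> \<rho> x" by (simp add: \<rho>_def e1 e2 c)

definition Z :: "(real^3) set" where
  "Z = cbox (vector [-L1, -L2, h + 1]) (vector [L1, L2, h + 3])"

lemma Z_bounded: "bounded Z" by (simp add: Z_def)

lemma vanishes_off_Z:
  assumes "\<And>t. t \<notin> {-L1..L1} \<Longrightarrow> a t = 0" "\<And>t. t \<notin> {-L2..L2} \<Longrightarrow> b t = 0" "x \<notin> Z"
  shows "a (x $ 1) * b (x $ 2) * \<sigma> (x $ 3) = (0::real)"
  using assms(3) assms(1)[of "x $ 1"] assms(2)[of "x $ 2"] c(4)[of "x $ 3"]
  by (auto simp: Z_def mem_box_cart forall_3)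

lemma rho_off_Z: "x \<notin> Z \<Longrightarrow> \<rho> x = 0"
  unfolding \<rho>_def by (rule vanishes_off_Z[OF e1(4) e2(4)])

lemma rho_low: "x $ 3 < h + 1 \<Longrightarrow> \<rho> x = 0" by (simp add: \<rho>_def c)

lemma integrable_rho_mult:
  fixes F :: "real^3 \<Rightarrow> complex"
  assumes "continuous_on UNIV F"
  shows "integrable lebesgue (\<lambda>x. of_real (\<rho> x) * F x)"
  by (rule integrable_continuous_bounded_support[OF _ Z_bounded])
     (auto simp: rho_off_Z intro!: continuous_intros rho_cont assms)

text \<open>Integrate \<open>\<partial>\<^sub>j(\<rho> E)\<close> for \<open>E = plane_wave K * cnj (plane_wave K')\<close> over the space, where \<open>j\<close> is a direction in
  which the wave vectors differ. The product \<open>E\<close> is biperiodic, so the term with \<open>\<partial>\<^sub>j\<rho>\<close> drops out, and what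
  remains is \<open>\<i>(K $ j - K' $ j)\<close> times the integral in question.\<close>

lemma plane_waves_orthogonal:
  assumes re: "\<And>j. j \<noteq> 3 \<Longrightarrow> Im (K $ j) = 0 \<and> Im (K' $ j) = 0"
    and lat: "lattice_shift L1 L2 K K'"
  shows "(\<integral>x. of_real (\<rho> x) * (plane_wave K x * cnj (plane_wave K' x)) \<partial>lebesgue) = 0"
proof -
  define E where "E x = plane_wave K x * cnj (plane_wave K' x)" for x
  have cC1: "C1_on UNIV (\<lambda>x. cnj (plane_wave K' x))"
    and cp: "partial j (\<lambda>x. cnj (plane_wave K' x)) x = cnj (\<i> * K' $ j * plane_wave K' x)" for j x
    using C1_on_bounded_linear[OF bounded_linear_cnj plane_wave_C1[of UNIV K']] by (auto simp: partial_plane_wave)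
  have EC1: "C1_on UNIV E" unfolding E_def[abs_def] by (rule C1_on_mult(1)[OF plane_wave_C1 cC1])
  have Ec: "continuous_on UNIV E" using C1_on_cont[OF EC1] .
  have Ep: "partial j E x = \<i> * (K $ j - cnj (K' $ j)) * E x" for j x
    unfolding E_def[abs_def] by (simp add: C1_on_mult(2)[OF plane_wave_C1 cC1] cp partial_plane_wave algebra_simps)
  define P where "P x = \<rho> x *\<^sub>R E x" for x
  have PC1: "C1_on UNIV P" unfolding P_def[abs_def] by (rule C1_on_scaleR(1)[OF rho_C1 EC1])
  have Pp: "partial j P x = of_real (\<rho> x) * (\<i> * (K $ j - cnj (K' $ j)) * E x) + of_real (partial j \<rho> x) * E x" for j x
    unfolding P_def[abs_def] C1_on_scaleR(2)[OF rho_C1 EC1 UNIV_I] Ep unfolding scaleR_conv_of_real by (rule refl)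
  have P0: "integral\<^sup>L lebesgue (partial j P) = 0" for j
    by (rule integral_partial_eq_0[OF PC1 Z_bounded]) (simp add: P_def rho_off_Z)
  have per: "E (x + L *\<^sub>R axis j 1) = E x"
    if "j \<noteq> 3" "K $ j - K' $ j = of_real (2 * pi * of_int m / L)" "0 < L" for x j m L
  proof -
    have sh: "plane_wave k (x + L *\<^sub>R axis j 1) = exp (\<i> * (k $ j * of_real L)) * plane_wave k x" for k
    proof -
      have "(\<Sum>i\<in>UNIV. k $ i * of_real ((x + L *\<^sub>R axis j 1) $ i)) = k $ j * of_real L + (\<Sum>i\<in>UNIV. k $ i * of_real (x $ i))"
        using exhaust_3[of j] by (auto simp: sum_3 axis_def algebra_simps)
      then show ?thesis by (simp add: plane_wave_def distrib_left exp_add)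
    qed
    have "cnj (K' $ j) = K' $ j" using re[OF that(1)] by (simp add: complex_eq_iff)
    then have "exp (\<i> * (K $ j * of_real L)) * cnj (exp (\<i> * (K' $ j * of_real L)))
       = exp (\<i> * ((K $ j - K' $ j) * of_real L))"
      by (simp add: exp_cnj algebra_simps flip: exp_add)
    also have "\<dots> = exp (of_int m * (of_real (2 * pi) * \<i>))"
      using that(3) unfolding that(2) by (simp add: mult_ac)
    also have "\<dots> = 1"
      using exp_integer_2pi[of "of_int m"] by (simp add: mult_ac)
    finally have "exp (\<i> * (K $ j * of_real L)) * cnj (exp (\<i> * (K' $ j * of_real L))) = 1" .
    then show ?thesis unfolding E_def sh complex_cnj_mult
      by (metis (no_types, opaque_lifting) mult.assoc mult.left_commute mult_1)
  qed
  have main: "(\<integral>x. of_real (\<rho> x) * E x \<partial>lebesgue) = 0"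
    if "j \<noteq> 3" "K $ j \<noteq> K' $ j" and z: "(\<integral>x. of_real (partial j \<rho> x) * E x \<partial>lebesgue) = 0"
      and zi: "integrable lebesgue (\<lambda>x. of_real (partial j \<rho> x) * E x)" for j
  proof -
    have ne: "\<i> * (K $ j - cnj (K' $ j)) \<noteq> 0"
      using re[OF that(1)] that(2) by (auto simp: complex_eq_iff)
    have "0 = (\<integral>x. of_real (\<rho> x) * (\<i> * (K $ j - cnj (K' $ j)) * E x) \<partial>lebesgue)
         + (\<integral>x. of_real (partial j \<rho> x) * E x \<partial>lebesgue)"
      using P0[of j] integrable_rho_mult[OF continuous_on_mult_left[OF Ec, of "\<i> * (K $ j - cnj (K' $ j))"]] zi
      unfolding Pp[abs_def] by (subst (asm) Bochner_Integration.integral_add) (auto intro!: continuous_intros)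
    also have "\<dots> = (\<i> * (K $ j - cnj (K' $ j))) * (\<integral>x. of_real (\<rho> x) * E x \<partial>lebesgue)"
      unfolding z by (simp only: mult.left_commute[of "of_real _" "\<i> * (K $ j - cnj (K' $ j))"] integral_mult_right_zero add_0_right)
    finally show ?thesis using ne by simp
  qed
  have wc: "continuous_on UNIV (\<lambda>x::real^3. q (x $ i))" if "continuous_on UNIV q" for q :: "real \<Rightarrow> real" and i
    by (intro continuous_on_compose2[OF that] continuous_intros) auto
  have wint: "integrable lebesgue (\<lambda>x. of_real (w x) * E x)"
    if "continuous_on UNIV w" "\<And>x. x \<notin> Z \<Longrightarrow> w x = 0" for w :: "real^3 \<Rightarrow> real"
    by (rule integrable_continuous_bounded_support[OF _ Z_bounded]) (auto simp: that(2) intro!: continuous_intros that(1) Ec)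
  have z1: "r1 t - r1 (t + L1) = 0" if "t \<notin> {-L1..L1}" for t
    using that e1(3)[of t] e1(3)[of "t + L1"] L by auto
  have z2: "r2 t - r2 (t + L2) = 0" if "t \<notin> {-L2..L2}" for t
    using that e2(3)[of t] e2(3)[of "t + L2"] L by auto
  have pz: "partial 1 \<rho> x = 0" "partial 2 \<rho> x = 0" if "x \<notin> Z" for x
    unfolding partial_rho by (rule vanishes_off_Z[OF z1 e2(4) that] vanishes_off_Z[OF e1(4) z2 that]; assumption)+
  have pc: "continuous_on UNIV (partial j \<rho>)" for j using rho_C1 by (simp add: C1_on_def)
  obtain m1 m2 :: int where m: "K $ 1 - K' $ 1 = of_real (2 * pi * of_int m1 / L1)" "K $ 2 - K' $ 2 = of_real (2 * pi * of_int m2 / L2)"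
    "m1 \<noteq> 0 \<or> m2 \<noteq> 0" using lat unfolding lattice_shift_def by iprover
  have p1: "E (x + L1 *\<^sub>R axis 1 1) = E x" and p2: "E (x + L2 *\<^sub>R axis 2 1) = E x" for x
    by (rule per[OF _ m(1) L(1)], simp, rule per[OF _ m(2) L(2)], simp)
  have Em: "E \<in> borel_measurable lebesgue" by (rule borel_measurable_lebesgue_continuous[OF Ec])
  have int: "integrable lebesgue (\<lambda>x. of_real (a (x $ 1) * b (x $ 2) * \<sigma> (x $ 3)) * E x)"
    if "continuous_on UNIV a" "continuous_on UNIV b" "\<And>t. t \<notin> {-L1..L1} \<Longrightarrow> a t = 0"
      "\<And>t. t \<notin> {-L2..L2} \<Longrightarrow> b t = 0" for a b
    by (intro wint continuous_intros wc eta_cont that(1,2) vanishes_off_Z) (use that(3,4) in auto)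
  note horizontal = integral_horizontal_derivative_weight[OF Em p1 p2 eta_cont(3) int]
  have "(\<integral>x. of_real (\<rho> x) * E x \<partial>lebesgue) = 0"
  proof (cases "m1 = 0")
    case False
    then have "K $ 1 \<noteq> K' $ 1" using m(1) L by auto
    then show ?thesis
      by (intro main[of 1] wint pc pz) (simp, assumption, unfold partial_rho, (rule horizontal; assumption))
  next
    case True
    then have "K $ 2 \<noteq> K' $ 2" using m(2,3) L by auto
    then show ?thesis
      by (intro main[of 2] wint pc pz) (simp, assumption, unfold partial_rho, (rule horizontal; assumption))
  qed
  then show ?thesis by (simp add: E_def)
qed

lemma integral_rho_pos:
  assumes g: "continuous_on UNIV g" "\<And>x. 0 < g x"
  shows "0 < (\<integral>x. \<rho> x * g x \<partial>lebesgue)"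
proof -
  have cont: "continuous_on UNIV (\<lambda>x. \<rho> x * g x)" by (intro continuous_intros rho_cont g)
  have i: "integrable lebesgue (\<lambda>x. \<rho> x * g x)"
    by (rule integrable_continuous_bounded_support[OF cont Z_bounded]) (simp add: rho_off_Z)
  have nn: "0 \<le> \<rho> x * g x" for x using rho_nonneg g(2)[of x] by (simp add: less_imp_le)
  have "(\<integral>x. \<rho> x * g x \<partial>lebesgue) \<noteq> 0"
  proof
    assume "(\<integral>x. \<rho> x * g x \<partial>lebesgue) = 0"
    then have "AE x in lebesgue. \<rho> x * g x = 0"
      using integral_nonneg_eq_0_iff_AE[OF i] nn by auto
    then have "AE x in lebesgue. \<not> \<rho> x \<noteq> 0"
    proof eventually_elim
      case (elim x)
      then show ?case using g(2)[of x] by simp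
    qed
    moreover have o: "open {x. \<rho> x \<noteq> 0}"
      by (intro open_Collect_neq rho_cont continuous_intros)
    ultimately have "{x. \<rho> x \<noteq> 0} \<in> null_sets lebesgue"
      by (intro AE_iff_null_sets[THEN iffD2, OF sets_lebesgue_open_imp]) (simp_all only: mem_Collect_eq)
    then have "negligible {x. \<rho> x \<noteq> 0}" by (simp add: negligible_iff_null_sets)
    moreover have "vector [0, 0, h + 2] \<in> {x. \<rho> x \<noteq> 0}"
      using e1(6) e2(6) c(7) by (simp add: \<rho>_def)
    ultimately show False using open_not_negligible[OF o] by blast
  qed
  moreover have "0 \<le> (\<integral>x. \<rho> x * g x \<partial>lebesgue)" using nn by simp
  ultimately show ?thesis by simp
qed

text \<open>Dominated convergence for truncated expansions. These are bounded uniformly only at a positive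
  distance above the plane \<open>x $ 3 = h\<close>, and the weight vanishes below \<open>h + 1\<close>.\<close>

lemma integral_rho_tendsto:
  fixes F :: "real^3 \<Rightarrow> complex"
  assumes Fk: "\<And>k. continuous_on UNIV (\<Phi> k)" and F: "continuous_on (half_space h) F"
    and lim: "\<And>x. x \<in> half_space h \<Longrightarrow> (\<lambda>k. \<Phi> k x) \<longlonglongrightarrow> F x"
    and bound: "\<And>k x. h + 1 \<le> x $ 3 \<Longrightarrow> norm (\<Phi> k x) \<le> B"
  shows "(\<lambda>k. \<integral>x. of_real (\<rho> x) * \<Phi> k x \<partial>lebesgue) \<longlonglongrightarrow> (\<integral>x. of_real (\<rho> x) * F x \<partial>lebesgue)"
proof (rule integral_dominated_convergence[where w = "\<lambda>x. \<rho> x * B"])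
  have w: "weighted h \<rho> F x = of_real (\<rho> x) * F x" for x
    using rho_low[of x] by (auto simp: weighted_def half_space_def scaleR_conv_of_real)
  show "(\<lambda>x. of_real (\<rho> x) * F x) \<in> borel_measurable lebesgue"
    using borel_measurable_lebesgue_continuous[OF weighted_continuous[OF rho_cont rho_low F]] by (simp add: w[abs_def])
  show "(\<lambda>x. of_real (\<rho> x) * \<Phi> k x) \<in> borel_measurable lebesgue" for k
    using integrable_rho_mult[OF Fk[of k]] by auto
  show "integrable lebesgue (\<lambda>x. \<rho> x * B)"
    by (intro integrable_mult_left integrable_continuous_bounded_support[OF rho_cont Z_bounded rho_off_Z])
  show "AE x in lebesgue. (\<lambda>k. of_real (\<rho> x) * \<Phi> k x) \<longlonglongrightarrow> of_real (\<rho> x) * F x"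
  proof (rule AE_I2)
    fix x show "(\<lambda>k. of_real (\<rho> x) * \<Phi> k x) \<longlonglongrightarrow> of_real (\<rho> x) * F x"
    proof (cases "x \<in> half_space h")
      case False
      then show ?thesis using rho_low[of x] by (simp add: half_space_def)
    qed (intro tendsto_intros lim)
  qed
  show "AE x in lebesgue. norm (of_real (\<rho> x) * \<Phi> k x) \<le> \<rho> x * B" for k
  proof (rule AE_I2)
    fix x show "norm (of_real (\<rho> x) * \<Phi> k x) \<le> \<rho> x * B"
    proof (cases "h + 1 \<le> x $ 3")
      case True
      then show ?thesis using bound[OF True] rho_nonneg[of x] by (simp add: norm_mult mult_left_mono)
    qed (use rho_low[of x] in simp)
  qed
qed

end

section \<open>Mode algebra\<close>

text \<open>This is \<open>energy_flux lam mu v H 3\<close> for \<open>v = d'\<close> and \<open>H $ i $ j = \<i> * k $ j * d $ i\<close>, the Jacobian of the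
  plane wave with wave vector \<open>k\<close> and polarization \<open>d\<close> up to its scalar factor.\<close>

definition wave_flux :: "real \<Rightarrow> real \<Rightarrow> complex^3 \<Rightarrow> complex^3 \<Rightarrow> complex^3 \<Rightarrow> complex" where
  "wave_flux lam mu k d d' = \<i> * (of_real mu * k $ 3 * (\<Sum>i\<in>UNIV. d $ i * cnj (d' $ i))
      + of_real (lam + mu) * (\<Sum>i\<in>UNIV. k $ i * d $ i) * cnj (d' $ 3))"

lemma cnj_real_or_imaginary:
  assumes "z\<^sup>2 = complex_of_real t"
  shows "cnj z = z \<or> cnj z = - z"
proof -
  have "(cnj z)\<^sup>2 = z\<^sup>2" by (metis assms complex_cnj_complex_of_real complex_cnj_power)
  then show ?thesis by (simp add: power2_eq_iff)
qed

lemma longitudinal_divergence: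
  fixes x y :: real and k d :: "complex^3"
  assumes "k $ 1 = of_real x" "k $ 2 = of_real y" "(k $ 3)\<^sup>2 = of_real (p - x\<^sup>2 - y\<^sup>2)"
    and "\<And>i. d $ i = A * k $ i"
  shows "(\<Sum>i\<in>UNIV. k $ i * d $ i) = A * of_real p"
proof -
  have "(\<Sum>i\<in>UNIV. k $ i * d $ i) = A * ((k $ 1)\<^sup>2 + (k $ 2)\<^sup>2 + (k $ 3)\<^sup>2)"
    by (simp add: sum_3 assms(4) power2_eq_square algebra_simps)
  then show ?thesis by (simp add: assms(1-3))
qed

text \<open>With \<open>W\<close> and \<open>V\<close> the two fluxes without the factor \<open>\<i>\<close>, the orthogonality of \<open>d'\<close> and \<open>k'\<close> turns
  \<open>W + cnj V\<close> into a multiple of \<open>\<mu>(g\<^sup>2 - g'\<^sup>2) + (\<lambda>+\<mu>) p\<close>. The vertical wave numbers satisfy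
  \<open>g\<^sup>2 - g'\<^sup>2 = p - s\<close>, whether they are real or imaginary, so this multiple is \<open>(\<lambda>+2\<mu>) p - \<mu> s = 0\<close>.\<close>

lemma wave_flux_longitudinal_transversal:
  fixes x y p s :: real
  assumes K: "k $ 1 = of_real x" "k $ 2 = of_real y" "(k $ 3)\<^sup>2 = of_real (p - x\<^sup>2 - y\<^sup>2)"
    and K': "k' $ 1 = of_real x" "k' $ 2 = of_real y" "(k' $ 3)\<^sup>2 = of_real (s - x\<^sup>2 - y\<^sup>2)"
    and ps: "(lam + 2 * mu) * p = mu * s"
    and d: "\<And>i. d $ i = A * k $ i" and d': "(\<Sum>i\<in>UNIV. k' $ i * d' $ i) = 0"
  shows "Im (wave_flux lam mu k d d' + wave_flux lam mu k' d' d) = 0"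
proof -
  define g where "g = k $ 3"
  define g' where "g' = k' $ 3"
  define e where "e = cnj (d' $ 3)"
  have kd: "(\<Sum>i\<in>UNIV. k $ i * d $ i) = A * of_real p" by (rule longitudinal_divergence[OF K d])
  have o: "of_real x * cnj (d' $ 1) + of_real y * cnj (d' $ 2) = - (cnj g' * e)"
  proof -
    have "cnj (of_real x * d' $ 1 + of_real y * d' $ 2 + g' * d' $ 3) = 0"
      using d' by (simp add: sum_3 K' g'_def)
    then show ?thesis by (simp add: e_def eq_neg_iff_add_eq_0)
  qed
  have s1: "(\<Sum>i\<in>UNIV. d $ i * cnj (d' $ i)) = A * (g - cnj g') * e"
  proof -
    have "(\<Sum>i\<in>UNIV. d $ i * cnj (d' $ i)) = A * ((of_real x * cnj (d' $ 1) + of_real y * cnj (d' $ 2)) + g * e)"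
      by (simp add: sum_3 d K e_def g_def algebra_simps)
    then show ?thesis unfolding o by (simp add: algebra_simps)
  qed
  have s2: "(\<Sum>i\<in>UNIV. d' $ i * cnj (d $ i)) = cnj (A * (g - cnj g') * e)"
    unfolding s1[symmetric] by (simp add: cnj_sum mult.commute)
  define W where "W = of_real mu * g * (A * (g - cnj g') * e) + of_real (lam + mu) * (A * of_real p) * e"
  define V where "V = of_real mu * g' * cnj (A * (g - cnj g') * e)"
  have w1: "wave_flux lam mu k d d' = \<i> * W"
    unfolding wave_flux_def s1 kd W_def by (simp add: g_def e_def)
  have w2: "wave_flux lam mu k' d' d = \<i> * V"
    unfolding wave_flux_def s2 d' V_def by (simp add: g'_def)
  have "W + cnj V = A * e * (of_real mu * (g\<^sup>2 - (cnj g')\<^sup>2) + of_real (lam + mu) * of_real p)"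
    unfolding W_def V_def by (simp add: power2_eq_square algebra_simps)
  also have "(cnj g')\<^sup>2 = of_real (s - x\<^sup>2 - y\<^sup>2)"
    using K'(3) unfolding g'_def by (metis complex_cnj_complex_of_real complex_cnj_power)
  also have "g\<^sup>2 = of_real (p - x\<^sup>2 - y\<^sup>2)" using K(3) by (simp add: g_def)
  also have "of_real mu * (of_real (p - x\<^sup>2 - y\<^sup>2) - of_real (s - x\<^sup>2 - y\<^sup>2)) + of_real (lam + mu) * of_real p
      = (of_real ((lam + 2 * mu) * p - mu * s) :: complex)" by (simp add: algebra_simps)
  also have "\<dots> = 0" using ps by simp
  finally have "W + cnj V = 0" by simp
  then have "Re W + Re V = 0" by (simp add: complex_eq_iff)
  then show ?thesis unfolding w1 w2 by simp
qed

text \<open>For a real vertical wave number \<open>g\<close> the squared length of the wave vector is \<open>p\<close>; for an imaginary one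
  the flux is real.\<close>

lemma wave_flux_longitudinal_self:
  fixes x y :: real
  assumes K: "k $ 1 = of_real x" "k $ 2 = of_real y" "(k $ 3)\<^sup>2 = of_real (p - x\<^sup>2 - y\<^sup>2)"
    and d: "\<And>i. d $ i = A * k $ i"
  shows "Im (wave_flux lam mu k d d) = (lam + 2 * mu) * p * Re (k $ 3) * (norm A)\<^sup>2"
proof -
  define g where "g = k $ 3"
  have kd: "(\<Sum>i\<in>UNIV. k $ i * d $ i) = A * of_real p" by (rule longitudinal_divergence[OF K d])
  have dd: "(\<Sum>i\<in>UNIV. d $ i * cnj (d $ i)) = of_real ((norm A)\<^sup>2 * (x\<^sup>2 + y\<^sup>2 + (norm g)\<^sup>2))"
    unfolding of_real_mult of_real_add complex_norm_square
    by (simp add: sum_3 d K(1,2) g_def power2_eq_square algebra_simps)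
  have "wave_flux lam mu k d d = \<i> * (of_real mu * g * of_real ((norm A)\<^sup>2 * (x\<^sup>2 + y\<^sup>2 + (norm g)\<^sup>2))
     + of_real ((lam + mu) * p) * (A * cnj A) * cnj g)"
    unfolding wave_flux_def kd dd by (simp add: d g_def)
  also have "A * cnj A = of_real ((norm A)\<^sup>2)" by (rule complex_norm_square[symmetric])
  finally have "Im (wave_flux lam mu k d d) = mu * Re g * ((norm A)\<^sup>2 * (x\<^sup>2 + y\<^sup>2 + (norm g)\<^sup>2))
      + (lam + mu) * p * (norm A)\<^sup>2 * Re g" by (simp del: of_real_mult of_real_add of_real_power)
  also have "\<dots> = (lam + 2 * mu) * p * Re g * (norm A)\<^sup>2"
  proof (cases "Re g = 0")
    case False
    have "cnj g = g"
      using cnj_real_or_imaginary[OF K(3)] False by (auto simp: g_def complex_eq_iff)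
    then have "of_real ((norm g)\<^sup>2) = g\<^sup>2"
      unfolding complex_norm_square by (simp add: power2_eq_square)
    then have "(norm g)\<^sup>2 = p - x\<^sup>2 - y\<^sup>2" using K(3) unfolding g_def by (metis of_real_eq_iff)
    then have "x\<^sup>2 + y\<^sup>2 + (norm g)\<^sup>2 = p" by simp
    then show ?thesis by (simp only: algebra_simps)
  qed simp
  finally show ?thesis by (simp add: g_def)
qed

lemma wave_flux_transversal_self:
  assumes "(\<Sum>i\<in>UNIV. k $ i * d $ i) = 0"
  shows "Im (wave_flux lam mu k d d) = mu * Re (k $ 3) * (\<Sum>i\<in>UNIV. (norm (d $ i))\<^sup>2)"
proof -
  have "(\<Sum>i\<in>UNIV. d $ i * cnj (d $ i)) = of_real (\<Sum>i\<in>UNIV. (norm (d $ i))\<^sup>2)"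
    by (simp only: of_real_sum complex_norm_square)
  then show ?thesis unfolding wave_flux_def assms by (simp del: of_real_sum)
qed

text \<open>The sum of the two fluxes is \<open>\<i>\<close> times a real multiple of \<open>A cnj A' - A' cnj A\<close>, which is imaginary.\<close>

lemma wave_flux_in_out:
  fixes x y g :: real
  assumes K: "k $ 1 = of_real x" "k $ 2 = of_real y" "k $ 3 = of_real g"
    and K': "k' $ 1 = of_real x" "k' $ 2 = of_real y" "k' $ 3 = of_real (- g)"
    and d: "\<And>i. d $ i = A * k $ i" and d': "\<And>i. d' $ i = A' * k' $ i"
  shows "Im (wave_flux lam mu k d d' + wave_flux lam mu k' d' d) = 0"
proof -
  define R where "R = mu * g * (x\<^sup>2 + y\<^sup>2 - g\<^sup>2) - (lam + mu) * (x\<^sup>2 + y\<^sup>2 + g\<^sup>2) * g"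
  have "wave_flux lam mu k d d' + wave_flux lam mu k' d' d = \<i> * (of_real R * (A * cnj A' - A' * cnj A))"
    unfolding wave_flux_def R_def by (simp add: sum_3 d d' K K' power2_eq_square algebra_simps)
  then show ?thesis by (simp add: complex_eq_iff)
qed

definition transversal_polarization :: "complex^3 \<Rightarrow> complex^3 \<Rightarrow> complex^3" where
  "transversal_polarization k B = vector [\<i> * (k $ 2 * B $ 3 - k $ 3 * B $ 2),
     \<i> * (k $ 3 * B $ 1 - k $ 1 * B $ 3), \<i> * (k $ 1 * B $ 2 - k $ 2 * B $ 1)]"

lemma transversal_polarization_orthogonal:
  "(\<Sum>i\<in>UNIV. k $ i * transversal_polarization k B $ i) = 0"
  by (simp add: transversal_polarization_def sum_3 algebra_simps)

lemma norm_vec3_squared: "(norm (B::complex^3))\<^sup>2 = (\<Sum>i\<in>UNIV. (norm (B $ i))\<^sup>2)"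
  by (simp add: norm_vec_def L2_set_def sum_nonneg)

text \<open>Lagrange's identity for the vector product of a real vector and an orthogonal complex one.\<close>

lemma transversal_polarization_norm:
  assumes "(\<Sum>i\<in>UNIV. k $ i * B $ i) = 0" and re: "\<And>i. cnj (k $ i) = k $ i" and s: "(\<Sum>i\<in>UNIV. (k $ i)\<^sup>2) = of_real s"
  shows "(\<Sum>i\<in>UNIV. (norm (transversal_polarization k B $ i))\<^sup>2) = s * (norm B)\<^sup>2"
proof -
  have "complex_of_real (\<Sum>i\<in>UNIV. (norm (transversal_polarization k B $ i))\<^sup>2)
      = (\<Sum>i\<in>UNIV. (k $ i)\<^sup>2) * (\<Sum>i\<in>UNIV. B $ i * cnj (B $ i)) - (\<Sum>i\<in>UNIV. k $ i * B $ i) * (\<Sum>i\<in>UNIV. k $ i * cnj (B $ i))"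
    unfolding of_real_sum complex_norm_square
    by (simp add: transversal_polarization_def sum_3 re power2_eq_square algebra_simps)
  also have "\<dots> = of_real (s * (norm B)\<^sup>2)"
    unfolding assms(1) s norm_vec3_squared of_real_mult of_real_sum complex_norm_square by simp
  finally show ?thesis by (simp only: of_real_eq_iff)
qed

lemma wave_flux_zero [simp]: "wave_flux lam mu k 0 d = 0" "wave_flux lam mu k d 0 = 0"
  by (simp_all add: wave_flux_def)

lemma wave_flux_scale: "wave_flux lam mu k d d' * (c * cnj c') = wave_flux lam mu k (c *s d) (c' *s d')"
  by (simp add: wave_flux_def sum_3 algebra_simps)

text \<open>The nine fluxes between the three waves of a mode, with the scalar factors of the plane waves
  absorbed into the polarizations. A nonzero incident amplitude \<open>A0\<close> is allowed only if the incident wave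
  is the mirror image of the outgoing longitudinal one. The propagating waves have factors of modulus
  one, so that the result depends on the amplitudes alone.\<close>

lemma mode_flux:
  fixes x y b om :: real and k d :: "3 \<Rightarrow> complex^3" and P :: "3 \<Rightarrow> complex"
  assumes mat: "om\<^sup>2 = (lam + 2 * mu) * p" "om\<^sup>2 = mu * s"
    and k: "k 1 = vector [of_real x, of_real y, of_real (- b)]" "k 2 = vector [of_real x, of_real y, \<beta>1]"
      "k 3 = vector [of_real x, of_real y, \<beta>2]"
    and b1: "\<beta>1\<^sup>2 = of_real (p - x\<^sup>2 - y\<^sup>2)" "Im \<beta>1 = 0 \<or> Re \<beta>1 = 0"
    and b2: "\<beta>2\<^sup>2 = of_real (s - x\<^sup>2 - y\<^sup>2)" "Im \<beta>2 = 0 \<or> Re \<beta>2 = 0"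
    and d: "d 1 = A0 *s k 1" "d 2 = (\<i> * a) *s k 2" "d 3 = transversal_polarization (k 3) B"
    and inc: "A0 = 0 \<or> \<beta>1 = of_real b"
    and B: "(\<Sum>i\<in>UNIV. k 3 $ i * B $ i) = 0"
    and P: "norm (P 1) = 1" "Im \<beta>1 = 0 \<Longrightarrow> norm (P 2) = 1" "Im \<beta>2 = 0 \<Longrightarrow> norm (P 3) = 1"
  shows "Im (\<Sum>t\<in>UNIV. \<Sum>t'\<in>UNIV. wave_flux lam mu (k t) (d t) (d t') * (P t * cnj (P t')))
     = om\<^sup>2 * Re \<beta>1 * (norm a)\<^sup>2 + om\<^sup>2 * Re \<beta>2 * (norm B)\<^sup>2 - om\<^sup>2 * b * (norm A0)\<^sup>2"
proof -
  define D where "D t = P t *s d t" for t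
  define w where "w t t' = wave_flux lam mu (k t) (D t) (D t')" for t t'
  have D1: "D 1 $ i = (P 1 * A0) * k 1 $ i" and D2: "D 2 $ i = (P 2 * (\<i> * a)) * k 2 $ i" for i
    by (simp_all add: D_def d)
  have ps: "(lam + 2 * mu) * p = mu * s" using mat by simp
  have tr: "(\<Sum>i\<in>UNIV. k 3 $ i * D 3 $ i) = 0"
  proof -
    have "(\<Sum>i\<in>UNIV. k 3 $ i * D 3 $ i) = P 3 * (\<Sum>i\<in>UNIV. k 3 $ i * transversal_polarization (k 3) B $ i)"
      by (simp add: D_def d sum_3 algebra_simps)
    then show ?thesis by (simp add: transversal_polarization_orthogonal)
  qed
  have k1: "k 1 $ 1 = of_real x" "k 1 $ 2 = of_real y" "k 1 $ 3 = of_real (- b)"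
    and k2: "k 2 $ 1 = of_real x" "k 2 $ 2 = of_real y" "k 2 $ 3 = \<beta>1" "(k 2 $ 3)\<^sup>2 = of_real (p - x\<^sup>2 - y\<^sup>2)"
    and k3: "k 3 $ 1 = of_real x" "k 3 $ 2 = of_real y" "k 3 $ 3 = \<beta>2" "(k 3 $ 3)\<^sup>2 = of_real (s - x\<^sup>2 - y\<^sup>2)"
    using b1 b2 by (simp_all add: k)
  have k1sq: "(k 1 $ 3)\<^sup>2 = of_real (p - x\<^sup>2 - y\<^sup>2)" if "A0 \<noteq> 0"
    using inc that b1(1) by (simp add: k1)
  have w22: "Im (w 2 2) = om\<^sup>2 * Re \<beta>1 * (norm a)\<^sup>2"
  proof -
    have "Im (w 2 2) = om\<^sup>2 * Re \<beta>1 * (norm (P 2 * (\<i> * a)))\<^sup>2"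
      unfolding w_def using wave_flux_longitudinal_self[OF k2(1,2,4) D2] by (simp add: k2 mat)
    then show ?thesis using P(2) b1(2) by (auto simp: norm_mult)
  qed
  have w33: "Im (w 3 3) = om\<^sup>2 * Re \<beta>2 * (norm B)\<^sup>2"
  proof (cases "Re \<beta>2 = 0")
    case False
    then have im: "Im \<beta>2 = 0" using b2(2) by simp
    then have re: "cnj (k 3 $ i) = k 3 $ i" for i using exhaust_3[of i] by (auto simp: k3 complex_eq_iff)
    have sq: "(\<Sum>i\<in>UNIV. (k 3 $ i)\<^sup>2) = of_real s" using b2(1) by (simp add: sum_3 k3)
    have "Im (w 3 3) = mu * Re \<beta>2 * (\<Sum>i\<in>UNIV. (norm (D 3 $ i))\<^sup>2)"
      unfolding w_def using wave_flux_transversal_self[OF tr] by (simp add: k3)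
    also have "(\<Sum>i\<in>UNIV. (norm (D 3 $ i))\<^sup>2) = s * (norm B)\<^sup>2"
      using transversal_polarization_norm[OF B re sq] P(3)[OF im] by (simp add: D_def d norm_mult)
    finally show ?thesis using mat(2) by simp
  qed (use wave_flux_transversal_self[OF tr] in \<open>simp add: w_def k3\<close>)
  have w23: "Im (w 2 3 + w 3 2) = 0"
    unfolding w_def by (rule wave_flux_longitudinal_transversal[OF k2(1,2,4) k3(1,2,4) ps D2 tr])
  have w1: "Im (w 1 1) = - (om\<^sup>2 * b * (norm A0)\<^sup>2)" "Im (w 1 2 + w 2 1) = 0" "Im (w 1 3 + w 3 1) = 0"
  proof -
    show "Im (w 1 1) = - (om\<^sup>2 * b * (norm A0)\<^sup>2)"
    proof (cases "A0 = 0")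
      case False
      then show ?thesis unfolding w_def
        using wave_flux_longitudinal_self[OF k1(1,2) k1sq D1, of lam mu] P(1) by (simp add: k1 mat norm_mult)
    qed (simp add: w_def D_def d)
    show "Im (w 1 2 + w 2 1) = 0"
    proof (cases "A0 = 0")
      case False
      then have "k 2 $ 3 = of_real b" using inc by (simp add: k2)
      from wave_flux_in_out[OF k2(1,2) this k1(1,2,3) D2 D1] show ?thesis
        unfolding w_def by (simp add: add.commute)
    qed (simp add: w_def D_def d)
    show "Im (w 1 3 + w 3 1) = 0"
    proof (cases "A0 = 0")
      case False
      from wave_flux_longitudinal_transversal[OF k1(1,2) k1sq[OF False] k3(1,2,4) ps D1 tr] show ?thesis
        unfolding w_def .
    qed (simp add: w_def D_def d)
  qed
  have "(\<Sum>t\<in>UNIV. \<Sum>t'\<in>UNIV. wave_flux lam mu (k t) (d t) (d t') * (P t * cnj (P t'))) = (\<Sum>t\<in>UNIV. \<Sum>t'\<in>UNIV. w t t')"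
    unfolding w_def D_def wave_flux_scale by (rule refl)
  then show ?thesis using w22 w33 w23 w1 by (simp add: sum_3)
qed

lemma energy_flux_wave_sum:
  assumes v: "\<And>i. v $ i = (\<Sum>s\<in>S. d s $ i * P s)"
    and H: "\<And>i j. H $ i $ j = (\<Sum>s\<in>S. \<i> * k s $ j * d s $ i * P s)"
  shows "energy_flux lam mu v H 3 = (\<Sum>s\<in>S. \<Sum>t\<in>S. wave_flux lam mu (k s) (d s) (d t) * (P s * cnj (P t)))"
proof -
  have hv: "H $ i $ j * cnj (v $ l) = (\<Sum>s\<in>S. \<Sum>t\<in>S. (\<i> * k s $ j * d s $ i * P s) * (cnj (d t $ l) * cnj (P t)))" for i j l
    by (simp add: v H sum_product)
  have "energy_flux lam mu v H 3 = of_real mu * (H $ 1 $ 3 * cnj (v $ 1)) + of_real mu * (H $ 2 $ 3 * cnj (v $ 2))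
      + of_real mu * (H $ 3 $ 3 * cnj (v $ 3)) + of_real (lam + mu) * (H $ 1 $ 1 * cnj (v $ 3))
      + of_real (lam + mu) * (H $ 2 $ 2 * cnj (v $ 3)) + of_real (lam + mu) * (H $ 3 $ 3 * cnj (v $ 3))"
    by (simp add: energy_flux_def sum_3 algebra_simps)
  also have "\<dots> = (\<Sum>s\<in>S. \<Sum>t\<in>S. wave_flux lam mu (k s) (d s) (d t) * (P s * cnj (P t)))"
    unfolding hv sum_distrib_left sum.distrib[symmetric]
    by (intro sum.cong refl) (simp add: wave_flux_def sum_3 algebra_simps)
  finally show ?thesis .
qed

text \<open>The mode \<open>(0, 0)\<close> belongs to every truncation, because the incident wave is counted in that mode.\<close>

definition modes :: "nat \<Rightarrow> (int \<times> int) set" where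
  "modes N = insert (0, 0) (from_nat_into UNIV ` {..<N})"

lemma finite_modes: "finite (modes N)" by (simp add: modes_def)

lemma infinite_modes: "infinite (UNIV :: (int \<times> int) set)"
  by (simp add: finite_prod infinite_UNIV_int)

lemma modes_exhaust: "filterlim modes (finite_subsets_at_top UNIV) sequentially"
  unfolding filterlim_finite_subsets_at_top
proof (intro allI impI)
  fix X :: "(int \<times> int) set" assume X: "finite X \<and> X \<subseteq> UNIV"
  have ev: "\<forall>\<^sub>F N in sequentially. n \<in> modes N" for n
  proof -
    have "n \<in> range (from_nat_into UNIV)" using range_from_nat_into[of "UNIV :: (int \<times> int) set"] by simp
    then obtain i where "n = from_nat_into UNIV i" by blast
    then show ?thesis unfolding eventually_sequentially modes_def by (intro exI[of _ "Suc i"]) auto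
  qed
  have "\<forall>\<^sub>F N in sequentially. \<forall>n\<in>X. n \<in> modes N"
    using X ev by (simp add: eventually_ball_finite)
  then show "\<forall>\<^sub>F N in sequentially. finite (modes N) \<and> X \<subseteq> modes N \<and> modes N \<subseteq> UNIV"
    by eventually_elim (auto simp: finite_modes)
qed

lemma wave_series_tendsto:
  assumes "outgoing K" "decays h K a" "x \<in> half_space h"
  shows "(\<lambda>N. \<Sum>n\<in>modes N. a n * plane_wave (K n) x) \<longlonglongrightarrow> wave_series K a x"
  using filterlim_compose[OF wave_series_has_sum[OF assms, unfolded has_sum_def] modes_exhaust] .

lemma wave_sum_bounded:
  assumes K: "outgoing K" and a: "decays h K a"
  obtains M where "0 \<le> M" "\<And>N x. h + 1 \<le> x $ 3 \<Longrightarrow> norm (\<Sum>n\<in>modes N. a n * plane_wave (K n) x) \<le> M"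
proof -
  define F where "F n = norm (a n) * exp (- (Im (K n $ 3) * (h + 1)))" for n
  have F: "F summable_on UNIV" using a unfolding decays_def F_def by simp
  have nn: "0 \<le> F n" for n by (simp add: F_def)
  have "norm (\<Sum>n\<in>modes N. a n * plane_wave (K n) x) \<le> infsum F UNIV" if "h + 1 \<le> x $ 3" for N x
  proof -
    have "norm (\<Sum>n\<in>modes N. a n * plane_wave (K n) x) \<le> (\<Sum>n\<in>modes N. F n)"
      unfolding F_def by (intro sum_norm_le norm_wave_term_le[OF K that])
    also have "\<dots> \<le> infsum F UNIV"
      by (intro finite_sum_le_infsum F finite_modes nn) auto
    finally show ?thesis .
  qed
  then show thesis by (intro that[of "infsum F UNIV"] infsum_nonneg nn)
qed

lemma outgoing_horizontal: "outgoing K \<Longrightarrow> j \<noteq> 3 \<Longrightarrow> Im (K n $ j) = 0"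
  using exhaust_3[of j] by (auto simp: outgoing_def)

context cutoffs begin

text \<open>The flux is sesquilinear, so it is a double sum over pairs of waves, and by orthogonality only
  the pairs within one mode survive the integration.\<close>

lemma integral_flux_mode_sum:
  fixes k d :: "(int \<times> int) \<times> 3 \<Rightarrow> complex^3"
  assumes A: "finite A"
    and re: "\<And>s j. j \<noteq> 3 \<Longrightarrow> Im (k s $ j) = 0"
    and lat: "\<And>n m t t'. n \<noteq> m \<Longrightarrow> lattice_shift L1 L2 (k (n, t)) (k (m, t'))"
    and E: "\<And>n x. n \<in> A \<Longrightarrow> Im (\<Sum>t\<in>UNIV. \<Sum>t'\<in>UNIV. wave_flux lam mu (k (n, t)) (d (n, t)) (d (n, t'))
         * (plane_wave (k (n, t)) x * cnj (plane_wave (k (n, t')) x))) = E n"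
  defines "v \<equiv> \<lambda>x. \<chi> i. \<Sum>s\<in>A \<times> UNIV. d s $ i * plane_wave (k s) x"
    and "H \<equiv> \<lambda>x. \<chi> i j. \<Sum>s\<in>A \<times> UNIV. \<i> * k s $ j * d s $ i * plane_wave (k s) x"
  shows "Im (\<integral>x. of_real (\<rho> x) * energy_flux lam mu (v x) (H x) 3 \<partial>lebesgue) = (\<Sum>n\<in>A. E n) * (\<integral>x. \<rho> x \<partial>lebesgue)"
proof -
  define T where "T s t x = wave_flux lam mu (k s) (d s) (d t) * (plane_wave (k s) x * cnj (plane_wave (k t) x))" for s t x
  define Di where "Di x = (\<Sum>n\<in>A. \<Sum>t\<in>UNIV. \<Sum>t'\<in>UNIV. T (n, t) (n, t') x)" for x
  define Of where "Of x = (\<Sum>n\<in>A. \<Sum>m\<in>A - {n}. \<Sum>t\<in>UNIV. \<Sum>t'\<in>UNIV. T (n, t) (m, t') x)" for x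
  have Tc: "continuous_on UNIV (T s t)" for s t
    unfolding T_def[abs_def] by (intro continuous_intros plane_wave_cont)
  have Ti: "integrable lebesgue (\<lambda>x. of_real (\<rho> x) * T s t x)" for s t
    by (rule integrable_rho_mult[OF Tc])
  have split: "energy_flux lam mu (v x) (H x) 3 = Di x + Of x" for x
  proof -
    have "energy_flux lam mu (v x) (H x) 3 = (\<Sum>s\<in>A \<times> UNIV. \<Sum>t\<in>A \<times> UNIV. T s t x)"
      unfolding T_def by (rule energy_flux_wave_sum) (simp_all add: v_def H_def)
    also have "\<dots> = (\<Sum>n\<in>A. \<Sum>t\<in>UNIV. \<Sum>m\<in>A. \<Sum>t'\<in>UNIV. T (n, t) (m, t') x)"
      by (simp add: sum.cartesian_product')
    also have "\<dots> = (\<Sum>n\<in>A. \<Sum>m\<in>A. \<Sum>t\<in>UNIV. \<Sum>t'\<in>UNIV. T (n, t) (m, t') x)"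
      by (intro sum.cong refl sum.swap)
    also have "\<dots> = Di x + Of x"
      unfolding Di_def Of_def sum.distrib[symmetric] by (intro sum.cong refl sum.remove A)
    finally show ?thesis .
  qed
  have Dc: "continuous_on UNIV Di" "continuous_on UNIV Of"
    unfolding Di_def[abs_def] Of_def[abs_def] by (intro continuous_intros Tc)+
  have O0: "(\<integral>x. of_real (\<rho> x) * Of x \<partial>lebesgue) = 0"
  proof -
    have T0: "(\<integral>x. of_real (\<rho> x) * T (n, t) (m, t') x \<partial>lebesgue) = 0" if "n \<noteq> m" for n m t t'
    proof -
      have "(\<integral>x. of_real (\<rho> x) * T (n, t) (m, t') x \<partial>lebesgue)
        = wave_flux lam mu (k (n, t)) (d (n, t)) (d (m, t')) *
          (\<integral>x. of_real (\<rho> x) * (plane_wave (k (n, t)) x * cnj (plane_wave (k (m, t')) x)) \<partial>lebesgue)"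
        unfolding T_def by (simp only: mult.left_commute[of "of_real _" "wave_flux _ _ _ _ _"] integral_mult_right_zero)
      also have "\<dots> = 0" using plane_waves_orthogonal[OF _ lat[OF that, of t t']] re by simp
      finally show ?thesis .
    qed
    have "(\<integral>x. of_real (\<rho> x) * Of x \<partial>lebesgue)
       = (\<integral>x. (\<Sum>n\<in>A. \<Sum>m\<in>A - {n}. \<Sum>t\<in>UNIV. \<Sum>t'\<in>UNIV. of_real (\<rho> x) * T (n, t) (m, t') x) \<partial>lebesgue)"
      by (simp add: Of_def sum_distrib_left)
    also have "\<dots> = (\<Sum>n\<in>A. \<Sum>m\<in>A - {n}. \<Sum>t\<in>UNIV. \<Sum>t'\<in>UNIV. \<integral>x. of_real (\<rho> x) * T (n, t) (m, t') x \<partial>lebesgue)"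
      by (simp add: Ti)
    also have "\<dots> = 0" by (intro sum.neutral ballI) (auto intro: T0)
    finally show ?thesis .
  qed
  have "(\<integral>x. of_real (\<rho> x) * energy_flux lam mu (v x) (H x) 3 \<partial>lebesgue) = (\<integral>x. of_real (\<rho> x) * Di x \<partial>lebesgue)"
    unfolding split distrib_left using integrable_rho_mult[OF Dc(1)] integrable_rho_mult[OF Dc(2)] O0 by simp
  moreover have "Im (\<integral>x. of_real (\<rho> x) * Di x \<partial>lebesgue) = (\<integral>x. Im (of_real (\<rho> x) * Di x) \<partial>lebesgue)"
    using integral_Im[OF integrable_rho_mult[OF Dc(1)]] by simp
  moreover have "Im (of_real (\<rho> x) * Di x) = \<rho> x * (\<Sum>n\<in>A. E n)" for x
    using E by (simp add: Di_def T_def)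
  ultimately have "Im (\<integral>x. of_real (\<rho> x) * energy_flux lam mu (v x) (H x) 3 \<partial>lebesgue)
      = (\<integral>x. \<rho> x * (\<Sum>n\<in>A. E n) \<partial>lebesgue)" by (simp only:)
  then show ?thesis unfolding integral_mult_left_zero by (simp only: mult.commute)
qed

text \<open>Uniqueness of Fourier coefficients: the integral of the series against \<open>\<rho> * cnj (plane_wave (K m))\<close> is
  a positive multiple of \<open>g m\<close> by orthogonality.\<close>

lemma wave_series_eq_0:
  fixes K :: "int \<times> int \<Rightarrow> complex^3"
  assumes K: "outgoing K" and g: "decays h K g" and zero: "\<And>x. x \<in> half_space h \<Longrightarrow> wave_series K g x = 0"
    and lat: "\<And>n m. n \<noteq> m \<Longrightarrow> lattice_shift L1 L2 (K n) (K m)"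
  shows "g m = 0"
proof -
  define \<Phi> where "\<Phi> N x = (\<Sum>n\<in>modes N. g n * plane_wave (K n) x) * cnj (plane_wave (K m) x)" for N x
  have re: "Im (K n $ j) = 0" if "j \<noteq> 3" for n j by (rule outgoing_horizontal[OF K that])
  obtain M where M: "0 \<le> M" "\<And>N x. h + 1 \<le> x $ 3 \<Longrightarrow> norm (\<Sum>n\<in>modes N. g n * plane_wave (K n) x) \<le> M"
    by (rule wave_sum_bounded[OF K g]) blast
  define Y where "Y = (\<integral>x. \<rho> x * (norm (plane_wave (K m) x))\<^sup>2 \<partial>lebesgue)"
  have Y: "0 < Y" unfolding Y_def
    by (rule integral_rho_pos) (auto simp: plane_wave_def intro!: continuous_intros plane_wave_cont[unfolded plane_wave_def[abs_def]])
  have "(\<lambda>N. \<integral>x. of_real (\<rho> x) * \<Phi> N x \<partial>lebesgue) \<longlonglongrightarrow> (\<integral>x. of_real (\<rho> x) * 0 \<partial>lebesgue)"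
  proof (rule integral_rho_tendsto)
    show "continuous_on UNIV (\<Phi> N)" for N unfolding \<Phi>_def[abs_def] by (intro continuous_intros plane_wave_cont)
    show "(\<lambda>N. \<Phi> N x) \<longlonglongrightarrow> 0" if "x \<in> half_space h" for x
      using tendsto_mult[OF wave_series_tendsto[OF K g that] tendsto_const[of "cnj (plane_wave (K m) x)"]]
      by (simp add: \<Phi>_def zero[OF that])
    show "norm (\<Phi> N x) \<le> M * exp (- (Im (K m $ 3) * (h + 1)))" if "h + 1 \<le> x $ 3" for N x
      unfolding \<Phi>_def norm_mult complex_mod_cnj
      using norm_wave_term_le[OF K that, of "\<lambda>_. 1" m] by (intro mult_mono M that) auto
  qed simp
  moreover have "\<forall>\<^sub>F N in sequentially. (\<integral>x. of_real (\<rho> x) * \<Phi> N x \<partial>lebesgue) = g m * of_real Y"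
  proof -
    have "\<forall>\<^sub>F N in sequentially. {m} \<subseteq> modes N"
      using modes_exhaust unfolding filterlim_finite_subsets_at_top by (auto elim!: allE[of _ "{m}"] eventually_mono)
    then show ?thesis
    proof eventually_elim
      case (elim N)
      define J where "J n = (\<integral>x. of_real (\<rho> x) * (plane_wave (K n) x * cnj (plane_wave (K m) x)) \<partial>lebesgue)" for n
      have i: "integrable lebesgue (\<lambda>x. of_real (\<rho> x) * (plane_wave (K n) x * cnj (plane_wave (K m) x)))" for n
        by (intro integrable_rho_mult continuous_intros plane_wave_cont)
      have "(\<integral>x. of_real (\<rho> x) * \<Phi> N x \<partial>lebesgue)
        = (\<integral>x. (\<Sum>n\<in>modes N. g n * (of_real (\<rho> x) * (plane_wave (K n) x * cnj (plane_wave (K m) x)))) \<partial>lebesgue)"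
        unfolding \<Phi>_def sum_distrib_left sum_distrib_right
        by (intro Bochner_Integration.integral_cong refl sum.cong) (simp only: mult_ac)
      also have "\<dots> = (\<Sum>n\<in>modes N. g n * J n)"
        unfolding J_def using i by simp
      also have "\<dots> = (\<Sum>n\<in>{m}. g n * J n)"
      proof (rule sum.mono_neutral_right[OF finite_modes elim])
        show "\<forall>n\<in>modes N - {m}. g n * J n = 0"
          unfolding J_def using plane_waves_orthogonal re lat by auto
      qed
      finally have "(\<integral>x. of_real (\<rho> x) * \<Phi> N x \<partial>lebesgue) = g m * J m" by simp
      moreover have "J m = of_real Y"
      proof -
        have "of_real (\<rho> x) * (plane_wave (K m) x * cnj (plane_wave (K m) x)) = of_real (\<rho> x * (norm (plane_wave (K m) x))\<^sup>2)" for x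
          unfolding of_real_mult complex_norm_square by (rule refl)
        then show ?thesis unfolding J_def Y_def by (simp only: integral_complex_of_real)
      qed
      ultimately show ?case by simp
    qed
  qed
  ultimately have "(\<lambda>N::nat. g m * of_real Y) \<longlonglongrightarrow> (0::complex)"
    by (simp add: tendsto_cong)
  then show ?thesis using Y by (simp add: LIMSEQ_const_iff)
qed

end

section \<open>The plane waves of the scattering problem\<close>

lemma alpha_n_nth:
  "alpha_n L1 L2 al n $ 1 = al $ 1 + 2 * pi * of_int (fst n) / L1"
  "alpha_n L1 L2 al n $ 2 = al $ 2 + 2 * pi * of_int (snd n) / L2"
  by (simp_all add: alpha_n_def)

lemma finite_propagating:
  assumes "0 < L1" "0 < L2"
  shows "finite {n. norm (alpha_n L1 L2 al n) \<le> k}"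
proof -
  have fin: "finite {i::int. \<bar>a + 2 * pi * of_int i / L\<bar> \<le> k}" if "0 < L" for a L :: real
  proof (rule finite_subset)
    define c where "c = (k + \<bar>a\<bar>) * L / (2 * pi)"
    show "{i::int. \<bar>a + 2 * pi * of_int i / L\<bar> \<le> k} \<subseteq> {- \<lceil>c\<rceil>..\<lceil>c\<rceil>}"
    proof
      fix i :: int assume "i \<in> {i::int. \<bar>a + 2 * pi * of_int i / L\<bar> \<le> k}"
      then have "\<bar>2 * pi * of_int i / L\<bar> \<le> k + \<bar>a\<bar>" by simp
      then have "\<bar>of_int i\<bar> * (2 * pi) / L \<le> k + \<bar>a\<bar>" using that by (simp add: abs_mult mult_ac)
      then have "\<bar>of_int i\<bar> \<le> c" using that unfolding c_def by (simp add: field_simps)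
      then have "of_int i \<le> c" "- of_int i \<le> c" by linarith+
      then have "i \<le> \<lceil>c\<rceil>" "- i \<le> \<lceil>c\<rceil>" by (simp_all add: le_ceiling_iff)
      then show "i \<in> {- \<lceil>c\<rceil>..\<lceil>c\<rceil>}" by simp
    qed
  qed simp
  have "{n. norm (alpha_n L1 L2 al n) \<le> k}
      \<subseteq> {i. \<bar>al $ 1 + 2 * pi * of_int i / L1\<bar> \<le> k} \<times> {i. \<bar>al $ 2 + 2 * pi * of_int i / L2\<bar> \<le> k}"
  proof
    fix n assume "n \<in> {n. norm (alpha_n L1 L2 al n) \<le> k}"
    then have "\<bar>alpha_n L1 L2 al n $ 1\<bar> \<le> k" "\<bar>alpha_n L1 L2 al n $ 2\<bar> \<le> k"
      using component_le_norm_cart[of "alpha_n L1 L2 al n" 1] component_le_norm_cart[of "alpha_n L1 L2 al n" 2]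
      by simp_all
    then show "n \<in> {i. \<bar>al $ 1 + 2 * pi * of_int i / L1\<bar> \<le> k} \<times> {i. \<bar>al $ 2 + 2 * pi * of_int i / L2\<bar> \<le> k}"
      unfolding alpha_n_nth mem_Times_iff mem_Collect_eq by (rule conjI)
  qed
  then show ?thesis using fin[OF assms(1)] fin[OF assms(2)] by (meson finite_SigmaI finite_subset)
qed

lemma norm_alpha_squared: "(norm (alpha_n L1 L2 al n))\<^sup>2 = (alpha_n L1 L2 al n $ 1)\<^sup>2 + (alpha_n L1 L2 al n $ 2)\<^sup>2"
  by (simp add: norm_vec_def L2_set_def sum_2)

lemma wave_vector_nth:
  "wave_vector L1 L2 al k n $ 1 = of_real (alpha_n L1 L2 al n $ 1)"
  "wave_vector L1 L2 al k n $ 2 = of_real (alpha_n L1 L2 al n $ 2)"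
  "wave_vector L1 L2 al k n $ 3 = beta_n L1 L2 al k n"
  by (simp_all add: wave_vector_def)

lemma lattice_shiftI:
  assumes L: "0 < L1" "0 < L2" and "n \<noteq> m"
    and "K $ 1 = of_real (alpha_n L1 L2 al n $ 1)" "K $ 2 = of_real (alpha_n L1 L2 al n $ 2)"
    and "K' $ 1 = of_real (alpha_n L1 L2 al m $ 1)" "K' $ 2 = of_real (alpha_n L1 L2 al m $ 2)"
  shows "lattice_shift L1 L2 K K'"
  unfolding lattice_shift_def
proof (intro exI conjI)
  show "K $ 1 - K' $ 1 = of_real (2 * pi * of_int (fst n - fst m) / L1)"
    "K $ 2 - K' $ 2 = of_real (2 * pi * of_int (snd n - snd m) / L2)"
    unfolding assms(4-7) alpha_n_nth of_real_diff[symmetric] of_real_eq_iff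
    by (simp_all add: diff_divide_distrib right_diff_distrib)
  show "fst n - fst m \<noteq> 0 \<or> snd n - snd m \<noteq> 0" using \<open>n \<noteq> m\<close> by (auto simp: prod_eq_iff)
qed

lemma beta_n_real_or_imaginary: "Im (beta_n L1 L2 al k n) = 0 \<or> Re (beta_n L1 L2 al k n) = 0"
  by (simp add: beta_n_def)

lemma wave_series_add:
  assumes "outgoing K" "decays h K a" "decays h K b" "x \<in> half_space h"
  shows "wave_series K a x + wave_series K b x = wave_series K (\<lambda>n. a n + b n) x"
    and "wave_series K a x - wave_series K b x = wave_series K (\<lambda>n. a n - b n) x"
    and "decays h K (\<lambda>n. a n + b n)" "decays h K (\<lambda>n. a n - b n)"
proof -
  note s = wave_series_has_sum[OF assms(1,2,4)] wave_series_has_sum[OF assms(1,3,4)]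
  show "wave_series K a x + wave_series K b x = wave_series K (\<lambda>n. a n + b n) x"
    using infsumI[OF has_sum_add[OF s]] by (simp add: wave_series_def algebra_simps)
  show "wave_series K a x - wave_series K b x = wave_series K (\<lambda>n. a n - b n) x"
    using infsumI[OF has_sum_add[OF s(1) has_sum_uminusI[OF s(2)]]]
    by (simp add: wave_series_def algebra_simps)
  have d: "decays h K (\<lambda>n. c n)" if "\<And>n. norm (c n) \<le> norm (a n) + norm (b n)" for c
    unfolding decays_def
  proof (intro allI impI)
    fix z assume "h < z"
    then have "(\<lambda>n. norm (a n) * exp (- (Im (K n $ 3) * z)) + norm (b n) * exp (- (Im (K n $ 3) * z))) summable_on UNIV"
      using assms(2,3) by (intro summable_on_add) (auto simp: decays_def)
    then show "(\<lambda>n. norm (c n) * exp (- (Im (K n $ 3) * z))) summable_on UNIV"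
    proof (rule summable_on_comparison_test)
      fix n
      show "norm (c n) * exp (- (Im (K n $ 3) * z)) \<le> norm (a n) * exp (- (Im (K n $ 3) * z)) + norm (b n) * exp (- (Im (K n $ 3) * z))"
        using that[of n] by (simp flip: distrib_right)
    qed auto
  qed
  show "decays h K (\<lambda>n. a n + b n)" by (rule d) (rule norm_triangle_ineq)
  show "decays h K (\<lambda>n. a n - b n)" by (rule d) (rule norm_triangle_ineq4)
qed

text \<open>The total field above the surface as an incident wave \<open>A0 Ki exp(\<i> Ki \<bullet> x)\<close> plus the gradient of a
  series of longitudinal waves plus the curl of a series of transversal ones.\<close>

locale rayleigh_field =
  fixes L1 L2 h k1 k2 :: real and al :: "real^2" and Ki :: "complex^3" and A0 :: complex
    and u :: "real^3 \<Rightarrow> complex^3" and a :: "int \<times> int \<Rightarrow> complex" and B :: "int \<times> int \<Rightarrow> complex^3"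
  assumes k: "0 \<le> k1" "0 \<le> k2"
    and Ki: "\<And>j. Im (Ki $ j) = 0"
    and a: "decays h (wave_vector L1 L2 al k1) a"
    and B: "\<And>i. decays h (wave_vector L1 L2 al k2) (\<lambda>n. B n $ i)"
    and u: "\<And>x i. x \<in> half_space h \<Longrightarrow> u x $ i = A0 * Ki $ i * plane_wave Ki x
       + wave_series (wave_vector L1 L2 al k1) (\<lambda>n. \<i> * wave_vector L1 L2 al k1 n $ i * a n) x
       + wave_series (wave_vector L1 L2 al k2) (\<lambda>n. transversal_polarization (wave_vector L1 L2 al k2 n) (B n) $ i) x"
begin

abbreviation "K1 \<equiv> wave_vector L1 L2 al k1"
abbreviation "K2 \<equiv> wave_vector L1 L2 al k2"

definition c1 where "c1 i n = \<i> * K1 n $ i * a n"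
definition c2 where "c2 i n = transversal_polarization (K2 n) (B n) $ i"

lemma outgoing_K: "outgoing K1" "outgoing K2"
  using outgoing_wave_vector k by blast+

lemma c_decays: "decays h K1 (c1 i)" "decays h K2 (c2 i)"
proof -
  show "decays h K1 (c1 i)" unfolding c1_def by (rule decays_gradient[OF outgoing_K(1) a])
  have g: "decays h K2 (\<lambda>n. \<i> * K2 n $ j * B n $ l)" for j l by (rule decays_gradient[OF outgoing_K(2) B])
  have x: "vector [0, 0, h + 1] \<in> half_space h" by (simp add: half_space_def)
  show "decays h K2 (c2 i)"
    using exhaust_3[of i] wave_series_add(4)[OF outgoing_K(2) g g x]
    by (auto simp: c2_def[abs_def] transversal_polarization_def right_diff_distrib mult.assoc)
qed

lemma u_eq: "x \<in> half_space h \<Longrightarrow> u x $ i = A0 * Ki $ i * plane_wave Ki x + wave_series K1 (c1 i) x + wave_series K2 (c2 i) x"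
  using u unfolding c1_def c2_def .

lemma u_nth_C1: "C1_on (half_space h) (\<lambda>x. u x $ i)"
  and partial_u_nth: "x \<in> half_space h \<Longrightarrow> partial j (\<lambda>x. u x $ i) x = \<i> * Ki $ j * (A0 * Ki $ i) * plane_wave Ki x
      + wave_series K1 (\<lambda>n. \<i> * K1 n $ j * c1 i n) x + wave_series K2 (\<lambda>n. \<i> * K2 n $ j * c2 i n) x"
proof -
  note I = C1_on_bounded_linear[OF bounded_linear_mult_right plane_wave_C1]
  note W = C1_on_wave_series[OF infinite_modes outgoing_K(1) c_decays(1)[of i]]
    C1_on_wave_series[OF infinite_modes outgoing_K(2) c_decays(2)[of i]]
  note IW = C1_on_add[OF I(1) W(1)]
  note C = C1_on_add[OF IW(1) W(2)]
  show "C1_on (half_space h) (\<lambda>x. u x $ i)"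
    by (rule C1_on_cong_open[OF open_half_space u_eq C(1)])
  show "partial j (\<lambda>x. u x $ i) x = \<i> * Ki $ j * (A0 * Ki $ i) * plane_wave Ki x
      + wave_series K1 (\<lambda>n. \<i> * K1 n $ j * c1 i n) x + wave_series K2 (\<lambda>n. \<i> * K2 n $ j * c2 i n) x"
    if x: "x \<in> half_space h"
  proof -
    have "partial j (\<lambda>x. u x $ i) x
        = partial j (\<lambda>x. A0 * Ki $ i * plane_wave Ki x + wave_series K1 (c1 i) x + wave_series K2 (c2 i) x) x"
      by (rule partial_cong_open[OF open_half_space x u_eq])
    then show ?thesis
    by (simp add: C(2)[OF x] IW(2)[OF x] I(2)[OF x] partial_plane_wave partial_wave_series[OF infinite_modes outgoing_K(1) c_decays(1) x]
        partial_wave_series[OF infinite_modes outgoing_K(2) c_decays(2) x])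
  qed
qed

lemma u_has_derivative:
  assumes "x \<in> half_space h"
  shows "(u has_derivative (\<lambda>v. \<chi> i. frechet_derivative (\<lambda>x. u x $ i) (at x) v)) (at x)"
proof -
  have "((\<lambda>x. u x \<bullet> b) has_derivative (\<lambda>v. (\<chi> i. frechet_derivative (\<lambda>x. u x $ i) (at x) v) \<bullet> b)) (at x)" if b: "b \<in> Basis" for b
  proof -
    obtain i e where "b = axis i e" using b unfolding Basis_vec_def by blast
    then show ?thesis
      using has_derivative_inner_left[OF C1_onD[OF u_nth_C1[of i] assms], of e] by (simp add: inner_axis)
  qed
  then show ?thesis by (subst has_derivative_componentwise_within) auto
qed

lemma u_C1: "C1_on (half_space h) u"
  and jacobian_u: "x \<in> half_space h \<Longrightarrow> jacobian u x $ i $ j = \<i> * Ki $ j * (A0 * Ki $ i) * plane_wave Ki x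
      + wave_series K1 (\<lambda>n. \<i> * K1 n $ j * c1 i n) x + wave_series K2 (\<lambda>n. \<i> * K2 n $ j * c2 i n) x"
proof -
  show "C1_on (half_space h) u"
    by (rule C1_onI[OF u_has_derivative])
       (use u_nth_C1 in \<open>auto simp: C1_on_def partial_def[abs_def] intro!: continuous_on_vec_lambda\<close>)
  show "x \<in> half_space h \<Longrightarrow> jacobian u x $ i $ j = \<i> * Ki $ j * (A0 * Ki $ i) * plane_wave Ki x
      + wave_series K1 (\<lambda>n. \<i> * K1 n $ j * c1 i n) x + wave_series K2 (\<lambda>n. \<i> * K2 n $ j * c2 i n) x"
    using partial_eqI[OF u_has_derivative] partial_u_nth[of x j i] by (simp add: jacobian_def partial_def)
qed

text \<open>Every mode carries three waves: the incident one (1), the longitudinal one (2) and the transversal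
  one (3). Only the mode \<open>(0, 0)\<close> has an incident wave; elsewhere its polarization is zero, and its
  wave vector is chosen so that all three have the same horizontal part.\<close>

definition wk :: "(int \<times> int) \<times> 3 \<Rightarrow> complex^3" where
  "wk s = (if snd s = 1 then vector [K1 (fst s) $ 1, K1 (fst s) $ 2, Ki $ 3]
     else if snd s = 2 then K1 (fst s) else K2 (fst s))"

definition wd :: "(int \<times> int) \<times> 3 \<Rightarrow> complex^3" where
  "wd s = (if snd s = 1 then (if fst s = (0, 0) then A0 else 0) *s wk s
     else if snd s = 2 then (\<i> * a (fst s)) *s wk s else transversal_polarization (wk s) (B (fst s)))"

definition uN :: "nat \<Rightarrow> real^3 \<Rightarrow> complex^3" where
  "uN N x = (\<chi> i. \<Sum>s\<in>modes N \<times> UNIV. wd s $ i * plane_wave (wk s) x)"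

definition JN :: "nat \<Rightarrow> real^3 \<Rightarrow> complex^3^3" where
  "JN N x = (\<chi> i j. \<Sum>s\<in>modes N \<times> UNIV. \<i> * wk s $ j * wd s $ i * plane_wave (wk s) x)"

lemma wave_sum_split:
  assumes K0: "vector [K1 (0, 0) $ 1, K1 (0, 0) $ 2, Ki $ 3] = Ki"
  shows "uN N x $ i = A0 * Ki $ i * plane_wave Ki x + (\<Sum>n\<in>modes N. c1 i n * plane_wave (K1 n) x)
       + (\<Sum>n\<in>modes N. c2 i n * plane_wave (K2 n) x)"
    and "JN N x $ i $ j = \<i> * Ki $ j * (A0 * Ki $ i) * plane_wave Ki x
       + (\<Sum>n\<in>modes N. \<i> * K1 n $ j * c1 i n * plane_wave (K1 n) x)
       + (\<Sum>n\<in>modes N. \<i> * K2 n $ j * c2 i n * plane_wave (K2 n) x)"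
proof -
  have z: "(\<Sum>n\<in>modes N. F n) = F (0, 0)" if "\<And>n. n \<noteq> (0, 0) \<Longrightarrow> F n = 0" for F :: "int \<times> int \<Rightarrow> complex"
  proof -
    have "(\<Sum>n\<in>modes N. F n) = (\<Sum>n\<in>{(0, 0)}. F n)"
      by (rule sum.mono_neutral_right) (auto simp: finite_modes that modes_def)
    then show ?thesis by simp
  qed
  have e: "(\<Sum>s\<in>modes N \<times> UNIV. F s) = (\<Sum>n\<in>modes N. F (n, 1)) + (\<Sum>n\<in>modes N. F (n, 2)) + (\<Sum>n\<in>modes N. F (n, 3))"
    for F :: "(int \<times> int) \<times> 3 \<Rightarrow> complex"
    by (simp add: sum.cartesian_product' sum_3 sum.distrib)
  show "uN N x $ i = A0 * Ki $ i * plane_wave Ki x + (\<Sum>n\<in>modes N. c1 i n * plane_wave (K1 n) x)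
       + (\<Sum>n\<in>modes N. c2 i n * plane_wave (K2 n) x)"
    unfolding uN_def vec_lambda_beta e
    by (subst z) (auto simp: wd_def wk_def K0 c1_def c2_def mult_ac)
  show "JN N x $ i $ j = \<i> * Ki $ j * (A0 * Ki $ i) * plane_wave Ki x
       + (\<Sum>n\<in>modes N. \<i> * K1 n $ j * c1 i n * plane_wave (K1 n) x)
       + (\<Sum>n\<in>modes N. \<i> * K2 n $ j * c2 i n * plane_wave (K2 n) x)"
    unfolding JN_def vec_lambda_beta e
    by (subst z) (auto simp: wd_def wk_def K0 c1_def c2_def mult_ac)
qed

lemma truncation_tendsto:
  assumes K0: "vector [K1 (0, 0) $ 1, K1 (0, 0) $ 2, Ki $ 3] = Ki" and x: "x \<in> half_space h"
  shows "(\<lambda>N. energy_flux lam mu (uN N x) (JN N x) 3) \<longlonglongrightarrow> energy_flux lam mu (u x) (jacobian u x) 3"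
proof -
  have 1: "(\<lambda>N. uN N x $ i) \<longlonglongrightarrow> u x $ i" for i
    unfolding wave_sum_split[OF K0] u_eq[OF x]
    by (intro tendsto_add tendsto_const wave_series_tendsto[OF outgoing_K(1) c_decays(1) x]
        wave_series_tendsto[OF outgoing_K(2) c_decays(2) x])
  have 2: "(\<lambda>N. JN N x $ i $ j) \<longlonglongrightarrow> jacobian u x $ i $ j" for i j
    unfolding wave_sum_split[OF K0] jacobian_u[OF x]
    by (intro tendsto_add tendsto_const wave_series_tendsto[OF outgoing_K(1) decays_gradient[OF outgoing_K(1) c_decays(1)] x]
        wave_series_tendsto[OF outgoing_K(2) decays_gradient[OF outgoing_K(2) c_decays(2)] x])
  show ?thesis unfolding energy_flux_def by (intro tendsto_intros 1 2)
qed

lemma truncation_bounded: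
  assumes K0: "vector [K1 (0, 0) $ 1, K1 (0, 0) $ 2, Ki $ 3] = Ki"
  obtains M where "\<And>N x. h + 1 \<le> x $ 3 \<Longrightarrow> norm (energy_flux lam mu (uN N x) (JN N x) 3) \<le> M"
proof -
  have pi: "norm (plane_wave Ki x) = 1" for x by (simp add: norm_plane_wave Ki)
  have bd: "\<exists>M\<ge>0. \<forall>N x. h + 1 \<le> x $ 3 \<longrightarrow> norm (c * plane_wave Ki x
      + (\<Sum>n\<in>modes N. a n * plane_wave (K1 n) x) + (\<Sum>n\<in>modes N. b n * plane_wave (K2 n) x)) \<le> M"
    if a: "decays h K1 a" and b: "decays h K2 b" for a b c
  proof -
    obtain M1 where M1: "M1 \<ge> 0" "\<And>N x. h + 1 \<le> x $ 3 \<Longrightarrow> norm (\<Sum>n\<in>modes N. a n * plane_wave (K1 n) x) \<le> M1"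
      by (rule wave_sum_bounded[OF outgoing_K(1) a]) blast
    obtain M2 where M2: "M2 \<ge> 0" "\<And>N x. h + 1 \<le> x $ 3 \<Longrightarrow> norm (\<Sum>n\<in>modes N. b n * plane_wave (K2 n) x) \<le> M2"
      by (rule wave_sum_bounded[OF outgoing_K(2) b]) blast
    show ?thesis
      by (intro exI[of _ "norm c + M1 + M2"] conjI allI impI norm_triangle_le add_mono M1 M2)
         (use M1 M2 in \<open>simp_all add: norm_mult pi\<close>)
  qed
  have "\<exists>M\<ge>0. \<forall>N x. h + 1 \<le> x $ 3 \<longrightarrow> norm (uN N x $ i) \<le> M" for i
    unfolding wave_sum_split[OF K0] by (rule bd[OF c_decays])
  then obtain Mu where Mu: "\<And>i. Mu i \<ge> 0" "\<And>i N x. h + 1 \<le> x $ 3 \<Longrightarrow> norm (uN N x $ i) \<le> Mu i" by metis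
  have "\<exists>M\<ge>0. \<forall>N x. h + 1 \<le> x $ 3 \<longrightarrow> norm (JN N x $ i $ j) \<le> M" for i j
    unfolding wave_sum_split[OF K0]
    by (rule bd[OF decays_gradient[OF outgoing_K(1) c_decays(1)] decays_gradient[OF outgoing_K(2) c_decays(2)]])
  then obtain MJ where MJ: "\<And>i j. MJ i j \<ge> 0" "\<And>i j N x. h + 1 \<le> x $ 3 \<Longrightarrow> norm (JN N x $ i $ j) \<le> MJ i j" by metis
  define M where "M = (\<Sum>i\<in>UNIV. Mu i) + (\<Sum>i\<in>UNIV. \<Sum>j\<in>UNIV. MJ i j)"
  have nn: "0 \<le> (\<Sum>i\<in>UNIV. Mu i)" "0 \<le> (\<Sum>i\<in>UNIV. \<Sum>j\<in>UNIV. MJ i j)" by (auto intro!: sum_nonneg Mu MJ)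
  have u: "Mu i \<le> M" for i
    using member_le_sum[of i UNIV Mu] Mu(1) nn by (simp add: M_def)
  have J: "MJ i j \<le> M" for i j
  proof -
    have "MJ i j \<le> (\<Sum>j\<in>UNIV. MJ i j)" using member_le_sum[of j UNIV "MJ i"] MJ(1) by simp
    also have "\<dots> \<le> (\<Sum>i\<in>UNIV. \<Sum>j\<in>UNIV. MJ i j)"
      using member_le_sum[of i UNIV "\<lambda>i. \<Sum>j\<in>UNIV. MJ i j"] by (simp add: MJ(1) sum_nonneg)
    finally show ?thesis using nn by (simp add: M_def)
  qed
  show thesis
  proof (rule that)
    fix N and x :: "real^3" assume x: "h + 1 \<le> x $ 3"
    show "norm (energy_flux lam mu (uN N x) (JN N x) 3) \<le> (3 * \<bar>mu\<bar> + 3 * \<bar>lam + mu\<bar>) * M\<^sup>2"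
      by (rule energy_flux_bound_components) (use Mu(2)[OF x] MJ(2)[OF x] u J in \<open>blast intro: order.trans\<close>)+
  qed
qed

lemma truncation_continuous: "continuous_on UNIV (\<lambda>x. energy_flux lam mu (uN N x) (JN N x) 3)"
  unfolding energy_flux_def uN_def JN_def vec_lambda_beta
  by (intro continuous_intros plane_wave_cont)

lemma flux_continuous: "continuous_on (half_space h) (\<lambda>x. energy_flux lam mu (u x) (jacobian u x) 3)"
proof -
  have "continuous_on (half_space h) (\<lambda>x. u x $ i)" for i using C1_on_cont[OF u_nth_C1] .
  moreover have "continuous_on (half_space h) (\<lambda>x. jacobian u x $ i $ j)" for i j
    using u_C1 by (auto simp: C1_on_def jacobian_def intro!: continuous_intros)
  ultimately show ?thesis unfolding energy_flux_def
    by (intro continuous_on_add continuous_on_mult continuous_on_sum continuous_on_const continuous_on_cnj)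
qed

end

section \<open>Conservation of energy\<close>

text \<open>The imaginary parts of the weighted fluxes of the truncated expansions converge to that of \<open>u\<close>, which
  is zero, and they are eventually constant, because only the modes in \<open>P\<close> carry energy.\<close>

lemma (in rigid_scatterer) energy_balance:
  assumes field: "rayleigh_field L1 L2 h k1 k2 al Ki A0 u a B"
    and Ki: "Ki = vector [of_real (al $ 1), of_real (al $ 2), of_real (- b)]"
    and mat: "om\<^sup>2 = (lam + 2 * mu) * k1\<^sup>2" "om\<^sup>2 = mu * k2\<^sup>2"
    and b: "beta_n L1 L2 al k1 (0, 0) = of_real b"
    and B: "\<And>n. (\<Sum>i\<in>UNIV. wave_vector L1 L2 al k2 n $ i * B n $ i) = 0"
    and P: "finite P" "\<And>n. n \<notin> P \<Longrightarrow> Re (beta_n L1 L2 al k1 n) = 0" "\<And>n. n \<notin> P \<Longrightarrow> Re (beta_n L1 L2 al k2 n) = 0"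
  shows "(\<Sum>n\<in>P. om\<^sup>2 * Re (beta_n L1 L2 al k1 n) * (norm (a n))\<^sup>2 + om\<^sup>2 * Re (beta_n L1 L2 al k2 n) * (norm (B n))\<^sup>2)
     = om\<^sup>2 * b * (norm A0)\<^sup>2"
proof -
  obtain \<eta>1 r1 \<eta>2 r2 \<tau> \<sigma> \<sigma>' where "cutoffs L1 L2 h \<eta>1 r1 \<eta>2 r2 \<tau> \<sigma> \<sigma>'" using exists_cutoffs[OF L] by blast
  then interpret C: cutoffs L1 L2 h \<eta>1 r1 \<eta>2 r2 \<tau> \<sigma> \<sigma>' .
  interpret R: rayleigh_field L1 L2 h k1 k2 al Ki A0 u a B by (rule field)
  \<comment> \<open>mode \<open>(0, 0)\<close> has the horizontal wave vector of the incident field\<close>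
  have K0: "vector [R.K1 (0, 0) $ 1, R.K1 (0, 0) $ 2, Ki $ 3] = Ki"
    by (simp add: Ki wave_vector_nth alpha_n_nth vec_eq_iff forall_3)
  have Ki3: "Ki $ 3 = - of_real b" by (simp add: Ki)
  define F where "F n = om\<^sup>2 * Re (beta_n L1 L2 al k1 n) * (norm (a n))\<^sup>2 + om\<^sup>2 * Re (beta_n L1 L2 al k2 n) * (norm (B n))\<^sup>2" for n
  define E where "E n = F n - om\<^sup>2 * b * (norm (if n = (0, 0) then A0 else 0))\<^sup>2" for n
  have wk1: "R.wk (n, t) $ 1 = of_real (alpha_n L1 L2 al n $ 1)"
    and wk2: "R.wk (n, t) $ 2 = of_real (alpha_n L1 L2 al n $ 2)" for n t
    by (auto simp: R.wk_def wave_vector_nth)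
  have re: "Im (R.wk s $ j) = 0" if "j \<noteq> 3" for s j
    using that exhaust_3[of j] wk1[of "fst s" "snd s"] wk2[of "fst s" "snd s"] by auto
  have mode: "Im (\<Sum>t\<in>UNIV. \<Sum>t'\<in>UNIV. wave_flux lam mu (R.wk (n, t)) (R.wd (n, t)) (R.wd (n, t'))
         * (plane_wave (R.wk (n, t)) x * cnj (plane_wave (R.wk (n, t')) x))) = E n" for n x
  proof -
    let ?x = "alpha_n L1 L2 al n $ 1" and ?y = "alpha_n L1 L2 al n $ 2"
    have np: "norm (plane_wave (R.wk (n, t)) x) = 1" if "Im (R.wk (n, t) $ 3) = 0" for t
      using that re by (simp add: norm_plane_wave)
    have sq: "(beta_n L1 L2 al k n)\<^sup>2 = of_real (k\<^sup>2 - ?x\<^sup>2 - ?y\<^sup>2)" if "0 \<le> k" for k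
      unfolding beta_n_squared[OF that] norm_alpha_squared by (simp add: diff_diff_eq)
    have "Im (\<Sum>t\<in>UNIV. \<Sum>t'\<in>UNIV. wave_flux lam mu (R.wk (n, t)) (R.wd (n, t)) (R.wd (n, t'))
         * (plane_wave (R.wk (n, t)) x * cnj (plane_wave (R.wk (n, t')) x)))
       = om\<^sup>2 * Re (beta_n L1 L2 al k1 n) * (norm (a n))\<^sup>2 + om\<^sup>2 * Re (beta_n L1 L2 al k2 n) * (norm (B n))\<^sup>2
         - om\<^sup>2 * b * (norm (if n = (0, 0) then A0 else 0))\<^sup>2"
    proof (rule mode_flux[OF mat, where k = "\<lambda>t. R.wk (n, t)" and d = "\<lambda>t. R.wd (n, t)" and P = "\<lambda>t. plane_wave (R.wk (n, t)) x"
          and x = ?x and y = ?y])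
      show "R.wk (n, 1) = vector [of_real ?x, of_real ?y, of_real (- b)]"
        by (simp add: R.wk_def wave_vector_nth Ki3)
      show "R.wk (n, 2) = vector [of_real ?x, of_real ?y, beta_n L1 L2 al k1 n]"
        "R.wk (n, 3) = vector [of_real ?x, of_real ?y, beta_n L1 L2 al k2 n]"
        by (simp_all add: R.wk_def wave_vector_def)
      show "(beta_n L1 L2 al k1 n)\<^sup>2 = of_real (k1\<^sup>2 - ?x\<^sup>2 - ?y\<^sup>2)" "(beta_n L1 L2 al k2 n)\<^sup>2 = of_real (k2\<^sup>2 - ?x\<^sup>2 - ?y\<^sup>2)"
        by (rule sq[OF R.k(1)], rule sq[OF R.k(2)])
      show "Im (beta_n L1 L2 al k1 n) = 0 \<or> Re (beta_n L1 L2 al k1 n) = 0" "Im (beta_n L1 L2 al k2 n) = 0 \<or> Re (beta_n L1 L2 al k2 n) = 0"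
        by (rule beta_n_real_or_imaginary)+
      show "R.wd (n, 1) = (if n = (0, 0) then A0 else 0) *s R.wk (n, 1)" "R.wd (n, 2) = (\<i> * a n) *s R.wk (n, 2)"
        "R.wd (n, 3) = transversal_polarization (R.wk (n, 3)) (B n)"
        by (simp_all add: R.wd_def)
      show "(if n = (0, 0) then A0 else 0) = 0 \<or> beta_n L1 L2 al k1 n = of_real b" using b by auto
      show "(\<Sum>i\<in>UNIV. R.wk (n, 3) $ i * B n $ i) = 0" using B[of n] by (simp add: R.wk_def)
      show "norm (plane_wave (R.wk (n, 1)) x) = 1" by (rule np) (simp add: R.wk_def R.Ki)
      show "norm (plane_wave (R.wk (n, 2)) x) = 1" if "Im (beta_n L1 L2 al k1 n) = 0"
        by (rule np) (use that in \<open>simp add: R.wk_def wave_vector_nth\<close>)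
      show "norm (plane_wave (R.wk (n, 3)) x) = 1" if "Im (beta_n L1 L2 al k2 n) = 0"
        by (rule np) (use that in \<open>simp add: R.wk_def wave_vector_nth\<close>)
    qed
    then show ?thesis by (simp add: E_def F_def)
  qed
  have lat: "lattice_shift L1 L2 (R.wk (n, t)) (R.wk (m, t'))" if "n \<noteq> m" for n m t t'
    by (rule lattice_shiftI[OF L that wk1 wk2 wk1 wk2])
  have fluxN: "Im (\<integral>x. of_real (C.\<rho> x) * energy_flux lam mu (R.uN N x) (R.JN N x) 3 \<partial>lebesgue)
      = (\<Sum>n\<in>modes N. E n) * (\<integral>x. C.\<rho> x \<partial>lebesgue)" for N
    unfolding R.uN_def R.JN_def by (rule C.integral_flux_mode_sum[OF finite_modes re lat mode])
  obtain M where M: "\<And>N x. h + 1 \<le> x $ 3 \<Longrightarrow> norm (energy_flux lam mu (R.uN N x) (R.JN N x) 3) \<le> M"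
    by (rule R.truncation_bounded[OF K0]) blast
  have lim: "(\<lambda>N. Im (\<integral>x. of_real (C.\<rho> x) * energy_flux lam mu (R.uN N x) (R.JN N x) 3 \<partial>lebesgue))
      \<longlonglongrightarrow> Im (\<integral>x. of_real (C.\<rho> x) * energy_flux lam mu (u x) (jacobian u x) 3 \<partial>lebesgue)"
    by (intro tendsto_Im C.integral_rho_tendsto[OF R.truncation_continuous R.flux_continuous R.truncation_tendsto[OF K0] M])
  have wok: "admissible_weight C.\<rho>"
    unfolding admissible_weight_def
  proof (intro conjI allI impI C.rho_cont)
    fix x :: "real^3" assume "C.\<rho> x \<noteq> 0"
    then have "x \<in> C.Z" using C.rho_off_Z by blast
    then show "- L1 \<le> x $ 1" "x $ 1 \<le> L1" "- L2 \<le> x $ 2" "x $ 2 \<le> L2" "x $ 3 \<le> h + 3"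
      by (auto simp: C.Z_def mem_box_cart forall_3)
  qed
  have "Im (\<integral>x. of_real (C.\<rho> x) * flux x 3 \<partial>lebesgue) = 0"
    unfolding C.\<rho>_def by (rule Im_flux_eq_0[OF C.cutoffs_axioms])
  moreover have "(\<integral>x. of_real (C.\<rho> x) * flux x 3 \<partial>lebesgue)
      = (\<integral>x. of_real (C.\<rho> x) * energy_flux lam mu (u x) (jacobian u x) 3 \<partial>lebesgue)"
    by (rule integral_flux_classical[OF C.rho_C1 wok C.rho_low R.u_C1])
  ultimately have "Im (\<integral>x. of_real (C.\<rho> x) * energy_flux lam mu (u x) (jacobian u x) 3 \<partial>lebesgue) = 0"
    by simp
  with lim have lim0: "(\<lambda>N. (\<Sum>n\<in>modes N. E n) * (\<integral>x. C.\<rho> x \<partial>lebesgue)) \<longlonglongrightarrow> 0"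
    by (simp add: fluxN)
  have "\<forall>\<^sub>F N in sequentially. P \<subseteq> modes N"
    using modes_exhaust P(1) unfolding filterlim_finite_subsets_at_top by (auto elim!: allE[of _ P] eventually_mono)
  then have ev: "\<forall>\<^sub>F N in sequentially. (\<Sum>n\<in>modes N. E n) * (\<integral>x. C.\<rho> x \<partial>lebesgue)
      = ((\<Sum>n\<in>P. F n) - om\<^sup>2 * b * (norm A0)\<^sup>2) * (\<integral>x. C.\<rho> x \<partial>lebesgue)"
  proof eventually_elim
    case (elim N)
    have "(\<Sum>n\<in>modes N. F n) = (\<Sum>n\<in>P. F n)"
      by (rule sum.mono_neutral_right[OF finite_modes elim]) (simp add: F_def P)
    moreover have "(\<Sum>n\<in>modes N. om\<^sup>2 * b * (norm (if n = (0, 0) then A0 else 0))\<^sup>2)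
       = (\<Sum>n\<in>{(0 :: int, 0 :: int)}. om\<^sup>2 * b * (norm (if n = (0, 0) then A0 else 0))\<^sup>2)"
      by (rule sum.mono_neutral_right[OF finite_modes]) (auto simp: modes_def)
    ultimately show ?case by (simp add: E_def sum_subtractf)
  qed
  have "(\<lambda>N::nat. ((\<Sum>n\<in>P. F n) - om\<^sup>2 * b * (norm A0)\<^sup>2) * (\<integral>x. C.\<rho> x \<partial>lebesgue)) \<longlonglongrightarrow> 0"
    by (rule tendsto_cong[OF ev, THEN iffD1, OF lim0])
  moreover have "0 < (\<integral>x. C.\<rho> x \<partial>lebesgue)" using C.integral_rho_pos[of "\<lambda>_. 1"] by simp
  ultimately have "(\<Sum>n\<in>P. F n) = om\<^sup>2 * b * (norm A0)\<^sup>2" by (simp add: LIMSEQ_const_iff)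
  then show ?thesis by (simp add: F_def)
qed

text \<open>Termwise differentiation of the expansions of the potentials. The gauge condition on \<open>\<psi>\<close> becomes the
  orthogonality of its coefficients to the wave vectors by uniqueness of Fourier coefficients.\<close>

lemma Helmholtz_potentials_wave_series:
  assumes L: "0 < L1" "0 < L2" and k: "0 \<le> k1" "0 \<le> k2"
    and pot: "helmholtz_potentials L1 L2 al k1 k2 h v \<phi> \<psi>"
    and \<phi>: "rayleigh_expansion L1 L2 al k1 h \<phi>n \<phi>"
    and \<psi>: "\<And>i. rayleigh_expansion L1 L2 al k2 h (\<lambda>n. \<psi>n n $ i) (\<lambda>x. \<psi> x $ i)"
    and a: "\<And>n. a n = \<phi>n n * exp (- \<i> * beta_n L1 L2 al k1 n * of_real h)"
    and B: "\<And>n. B n = exp (- \<i> * beta_n L1 L2 al k2 n * of_real h) *s \<psi>n n"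
  shows "decays h (wave_vector L1 L2 al k1) a" "decays h (wave_vector L1 L2 al k2) (\<lambda>n. B n $ i)"
    and "(\<Sum>i\<in>UNIV. wave_vector L1 L2 al k2 n $ i * B n $ i) = 0"
    and "x \<in> half_space h \<Longrightarrow> v x $ i = wave_series (wave_vector L1 L2 al k1) (\<lambda>n. \<i> * wave_vector L1 L2 al k1 n $ i * a n) x
       + wave_series (wave_vector L1 L2 al k2) (\<lambda>n. transversal_polarization (wave_vector L1 L2 al k2 n) (B n) $ i) x"
proof -
  define K1 where "K1 = wave_vector L1 L2 al k1"
  define K2 where "K2 = wave_vector L1 L2 al k2"
  have K: "outgoing K1" "outgoing K2" unfolding K1_def K2_def using outgoing_wave_vector k by blast+
  have a': "(\<lambda>n. \<phi>n n * exp (- \<i> * beta_n L1 L2 al k1 n * of_real h)) = a" using a by auto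
  have B': "(\<lambda>n. \<psi>n n $ i * exp (- \<i> * beta_n L1 L2 al k2 n * of_real h)) = (\<lambda>n. B n $ i)" for i
    using B by (auto simp: mult.commute)
  have da: "decays h K1 a" and sa: "\<And>x. x \<in> half_space h \<Longrightarrow> \<phi> x = wave_series K1 a x"
    using rayleigh_expansion_wave_series[OF k(1) \<phi>] unfolding a' K1_def by auto
  have dB: "decays h K2 (\<lambda>n. B n $ i)" and sB: "\<And>x. x \<in> half_space h \<Longrightarrow> \<psi> x $ i = wave_series K2 (\<lambda>n. B n $ i) x" for i
    using rayleigh_expansion_wave_series[OF k(2) \<psi>[of i]] unfolding B' K2_def by auto
  show "decays h (wave_vector L1 L2 al k1) a" "decays h (wave_vector L1 L2 al k2) (\<lambda>n. B n $ i)"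
    using da dB unfolding K1_def K2_def by auto
  have \<psi>C: "C1_on (half_space h) \<psi>" using pot by (simp add: helmholtz_potentials_def C2_on_def)
  have g\<phi>: "partial j \<phi> x = wave_series K1 (\<lambda>n. \<i> * K1 n $ j * a n) x" if x: "x \<in> half_space h" for j x
  proof -
    have "partial j \<phi> x = partial j (wave_series K1 a) x"
      by (rule partial_cong_open[OF open_half_space x sa])
    then show ?thesis unfolding partial_wave_series[OF infinite_modes K(1) da x] .
  qed
  define g where "g j i n = \<i> * K2 n $ j * B n $ i" for j i n
  have dg: "decays h K2 (g j i)" for j i unfolding g_def by (rule decays_gradient[OF K(2) dB])
  have g\<psi>: "partial j \<psi> x $ i = wave_series K2 (g j i) x" if x: "x \<in> half_space h" for j i x
  proof -
    have "partial j \<psi> x $ i = partial j (\<lambda>x. \<psi> x $ i) x"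
      using C1_on_bounded_linear(2)[OF bounded_linear_vec_nth \<psi>C x] by simp
    also have "\<dots> = partial j (wave_series K2 (\<lambda>n. B n $ i)) x"
      by (rule partial_cong_open[OF open_half_space x sB])
    also have "\<dots> = wave_series K2 (g j i) x"
      unfolding g_def by (rule partial_wave_series[OF infinite_modes K(2) dB x])
    finally show ?thesis .
  qed
  show "(\<Sum>i\<in>UNIV. wave_vector L1 L2 al k2 n $ i * B n $ i) = 0"
  proof -
    obtain \<eta>1 r1 \<eta>2 r2 \<tau> \<sigma> \<sigma>' where "cutoffs L1 L2 h \<eta>1 r1 \<eta>2 r2 \<tau> \<sigma> \<sigma>'" using exists_cutoffs[OF L] by blast
    then interpret C: cutoffs L1 L2 h \<eta>1 r1 \<eta>2 r2 \<tau> \<sigma> \<sigma>' .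
    have x0: "vector [0, 0, h + 1] \<in> half_space h" by (simp add: half_space_def)
    have "(\<lambda>n. (g 1 1 n + g 2 2 n) + g 3 3 n) n = 0"
    proof (rule C.wave_series_eq_0[OF K(2)])
      have d12: "decays h K2 (\<lambda>n. g 1 1 n + g 2 2 n)" by (rule wave_series_add(3)[OF K(2) dg dg x0])
      show "decays h K2 (\<lambda>n. (g 1 1 n + g 2 2 n) + g 3 3 n)" by (rule wave_series_add(3)[OF K(2) d12 dg x0])
      show "lattice_shift L1 L2 (K2 n) (K2 m)" if "n \<noteq> m" for n m
        by (rule lattice_shiftI[OF L that]) (simp_all add: K2_def wave_vector_nth)
      fix x assume x: "x \<in> half_space h"
      have "0 = divergence \<psi> x" using pot x by (simp add: helmholtz_potentials_def)
      also have "\<dots> = wave_series K2 (g 1 1) x + wave_series K2 (g 2 2) x + wave_series K2 (g 3 3) x"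
        by (simp add: divergence_def sum_3 g\<psi>[OF x])
      also have "\<dots> = wave_series K2 (\<lambda>n. (g 1 1 n + g 2 2 n) + g 3 3 n) x"
        by (simp only: wave_series_add(1)[OF K(2) dg dg x] wave_series_add(1)[OF K(2) d12 dg x])
      finally show "wave_series K2 (\<lambda>n. (g 1 1 n + g 2 2 n) + g 3 3 n) x = 0" by simp
    qed
    then have "\<i> * (\<Sum>i\<in>UNIV. K2 n $ i * B n $ i) = 0" by (simp add: g_def sum_3 algebra_simps)
    then show ?thesis by (simp add: K2_def)
  qed
  show "v x $ i = wave_series (wave_vector L1 L2 al k1) (\<lambda>n. \<i> * wave_vector L1 L2 al k1 n $ i * a n) x
       + wave_series (wave_vector L1 L2 al k2) (\<lambda>n. transversal_polarization (wave_vector L1 L2 al k2 n) (B n) $ i) x"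
    if x: "x \<in> half_space h"
  proof -
    have tp: "(\<lambda>n. transversal_polarization (K2 n) (B n) $ 1) = (\<lambda>n. g 2 3 n - g 3 2 n)"
      "(\<lambda>n. transversal_polarization (K2 n) (B n) $ 2) = (\<lambda>n. g 3 1 n - g 1 3 n)"
      "(\<lambda>n. transversal_polarization (K2 n) (B n) $ 3) = (\<lambda>n. g 1 2 n - g 2 1 n)"
      by (auto simp: transversal_polarization_def g_def algebra_simps)
    have "curl \<psi> x $ i = wave_series K2 (\<lambda>n. transversal_polarization (K2 n) (B n) $ i) x"
      using exhaust_3[of i] by (auto simp: curl_def g\<psi>[OF x] tp wave_series_add(2)[OF K(2) dg dg x])
    moreover have "v x = grad \<phi> x + curl \<psi> x" using pot x by (simp add: helmholtz_potentials_def)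
    ultimately show ?thesis by (simp add: grad_def g\<phi>[OF x] K1_def K2_def)
  qed
qed

theorem theorem2p2:
  fixes om lam mu th1 th2 L1 L2 h k1 k2 b :: real
    and al :: "real^2" and q :: "real^3" and a0 :: complex
    and f :: "real^2 \<Rightarrow> real"
    and u \<psi> :: "real^3 \<Rightarrow> complex^3" and \<phi> :: "real^3 \<Rightarrow> complex"
    and \<phi>n a1 e1 e2 :: "int \<times> int \<Rightarrow> complex" and \<psi>n bn :: "int \<times> int \<Rightarrow> complex^3"
    and U1 U2 :: "(int \<times> int) set"
  assumes periods: "0 < L1" "0 < L2"
    and surface: "\<exists>C. C-lipschitz_on UNIV f" "biperiodic L1 L2 f"
    and height: "\<forall>r. f r < h"
    and material: "0 < om" "0 < mu" "0 < lam + mu"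
    and angles: "0 \<le> th1" "th1 < pi / 2" "0 \<le> th2" "th2 \<le> 2 * pi"
    and k1: "k1 = om / sqrt (lam + 2 * mu)"
    and k2: "k2 = om / sqrt mu"
    and q: "q = inc_direction th1 th2"
    and al: "al = vector [k1 * sin th1 * cos th2, k1 * sin th1 * sin th2]"
    and b: "b = k1 * cos th1"
    and nonresonant: "\<forall>n. norm (alpha_n L1 L2 al n) \<noteq> k1 \<and> norm (alpha_n L1 L2 al n) \<noteq> k2"
    and solution: "rigid_surface_solution lam mu om L1 L2 al f u"
    and potentials: "helmholtz_potentials L1 L2 al k1 k2 h (\<lambda>x. u x - inc_field k1 q x) \<phi> \<psi>"
    and radiation_\<phi>: "rayleigh_expansion L1 L2 al k1 h \<phi>n \<phi>"
    and radiation_\<psi>: "\<forall>i. rayleigh_expansion L1 L2 al k2 h (\<lambda>n. \<psi>n n $ i) (\<lambda>x. \<psi> x $ i)"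
    and a0: "a0 = - \<i> / of_real k1"
    and a1: "\<forall>n. a1 n = \<phi>n n * exp (- \<i> * beta_n L1 L2 al k1 n * of_real h)"
    and bn: "\<forall>n. bn n = exp (- \<i> * beta_n L1 L2 al k2 n * of_real h) *s \<psi>n n"
    and e1: "\<forall>n. e1 n = efficiency b a0 (beta_n L1 L2 al k1 n) (a1 n)"
    and e2: "\<forall>n. e2 n = efficiency b a0 (beta_n L1 L2 al k2 n) (bn n)"
    and U1: "U1 = {n. norm (alpha_n L1 L2 al n) \<le> k1}"
    and U2: "U2 = {n. norm (alpha_n L1 L2 al n) \<le> k2}"
  shows "(\<Sum>n\<in>U1. e1 n) + (\<Sum>n\<in>U2. e2 n) = 1"
proof -
  have lm: "0 < lam + 2 * mu" using material by simp
  have kpos: "0 < k1" "0 < k2" using material lm by (simp_all add: k1 k2)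
  have mat: "om\<^sup>2 = (lam + 2 * mu) * k1\<^sup>2" "om\<^sup>2 = mu * k2\<^sup>2"
    using lm material by (simp_all add: k1 k2 power_divide)
  have cos: "0 < cos th1" using angles by (intro cos_gt_zero_pi) auto
  have bpos: "0 < b" using kpos cos by (simp add: b)
  obtain G where G: "G \<in> borel_measurable (lebesgue_on (region_above f))"
      "\<And>i j. quasi_biperiodic L1 L2 al (region_above f) (\<lambda>x. G x $ i $ j)"
      "weak_jacobian (region_above f) u G"
      "\<And>c. (\<And>r. f r < c) \<Longrightarrow> H1_cell L1 L2 f c u G \<and> zero_on_surface L1 L2 al f c u G"
      "weak_navier lam mu om (region_above f) u G"
    using solution unfolding rigid_surface_solution_def by blast
  interpret rigid_scatterer lam mu om L1 L2 h al f u G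
    by unfold_locales (use periods surface height solution G in \<open>auto simp: rigid_surface_solution_def\<close>)
  define Ki :: "complex^3" where "Ki = vector [of_real (al $ 1), of_real (al $ 2), of_real (- b)]"
  \<comment> \<open>the incident field is \<open>q = k1 q / k1\<close> times a plane wave with wave vector \<open>k1 q\<close>\<close>
  define A0 where "A0 = 1 / complex_of_real k1"
  have Kq: "Ki $ i = of_real (k1 * q $ i)" for i
    using exhaust_3[of i] by (auto simp: Ki_def q al b inc_direction_def)
  have inc: "inc_field k1 q x $ i = A0 * Ki $ i * plane_wave Ki x" for x i
    using kpos by (simp add: inc_field_def A0_def Kq plane_wave_def inner_vec_def sum_3 algebra_simps)
  note H = Helmholtz_potentials_wave_series[OF periods less_imp_le[OF kpos(1)] less_imp_le[OF kpos(2)]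
      potentials radiation_\<phi> radiation_\<psi>[rule_format] a1[rule_format] bn[rule_format]]
  have field: "rayleigh_field L1 L2 h k1 k2 al Ki A0 u a1 bn"
  proof
    show "Im (Ki $ j) = 0" for j by (simp add: Kq)
    show "u x $ i = A0 * Ki $ i * plane_wave Ki x
       + wave_series (wave_vector L1 L2 al k1) (\<lambda>n. \<i> * wave_vector L1 L2 al k1 n $ i * a1 n) x
       + wave_series (wave_vector L1 L2 al k2) (\<lambda>n. transversal_polarization (wave_vector L1 L2 al k2 n) (bn n) $ i) x"
      if "x \<in> half_space h" for x i
      using H(4)[OF that, of i] by (simp add: inc algebra_simps)
  qed (use kpos H in auto)
  have b0: "beta_n L1 L2 al k1 (0, 0) = of_real b"
  proof -
    have al0: "alpha_n L1 L2 al (0, 0) = al" by (simp add: vec_eq_iff forall_2 alpha_n_nth)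
    have "(norm al)\<^sup>2 = (al $ 1)\<^sup>2 + (al $ 2)\<^sup>2"
      using norm_alpha_squared[of L1 L2 al "(0, 0)"] unfolding al0 .
    also have "\<dots> = (k1 * sin th1)\<^sup>2 * ((cos th2)\<^sup>2 + (sin th2)\<^sup>2)"
      by (simp only: al vector_2 power_mult_distrib distrib_left)
    finally have n2: "(norm al)\<^sup>2 = (k1 * sin th1)\<^sup>2" by simp
    have d: "k1\<^sup>2 - (norm al)\<^sup>2 = b\<^sup>2"
      unfolding n2 b power_mult_distrib cos_squared_eq by (simp add: algebra_simps)
    then have "(norm al)\<^sup>2 < k1\<^sup>2" using bpos by (smt (verit) zero_less_power2)
    then have "norm al < k1" using kpos by (simp add: power2_less_imp_less)
    then show ?thesis using d bpos by (simp add: beta_n_def al0)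
  qed
  have fin: "finite U1" "finite U2" unfolding U1 U2 by (rule finite_propagating[OF periods])+
  have out: "n \<notin> U1 \<Longrightarrow> Re (beta_n L1 L2 al k1 n) = 0" "n \<notin> U2 \<Longrightarrow> Re (beta_n L1 L2 al k2 n) = 0" for n
    by (auto simp: U1 U2 beta_n_def)
  have real: "n \<in> U1 \<Longrightarrow> beta_n L1 L2 al k1 n = of_real (Re (beta_n L1 L2 al k1 n))"
    "n \<in> U2 \<Longrightarrow> beta_n L1 L2 al k2 n = of_real (Re (beta_n L1 L2 al k2 n))" for n
    using nonresonant by (auto simp: U1 U2 beta_n_def order.order_iff_strict)
  define F1 where "F1 n = Re (beta_n L1 L2 al k1 n) * (norm (a1 n))\<^sup>2" for n
  define F2 where "F2 n = Re (beta_n L1 L2 al k2 n) * (norm (bn n))\<^sup>2" for n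
  have "(\<Sum>n\<in>U1 \<union> U2. om\<^sup>2 * Re (beta_n L1 L2 al k1 n) * (norm (a1 n))\<^sup>2 + om\<^sup>2 * Re (beta_n L1 L2 al k2 n) * (norm (bn n))\<^sup>2)
     = om\<^sup>2 * b * (norm A0)\<^sup>2"
    by (rule energy_balance[OF field Ki_def mat b0 H(3)]) (use fin out in auto)
  then have "om\<^sup>2 * (\<Sum>n\<in>U1 \<union> U2. F1 n + F2 n) = om\<^sup>2 * (b * (norm A0)\<^sup>2)"
    by (simp add: F1_def F2_def sum_distrib_left distrib_left mult.assoc)
  then have "(\<Sum>n\<in>U1 \<union> U2. F1 n) + (\<Sum>n\<in>U1 \<union> U2. F2 n) = b * (norm A0)\<^sup>2"
    using material by (simp add: sum.distrib)
  moreover have "(\<Sum>n\<in>U1 \<union> U2. F1 n) = (\<Sum>n\<in>U1. F1 n)" "(\<Sum>n\<in>U1 \<union> U2. F2 n) = (\<Sum>n\<in>U2. F2 n)"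
    by (rule sum.mono_neutral_right; use fin out in \<open>auto simp: F1_def F2_def\<close>)+
  moreover have nA: "norm A0 = norm a0" using kpos by (simp add: A0_def a0 norm_divide)
  ultimately have bal: "(\<Sum>n\<in>U1. F1 n) + (\<Sum>n\<in>U2. F2 n) = b * (norm a0)\<^sup>2" by simp
  have D: "b * (norm a0)\<^sup>2 \<noteq> 0" using bpos kpos by (simp add: a0)
  have E1: "(\<Sum>n\<in>U1. e1 n) = of_real ((\<Sum>n\<in>U1. F1 n) / (b * (norm a0)\<^sup>2))"
    unfolding sum_divide_distrib of_real_sum
  proof (rule sum.cong[OF refl])
    fix n assume "n \<in> U1"
    then show "e1 n = of_real (F1 n / (b * (norm a0)\<^sup>2))"
      using e1 real(1)[of n] unfolding efficiency_def F1_def by (metis of_real_divide of_real_mult)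
  qed
  have E2: "(\<Sum>n\<in>U2. e2 n) = of_real ((\<Sum>n\<in>U2. F2 n) / (b * (norm a0)\<^sup>2))"
    unfolding sum_divide_distrib of_real_sum
  proof (rule sum.cong[OF refl])
    fix n assume "n \<in> U2"
    then show "e2 n = of_real (F2 n / (b * (norm a0)\<^sup>2))"
      using e2 real(2)[of n] unfolding efficiency_def F2_def by (metis of_real_divide of_real_mult)
  qed
  show ?thesis
    unfolding E1 E2 of_real_add[symmetric] add_divide_distrib[symmetric] bal using D by simp
qed

end
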